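(* Let $\mathcal{E}$ be a Dirichlet form in $L^2=L^2(X,m)$, with time-dependent approximations $\mathcal{E}^{(t)}$, $t>0$, and Deny–Yosida approximations $\mathcal{E}^{(\beta)}$, $\beta>0$. (a) The conservative part of $\mathcal{E}$ is the Mosco limit, as $t\downarrow0$, of the conservative part of $\mathcal{E}^{(t)}$, whereas its dissipative part is the Mosco limit, as $t\downarrow0$, of the dissipative part of $\mathcal{E}^{(t)}$. (b) The conservative part of $\mathcal{E}$ is the Mosco limit, as $\beta\uparrow\infty$, of the conservative part of $\mathcal{E}^{(\beta)}$, whereas its dissipative part is the Mosco limit, as $\beta\uparrow\infty$, of the dissipative part of $\mathcal{E}^{(\beta)}$.
   Context: $X$ is a Hausdorff topological space and $m$ is a positive $\sigma$-finite Radon measure on a $\sigma$-algebra $\mathcal{A}$ of subsets of $X$, with full support $X$; $L^p=L^p(X,m)$. All equalities and inequalities of functions and sets are understood $m$-a.e. $(\cdot,\cdot)$ is the scalar product of $L^2$. A Dirichlet form $\mathcal{E}$ with domain $\mathcal{D}\subset L^2$ is a (symmetric, nonnegative) densely defined closed quadratic form such that $u\in\mathcal{D}$ implies $u_{0,1}:=\min(\max(u,0),1)\in\mathcal{D}$ and $\mathcal{E}[u_{0,1}]\le\mathcal{E}[u]$. With $L$ the nonnegative selfadjoint operator of $\mathcal{E}$, its semigroup is $T_t=e^{-tL}$ and its resolvent is $K_\beta=(L+\beta)^{-1}$. The semigroup extends to $L^\infty$: choose $\varphi_k\in L^1\cap L^\infty$ with $0<\varphi_k\le1$, $\varphi_k\uparrow1$;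 for $0\le u\in L^\infty$ put $T_tu=\lim_kT_t(u\varphi_k)$, and $T_tu=T_tu^+-T_tu^-$ in general. For $t>0$: $\mathrm{dom}(\mathcal{E}^{(t)})=L^2$, $\mathcal{E}^{(t)}[u]=\frac1t(u-T_tu,u)$. For $\beta>0$: $\mathrm{dom}(\mathcal{E}^{(\beta)})=L^2$, $\mathcal{E}^{(\beta)}[u]=\beta(u-\beta K_\beta u,u)$. Both are bounded Dirichlet forms in $L^2$. For any Dirichlet form $Q$ in $L^2$ with domain $\mathrm{dom}(Q)$ and semigroup $(P_s)_{s>0}$ (extended to $L^\infty$ in the same way), put $X_{\mathrm{cons}}(Q)=\bigcap_{s>0}\{P_s1=1\}=\bigcap_{k\ge1}\{P_k1=1\}$ ($k$ integer; up to null sets via the countable expression) and $X_{\mathrm{diss}}(Q)=X\setminus X_{\mathrm{cons}}(Q)$. These sets are invariant, i.e. multiplication by their indicator functions commutes with all $P_s$ and maps $\mathrm{dom}(Q)$ into itself. The conservative (resp. dissipative) part of $Q$ is the form with domain $\{1_Yu:u\in\mathrm{dom}(Q)\}$ and value $Q[1_Yu]$ at $1_Yu$, where $Y=X_{\mathrm{cons}}(Q)$ (resp. $Y=X_{\mathrm{diss}}(Q)$); it is a Dirichlet form in $L^2(Y,m|_Y)$, identified with $\{u\in L^2:u=0\text{ on }X\setminus Y\}$. Mosco convergence in the Hilbert space $L^2$: forms are extended by $+\infty$ outside their domains; $(a_n)$ Mosco-converges to $a_\infty$ if (M1) $u_n\to u$ weakly implies $\liminf_na_n[u_n]\ge a_\infty[u]$,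 and (M2) for every $u$ there is $(u_n)$ with $u_n\to u$ and $\limsup_na_n[u_n]\le a_\infty[u]$. Convergence as $t\downarrow0$ or $\beta\uparrow\infty$ means convergence along every sequence $t_n\downarrow0$ or $\beta_n\uparrow\infty$. *)

theory Defs
  imports "HOL-Analysis.Analysis"
begin

text \<open>
  The sigma-algebra of \<open>m\<close> may be larger than the Borel one, as long as \<open>m\<close> stays inner regular
  with respect to compact sets on all of it.
\<close>
definition radon_measure :: "'a::t2_space measure \<Rightarrow> bool" where
  "radon_measure m \<longleftrightarrow>
     space m = UNIV \<and> sets borel \<subseteq> sets m \<and>
     (\<forall>x. \<exists>U. open U \<and> x \<in> U \<and> emeasure m U < \<infinity>) \<and>
     (\<forall>A\<in>sets m. emeasure m A = (SUP K\<in>{K. compact K \<and> K \<subseteq> A}. emeasure m K))"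

definition full_support :: "'a::topological_space measure \<Rightarrow> bool" where
  "full_support m \<longleftrightarrow> (\<forall>U. open U \<longrightarrow> U \<noteq> {} \<longrightarrow> emeasure m U > 0)"


section \<open>The real Hilbert space \<open>L\<^sup>2\<close>\<close>

text \<open>
  Elements of \<open>L\<^sup>2\<close> are represented by functions; functions that agree almost everywhere stand for
  the same element. Everything below is compatible with this identification.
\<close>
definition L2 :: "'a measure \<Rightarrow> ('a \<Rightarrow> real) set" where
  "L2 m = {u. u \<in> borel_measurable m \<and> integrable m (\<lambda>x. (u x)\<^sup>2)}"

definition L2_inner :: "'a measure \<Rightarrow> ('a \<Rightarrow> real) \<Rightarrow> ('a \<Rightarrow> real) \<Rightarrow> real" where
  "L2_inner m u v = (\<integral>x. u x * v x \<partial>m)"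

definition L2_norm :: "'a measure \<Rightarrow> ('a \<Rightarrow> real) \<Rightarrow> real" where
  "L2_norm m u = sqrt (L2_inner m u u)"

definition L2_lim :: "'a measure \<Rightarrow> (nat \<Rightarrow> 'a \<Rightarrow> real) \<Rightarrow> ('a \<Rightarrow> real) \<Rightarrow> bool" where
  "L2_lim m u w \<longleftrightarrow> (\<lambda>n. L2_norm m (\<lambda>x. u n x - w x)) \<longlonglongrightarrow> 0"

definition L2_weak_lim :: "'a measure \<Rightarrow> (nat \<Rightarrow> 'a \<Rightarrow> real) \<Rightarrow> ('a \<Rightarrow> real) \<Rightarrow> bool" where
  "L2_weak_lim m u w \<longleftrightarrow> (\<forall>v\<in>L2 m. (\<lambda>n. L2_inner m (u n) v) \<longlonglongrightarrow> L2_inner m w v)"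


section \<open>Dirichlet forms\<close>

text \<open>A form is its domain together with its values; values off the domain are irrelevant.\<close>
record 'a qform =
  qdom :: "('a \<Rightarrow> real) set"
  qval :: "('a \<Rightarrow> real) \<Rightarrow> real"

definition qbil :: "'a qform \<Rightarrow> ('a \<Rightarrow> real) \<Rightarrow> ('a \<Rightarrow> real) \<Rightarrow> real" where
  "qbil Q u v = (qval Q (\<lambda>x. u x + v x) - qval Q (\<lambda>x. u x - v x)) / 4"

definition quadratic_form :: "'a measure \<Rightarrow> 'a qform \<Rightarrow> bool" where
  "quadratic_form m Q \<longleftrightarrow>
     qdom Q \<subseteq> L2 m \<and>
     (\<lambda>x. 0) \<in> qdom Q \<and>
     (\<forall>u\<in>qdom Q. \<forall>v\<in>qdom Q. (\<lambda>x. u x + v x) \<in> qdom Q) \<and>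
     (\<forall>c. \<forall>u\<in>qdom Q. (\<lambda>x. c * u x) \<in> qdom Q) \<and>
     (\<forall>u\<in>qdom Q. \<forall>v\<in>L2 m. (AE x in m. u x = v x) \<longrightarrow> v \<in> qdom Q \<and> qval Q v = qval Q u) \<and>
     (\<forall>c. \<forall>u\<in>qdom Q. qval Q (\<lambda>x. c * u x) = c\<^sup>2 * qval Q u) \<and>
     (\<forall>u\<in>qdom Q. \<forall>v\<in>qdom Q. \<forall>w\<in>qdom Q.
        qbil Q (\<lambda>x. u x + v x) w = qbil Q u w + qbil Q v w) \<and>
     (\<forall>c. \<forall>u\<in>qdom Q. \<forall>w\<in>qdom Q. qbil Q (\<lambda>x. c * u x) w = c * qbil Q u w)"

definition densely_defined :: "'a measure \<Rightarrow> 'a qform \<Rightarrow> bool" where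
  "densely_defined m Q \<longleftrightarrow>
     (\<forall>f\<in>L2 m. \<forall>\<epsilon>>0. \<exists>u\<in>qdom Q. L2_norm m (\<lambda>x. f x - u x) < \<epsilon>)"

text \<open>Squared form norm, for which the domain of a closed form is complete.\<close>
definition form_norm_sq :: "'a measure \<Rightarrow> 'a qform \<Rightarrow> ('a \<Rightarrow> real) \<Rightarrow> real" where
  "form_norm_sq m Q u = qval Q u + (L2_norm m u)\<^sup>2"

definition closed_form :: "'a measure \<Rightarrow> 'a qform \<Rightarrow> bool" where
  "closed_form m Q \<longleftrightarrow>
     (\<forall>u::nat \<Rightarrow> 'a \<Rightarrow> real.
        (\<forall>n. u n \<in> qdom Q) \<longrightarrow>
        (\<forall>\<epsilon>>0. \<exists>N. \<forall>i\<ge>N. \<forall>j\<ge>N. form_norm_sq m Q (\<lambda>x. u i x - u j x) < \<epsilon>) \<longrightarrow>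
        (\<exists>w\<in>qdom Q. (\<lambda>n. form_norm_sq m Q (\<lambda>x. u n x - w x)) \<longlonglongrightarrow> 0))"

definition dirichlet_form :: "'a measure \<Rightarrow> 'a qform \<Rightarrow> bool" where
  "dirichlet_form m Q \<longleftrightarrow>
     quadratic_form m Q \<and>
     (\<forall>u\<in>qdom Q. 0 \<le> qval Q u) \<and>
     densely_defined m Q \<and>
     closed_form m Q \<and>
     (\<forall>u\<in>qdom Q. (\<lambda>x. min (max (u x) 0) 1) \<in> qdom Q \<and>
                   qval Q (\<lambda>x. min (max (u x) 0) 1) \<le> qval Q u)"


section \<open>Operator, resolvent and semigroup of a form\<close>

text \<open>
  The graph of the selfadjoint operator \<open>L\<close> of \<open>Q\<close>, as in the first representation theorem:
  \<open>u \<in> dom L\<close> and \<open>L u = f\<close>.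
\<close>
definition form_op :: "'a measure \<Rightarrow> 'a qform \<Rightarrow> ('a \<Rightarrow> real) \<Rightarrow> ('a \<Rightarrow> real) \<Rightarrow> bool" where
  "form_op m Q u f \<longleftrightarrow>
     u \<in> qdom Q \<and> f \<in> L2 m \<and> (\<forall>v\<in>qdom Q. qbil Q u v = L2_inner m f v)"

text \<open>\<open>(L + \<beta>)\<^sup>-\<^sup>1 f\<close>: the choice is unique up to null sets.\<close>
definition form_resolvent :: "'a measure \<Rightarrow> 'a qform \<Rightarrow> real \<Rightarrow> ('a \<Rightarrow> real) \<Rightarrow> ('a \<Rightarrow> real)" where
  "form_resolvent m Q \<beta> f =
     (SOME u. \<exists>g. form_op m Q u g \<and> (AE x in m. g x + \<beta> * u x = f x))"

definition contraction_semigroup ::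
  "'a measure \<Rightarrow> (real \<Rightarrow> ('a \<Rightarrow> real) \<Rightarrow> ('a \<Rightarrow> real)) \<Rightarrow> bool" where
  "contraction_semigroup m T \<longleftrightarrow>
     (\<forall>t\<ge>0. \<forall>f\<in>L2 m. T t f \<in> L2 m \<and> L2_norm m (T t f) \<le> L2_norm m f) \<and>
     (\<forall>t\<ge>0. \<forall>f\<in>L2 m. \<forall>g\<in>L2 m. AE x in m. T t (\<lambda>y. f y + g y) x = T t f x + T t g x) \<and>
     (\<forall>t\<ge>0. \<forall>c. \<forall>f\<in>L2 m. AE x in m. T t (\<lambda>y. c * f y) x = c * T t f x) \<and>
     (\<forall>f\<in>L2 m. AE x in m. T 0 f x = f x) \<and>
     (\<forall>s\<ge>0. \<forall>t\<ge>0. \<forall>f\<in>L2 m. AE x in m. T (s + t) f x = T s (T t f) x) \<and>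
     (\<forall>f\<in>L2 m. ((\<lambda>t. L2_norm m (\<lambda>x. T t f x - f x)) \<longlongrightarrow> 0) (at_right 0))"

text \<open>
  \<open>exp (- t L)\<close>, understood as the strongly continuous contraction semigroup with generator
  \<open>- L\<close> (including equality of domains). It is unique up to null sets.
\<close>
definition is_form_semigroup ::
  "'a measure \<Rightarrow> 'a qform \<Rightarrow> (real \<Rightarrow> ('a \<Rightarrow> real) \<Rightarrow> ('a \<Rightarrow> real)) \<Rightarrow> bool" where
  "is_form_semigroup m Q T \<longleftrightarrow>
     contraction_semigroup m T \<and>
     (\<forall>u\<in>L2 m. \<forall>f\<in>L2 m. form_op m Q u f \<longleftrightarrow>
        ((\<lambda>h. L2_norm m (\<lambda>x. (u x - T h u x) / h - f x)) \<longlongrightarrow> 0) (at_right 0))"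

definition form_semigroup ::
  "'a measure \<Rightarrow> 'a qform \<Rightarrow> real \<Rightarrow> ('a \<Rightarrow> real) \<Rightarrow> ('a \<Rightarrow> real)" where
  "form_semigroup m Q = (SOME T. is_form_semigroup m Q T)"

text \<open>
  An exhausting sequence in \<open>L\<^sup>1 \<inter> L\<^sup>\<infinity>\<close>. It exists as \<open>m\<close> is \<open>\<sigma>\<close>-finite, and the extension of a
  Dirichlet form's semigroup to \<open>L\<^sup>\<infinity>\<close> does not depend on the choice, up to null sets.
\<close>
definition is_cutoff_seq :: "'a measure \<Rightarrow> (nat \<Rightarrow> 'a \<Rightarrow> real) \<Rightarrow> bool" where
  "is_cutoff_seq m \<phi> \<longleftrightarrow>
     (\<forall>k. integrable m (\<phi> k)) \<and>
     (\<forall>x\<in>space m. (\<forall>k. 0 < \<phi> k x \<and> \<phi> k x \<le> 1 \<and> \<phi> k x \<le> \<phi> (Suc k) x) \<and>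
                    (\<lambda>k. \<phi> k x) \<longlonglongrightarrow> 1)"

definition cutoff_seq :: "'a measure \<Rightarrow> nat \<Rightarrow> 'a \<Rightarrow> real" where
  "cutoff_seq m = (SOME \<phi>. is_cutoff_seq m \<phi>)"

definition semigroup_Linf ::
  "'a measure \<Rightarrow> 'a qform \<Rightarrow> real \<Rightarrow> ('a \<Rightarrow> real) \<Rightarrow> ('a \<Rightarrow> real)" where
  "semigroup_Linf m Q t u x =
     lim (\<lambda>k. form_semigroup m Q t (\<lambda>y. max (u y) 0 * cutoff_seq m k y) x) -
     lim (\<lambda>k. form_semigroup m Q t (\<lambda>y. max (- u y) 0 * cutoff_seq m k y) x)"


section \<open>Approximating forms\<close>

definition time_approx :: "'a measure \<Rightarrow> 'a qform \<Rightarrow> real \<Rightarrow> 'a qform" where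
  "time_approx m Q t =
     \<lparr>qdom = L2 m,
      qval = (\<lambda>u. 1 / t * L2_inner m (\<lambda>x. u x - form_semigroup m Q t u x) u)\<rparr>"

definition deny_yosida_approx :: "'a measure \<Rightarrow> 'a qform \<Rightarrow> real \<Rightarrow> 'a qform" where
  "deny_yosida_approx m Q \<beta> =
     \<lparr>qdom = L2 m,
      qval = (\<lambda>u. \<beta> * L2_inner m (\<lambda>x. u x - \<beta> * form_resolvent m Q \<beta> u x) u)\<rparr>"


section \<open>Conservative and dissipative parts\<close>

definition X_cons :: "'a measure \<Rightarrow> 'a qform \<Rightarrow> 'a set" where
  "X_cons m Q = (\<Inter>k\<in>{1::nat..}. {x \<in> space m. semigroup_Linf m Q (real k) (\<lambda>y. 1) x = 1})"

definition X_diss :: "'a measure \<Rightarrow> 'a qform \<Rightarrow> 'a set" where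
  "X_diss m Q = space m - X_cons m Q"

text \<open>
  The part of \<open>Q\<close> on an invariant set \<open>Y\<close>, as a form on the subspace of functions vanishing off
  \<open>Y\<close>. Members of its domain are a.e. of the form \<open>1\<^sub>Y u\<close>, so taking the value of \<open>Q\<close> is right.
\<close>
definition form_part :: "'a measure \<Rightarrow> 'a set \<Rightarrow> 'a qform \<Rightarrow> 'a qform" where
  "form_part m Y Q =
     \<lparr>qdom = {v \<in> L2 m. \<exists>u\<in>qdom Q. AE x in m. v x = indicator Y x * u x},
      qval = qval Q\<rparr>"

definition conservative_part :: "'a measure \<Rightarrow> 'a qform \<Rightarrow> 'a qform" where
  "conservative_part m Q = form_part m (X_cons m Q) Q"

definition dissipative_part :: "'a measure \<Rightarrow> 'a qform \<Rightarrow> 'a qform" where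
  "dissipative_part m Q = form_part m (X_diss m Q) Q"


section \<open>Mosco convergence\<close>

definition qext :: "'a qform \<Rightarrow> ('a \<Rightarrow> real) \<Rightarrow> ereal" where
  "qext Q u = (if u \<in> qdom Q then ereal (qval Q u) else \<infinity>)"

definition mosco_converges :: "'a measure \<Rightarrow> (nat \<Rightarrow> 'a qform) \<Rightarrow> 'a qform \<Rightarrow> bool" where
  "mosco_converges m a b \<longleftrightarrow>
     (\<forall>u w. (\<forall>n. u n \<in> L2 m) \<longrightarrow> w \<in> L2 m \<longrightarrow> L2_weak_lim m u w \<longrightarrow>
        qext b w \<le> liminf (\<lambda>n. qext (a n) (u n))) \<and>
     (\<forall>w\<in>L2 m. \<exists>u. (\<forall>n. u n \<in> L2 m) \<and> L2_lim m u w \<and>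
        limsup (\<lambda>n. qext (a n) (u n)) \<le> qext b w)"

definition mosco_at_zero :: "'a measure \<Rightarrow> (real \<Rightarrow> 'a qform) \<Rightarrow> 'a qform \<Rightarrow> bool" where
  "mosco_at_zero m a b \<longleftrightarrow>
     (\<forall>t::nat \<Rightarrow> real. (\<forall>n. 0 < t n) \<longrightarrow> t \<longlonglongrightarrow> 0 \<longrightarrow> mosco_converges m (\<lambda>n. a (t n)) b)"

definition mosco_at_infinity :: "'a measure \<Rightarrow> (real \<Rightarrow> 'a qform) \<Rightarrow> 'a qform \<Rightarrow> bool" where
  "mosco_at_infinity m a b \<longleftrightarrow>
     (\<forall>\<beta>::nat \<Rightarrow> real. (\<forall>n. 0 < \<beta> n) \<longrightarrow> filterlim \<beta> at_top sequentially \<longrightarrow>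
        mosco_converges m (\<lambda>n. a (\<beta> n)) b)"

end

theory Submission
  imports Defs "HOL-Library.Function_Algebras"
begin

text \<open>Write \<open>J\<^sub>h = (1 + h L)\<^sup>-\<^sup>1 = \<beta> K\<^sub>\<beta>\<close> with \<open>\<beta> = 1 / h\<close>. The theorem rests on three facts.

  The approximating forms increase to \<open>\<E>\<close>. The Deny--Yosida form is the Moreau envelope
  \<open>min\<^sub>v (\<E>[v] + \<beta> \<parallel>u - v\<parallel>\<^sup>2)\<close>, which visibly increases in \<open>\<beta>\<close> and stays below \<open>\<E>[u]\<close>; if it
  stays bounded, the minimisers \<open>J\<^sub>h u\<close> are Cauchy for the form norm, so \<open>u\<close> lies in the
  domain (\<open>env_bounded_imp_dom\<close>). The form \<open>(u - T\<^sub>t u, u) / t\<close> increases as \<open>t\<close> decreases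
  because \<open>t \<mapsto> (T\<^sub>t u, u)\<close> is convex (\<open>tform_mono\<close>), and testing it against \<open>J\<^sub>h u\<close> reduces
  the question about its limit to envelopes (\<open>tform_bounded_imp_dom\<close>). Each approximating
  form is continuous and convex, hence weakly lower semicontinuous, and so an increasing
  family of them satisfies the lower bound of Mosco convergence, while constant sequences
  give the upper bound.

  All conservative sets agree up to null sets. By symmetry, a nonnegative \<open>f \<in> L\<^sup>1 \<inter> L\<^sup>2\<close>
  vanishes off \<open>X\<^sub>c\<^sub>o\<^sub>n\<^sub>s\<close> if and only if \<open>\<integral> P\<^sub>s f = \<integral> f\<close> for all \<open>s\<close> (\<open>conserved_iff_X_cons\<close>),
  so sets are compared through the masses \<open>\<integral> P\<^sub>s f\<close>. As \<open>J\<^sub>h f\<close> is the average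
  \<open>\<integral> h\<^sup>-\<^sup>1 e\<^sup>-\<^sup>s\<^sup>/\<^sup>h T\<^sub>s f ds\<close>, mass is preserved by the semigroup exactly when it is preserved by
  one resolvent operator (\<open>conserved_iff_J\<close>). If \<open>S\<close> is symmetric and Markov, the semigroup
  of the bounded form \<open>c (u - S u, u)\<close> preserves the mass of \<open>f\<close> exactly when every power of
  \<open>S\<close> does (\<open>conserved_bform_iff\<close>). The powers of \<open>T\<^sub>t\<close> are the \<open>T\<^sub>n\<^sub>t\<close>, and \<open>J\<^sub>h\<close> commutes with
  the semigroup, so for \<open>S = T\<^sub>t\<close> and \<open>S = J\<^sub>h\<close> the criterion is the one for \<open>\<E>\<close>.

  The conservative set is invariant: \<open>T\<^sub>t\<close> maps functions living on it to such functions,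
  hence by symmetry respects its complement too, and \<open>(u - T\<^sub>t u, u)\<close> splits into two
  nonnegative parts. Therefore multiplication by its indicator does not leave the domain
  (\<open>invariant_set_domain\<close>), and Mosco convergence of the full forms passes to the parts
  (\<open>mosco_part\<close>).

  The semigroup itself is obtained as the limit of the implicit Euler scheme \<open>J\<^sub>t\<^sub>/\<^sub>n\<^sup>n\<close>, and
  any semigroup with generator \<open>- L\<close> is such a limit; this also transfers symmetry and the
  Markov property from the resolvent, which inherits them from the variational problem that
  defines it. To work with equations rather than identities almost everywhere, \<open>L\<^sup>2\<close> is
  realised on a linear choice of representatives.\<close>

section \<open>Real vector spaces of functions\<close>

instantiation "fun" :: (type, real_vector) real_vector
begin

definition scaleR_fun :: "real \<Rightarrow> ('a \<Rightarrow> 'b) \<Rightarrow> 'a \<Rightarrow> 'b" where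
  "scaleR_fun c f = (\<lambda>x. c *\<^sub>R f x)"

instance
  by standard (simp_all add: scaleR_fun_def fun_eq_iff scaleR_add_right scaleR_add_left)

end

section \<open>Semi-inner products and the Riesz representation theorem\<close>

lemma quadratic_nonneg_linear_zero:
  fixes a c :: real
  assumes "\<And>s. 0 \<le> s\<^sup>2 * a + 2 * s * c"
  shows "c = 0"
proof (rule ccontr)
  assume c: "c \<noteq> 0"
  show False
  proof (cases "a \<le> 0")
    case True
    have "0 \<le> (- c)\<^sup>2 * a + 2 * (- c) * c" using assms .
    moreover have "(- c)\<^sup>2 * a \<le> 0" using True by (simp add: mult_nonneg_nonpos)
    moreover have "2 * (- c) * c < 0" using c by (simp add: power2_eq_square[symmetric])
    ultimately show False by linarith
  next
    case False
    \<comment> \<open>the minimum of the quadratic in \<open>s\<close>\<close>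
    have "0 \<le> (- c / a)\<^sup>2 * a + 2 * (- c / a) * c" using assms .
    also have "\<dots> = - c\<^sup>2 / a" using False by (simp add: field_simps power2_eq_square)
    finally show False using False c by (simp add: divide_le_0_iff zero_le_divide_iff)
  qed
qed

text \<open>Two instances matter: the whole Hilbert space, and the domain of a form with the
  energy inner product \<open>h b + (\<cdot>, \<cdot>)\<close>, where nothing is known about the form off its domain.\<close>
locale semi_inner_on =
  fixes V :: "'b::real_vector set" and c :: "'b \<Rightarrow> 'b \<Rightarrow> real"
  assumes subsp: "subspace V"
    and c_add: "\<And>x y z. x \<in> V \<Longrightarrow> y \<in> V \<Longrightarrow> z \<in> V \<Longrightarrow> c (x + y) z = c x z + c y z"
    and c_scale: "\<And>r x z. x \<in> V \<Longrightarrow> z \<in> V \<Longrightarrow> c (r *\<^sub>R x) z = r * c x z"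
    and c_sym: "\<And>x y. x \<in> V \<Longrightarrow> y \<in> V \<Longrightarrow> c x y = c y x"
    and c_nonneg: "\<And>x. x \<in> V \<Longrightarrow> 0 \<le> c x x"
begin

lemma V_add [simp]: "x \<in> V \<Longrightarrow> y \<in> V \<Longrightarrow> x + y \<in> V"
  and V_diff [simp]: "x \<in> V \<Longrightarrow> y \<in> V \<Longrightarrow> x - y \<in> V"
  and V_scale [simp]: "x \<in> V \<Longrightarrow> r *\<^sub>R x \<in> V"
  and V_zero [simp]: "0 \<in> V"
  and V_minus [simp]: "x \<in> V \<Longrightarrow> - x \<in> V"
  using subsp by (auto simp: subspace_add subspace_diff subspace_scale subspace_0 subspace_neg)

lemma c_minus: "x \<in> V \<Longrightarrow> z \<in> V \<Longrightarrow> c (- x) z = - c x z"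
  using c_scale[of x z "-1"] by simp

lemma c_diff: "x \<in> V \<Longrightarrow> y \<in> V \<Longrightarrow> z \<in> V \<Longrightarrow> c (x - y) z = c x z - c y z"
  using c_add[of x "- y" z] c_minus by simp

lemma c_add_right: "x \<in> V \<Longrightarrow> y \<in> V \<Longrightarrow> z \<in> V \<Longrightarrow> c z (x + y) = c z x + c z y"
  by (metis c_add c_sym V_add)

lemma c_diff_right: "x \<in> V \<Longrightarrow> y \<in> V \<Longrightarrow> z \<in> V \<Longrightarrow> c z (x - y) = c z x - c z y"
  by (metis c_diff c_sym V_diff)

lemma c_scale_right: "x \<in> V \<Longrightarrow> z \<in> V \<Longrightarrow> c z (r *\<^sub>R x) = r * c z x"
  by (metis c_scale c_sym V_scale)

lemmas c_bilin = c_add c_add_right c_diff c_diff_right c_scale c_scale_right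

lemma c_cauchy_schwarz:
  assumes x: "x \<in> V" and y: "y \<in> V"
  shows "(c x y)\<^sup>2 \<le> c x x * c y y"
proof -
  have q: "0 \<le> c x x + 2 * s * c x y + s\<^sup>2 * c y y" for s
  proof -
    have "0 \<le> c (x + s *\<^sub>R y) (x + s *\<^sub>R y)" using x y by (intro c_nonneg) auto
    also have "\<dots> = c x x + 2 * s * c x y + s\<^sup>2 * c y y"
      using x y by (simp add: c_bilin c_sym[of y x] power2_eq_square algebra_simps)
    finally show ?thesis .
  qed
  show ?thesis
  proof (cases "c y y = 0")
    case True
    have "c x y = 0"
    proof (rule ccontr)
      assume n: "c x y \<noteq> 0"
      have "0 \<le> c x x + 2 * (- (c x x + 1) / (2 * c x y)) * c x y" using q[of "- (c x x + 1) / (2 * c x y)"] True by simp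
      also have "\<dots> = -1" using n by (simp add: field_simps)
      finally show False by simp
    qed
    then show ?thesis using True by simp
  next
    case False
    then have pos: "c y y > 0" using c_nonneg[OF y] by simp
    have "0 \<le> c x x + 2 * (- c x y / c y y) * c x y + (- c x y / c y y)\<^sup>2 * c y y" by (rule q)
    also have "\<dots> = c x x - (c x y)\<^sup>2 / c y y" using pos by (simp add: field_simps power2_eq_square)
    finally show ?thesis using pos by (simp add: field_simps)
  qed
qed

lemma c_abs_le: "x \<in> V \<Longrightarrow> y \<in> V \<Longrightarrow> \<bar>c x y\<bar> \<le> sqrt (c x x) * sqrt (c y y)"
  using c_cauchy_schwarz[of x y] by (metis real_sqrt_abs real_sqrt_le_iff real_sqrt_mult)

text \<open>The minimiser of \<open>c v v - 2 l v\<close> represents \<open>l\<close>. A minimising sequence is Cauchy by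
  the parallelogram identity, and the first variation vanishes at its limit.\<close>
lemma riesz_representation:
  assumes complete: "\<And>u :: nat \<Rightarrow> 'b. (\<And>n. u n \<in> V) \<Longrightarrow>
        (\<And>\<epsilon>. 0 < \<epsilon> \<Longrightarrow> \<exists>N. \<forall>i\<ge>N. \<forall>j\<ge>N. c (u i - u j) (u i - u j) < \<epsilon>) \<Longrightarrow>
        \<exists>w\<in>V. (\<lambda>n. c (u n - w) (u n - w)) \<longlonglongrightarrow> 0"
    and l_add: "\<And>x y. x \<in> V \<Longrightarrow> y \<in> V \<Longrightarrow> l (x + y) = l x + l y"
    and l_scale: "\<And>r x. x \<in> V \<Longrightarrow> l (r *\<^sub>R x) = r * l x"
    and l_bound: "\<And>x. x \<in> V \<Longrightarrow> \<bar>l x\<bar> \<le> K * sqrt (c x x)"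
  shows "\<exists>w\<in>V. \<forall>v\<in>V. c w v = l v"
proof -
  define G where "G v = c v v - 2 * l v" for v
  have bdd: "- K\<^sup>2 \<le> G v" if v: "v \<in> V" for v
  proof -
    have "c v v = (sqrt (c v v))\<^sup>2" using c_nonneg[OF v] by simp
    moreover have "l v \<le> K * sqrt (c v v)" using l_bound[OF v] by simp
    moreover have "0 \<le> (sqrt (c v v) - K)\<^sup>2" by simp
    ultimately show ?thesis unfolding G_def power2_diff by (simp add: algebra_simps)
  qed
  define I where "I = Inf (G ` V)"
  have bb: "bdd_below (G ` V)" unfolding bdd_below_def using bdd by blast
  have IG: "I \<le> G v" if "v \<in> V" for v
    unfolding I_def using bb that by (intro cInf_lower) auto
  have "\<exists>v\<in>V. G v < I + 1 / (real n + 1)" for n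
  proof -
    have "Inf (G ` V) < I + 1 / (real n + 1)" unfolding I_def by simp
    then show ?thesis by (subst (asm) cInf_less_iff) (use bb subspace_0[OF subsp] in blast)+
  qed
  then obtain u where uV: "\<And>n. u n \<in> V" and uG: "\<And>n. G (u n) < I + 1 / (real n + 1)" by metis
  have par: "c (x - y) (x - y) = 2 * G x + 2 * G y - 4 * G ((1/2) *\<^sub>R (x + y))"
    if "x \<in> V" "y \<in> V" for x y
    unfolding G_def using that
    by (simp add: c_bilin l_add l_scale c_sym[of y x] algebra_simps)
  have cau: "\<exists>N. \<forall>i\<ge>N. \<forall>j\<ge>N. c (u i - u j) (u i - u j) < \<epsilon>" if eps: "\<epsilon> > 0" for \<epsilon>
  proof -
    obtain N where N: "1 / (real N + 1) < \<epsilon> / 4"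
      using reals_Archimedean[of "\<epsilon> / 4"] eps by (auto simp: inverse_eq_divide add.commute)
    have "c (u i - u j) (u i - u j) < \<epsilon>" if "i \<ge> N" "j \<ge> N" for i j
    proof -
      have "1 / (real i + 1) \<le> 1 / (real N + 1)" "1 / (real j + 1) \<le> 1 / (real N + 1)"
        using that by (simp_all add: frac_le)
      moreover have "I \<le> G ((1/2) *\<^sub>R (u i + u j))" using uV by (intro IG) auto
      ultimately show ?thesis using par[OF uV uV, of i j] uG[of i] uG[of j] N by linarith
    qed
    then show ?thesis by blast
  qed
  obtain w where wV: "w \<in> V" and w: "(\<lambda>n. c (u n - w) (u n - w)) \<longlonglongrightarrow> 0"
    using complete[OF uV cau] by blast
  have "c w v = l v" if v: "v \<in> V" for v
  proof -
    have lim: "(\<lambda>n. c (u n) v) \<longlonglongrightarrow> c w v"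
    proof -
      have "(\<lambda>n. sqrt (c (u n - w) (u n - w)) * sqrt (c v v)) \<longlonglongrightarrow> sqrt 0 * sqrt (c v v)"
        by (intro tendsto_intros w)
      then have "(\<lambda>n. c (u n - w) v) \<longlonglongrightarrow> 0"
        by (rule_tac Lim_null_comparison[rotated], simp)
          (intro always_eventually allI, use c_abs_le uV wV v in simp)
      then have "(\<lambda>n. c (u n - w) v + c w v) \<longlonglongrightarrow> 0 + c w v" by (intro tendsto_intros)
      then show ?thesis using uV wV v by (simp add: c_diff)
    qed
    have "0 \<le> s\<^sup>2 * c v v + 2 * s * (c w v - l v)" for s
    proof (rule LIMSEQ_le_const)
      show "(\<lambda>n. s\<^sup>2 * c v v + 2 * s * (c (u n) v - l v) + 1 / (real n + 1)) \<longlonglongrightarrow> s\<^sup>2 * c v v + 2 * s * (c w v - l v)"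
        using tendsto_add[OF tendsto_add[OF tendsto_const[of "s\<^sup>2 * c v v"] tendsto_mult[OF tendsto_const[of "2 * s"] tendsto_diff[OF lim tendsto_const[of "l v"]]]] LIMSEQ_inverse_real_of_nat]
        by (simp add: inverse_eq_divide add.commute)
      have "0 \<le> s\<^sup>2 * c v v + 2 * s * (c (u n) v - l v) + 1 / (real n + 1)" for n
      proof -
        have "G (u n) - 1 / (real n + 1) \<le> G (u n + s *\<^sub>R v)" using uG[of n] IG[of "u n + s *\<^sub>R v"] uV v by force
        also have "\<dots> = G (u n) + (s\<^sup>2 * c v v + 2 * s * (c (u n) v - l v))"
          unfolding G_def using uV[of n] v
          by (simp add: c_bilin l_add l_scale c_sym[of v "u n"] power2_eq_square algebra_simps)
        finally show ?thesis by simp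
      qed
      then show "\<exists>N. \<forall>n\<ge>N. 0 \<le> s\<^sup>2 * c v v + 2 * s * (c (u n) v - l v) + 1 / (real n + 1)" by blast
    qed
    from quadratic_nonneg_linear_zero[OF this] show ?thesis by simp
  qed
  then show ?thesis using wV by blast
qed

end

section \<open>Hilbert spaces of representatives\<close>

text \<open>In \<open>L\<^sup>2\<close> vectors are functions modulo null functions. The linear projection \<open>P\<close> selects
  one vector in each class, so that on its range null differences are zero and operator
  identities are equations. The semi-inner product is total, which spares membership
  conditions in bilinear expansions.\<close>
locale hilbert_rep =
  fixes ip :: "'b::real_vector \<Rightarrow> 'b \<Rightarrow> real" and P :: "'b \<Rightarrow> 'b"
  assumes ip_add: "ip (x + y) z = ip x z + ip y z"
    and ip_scale: "ip (r *\<^sub>R x) z = r * ip x z"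
    and ip_sym: "ip x y = ip y x"
    and ip_nonneg [simp]: "0 \<le> ip x x"
    and P_linear: "linear P"
    and P_equiv: "ip (P x - x) (P x - x) = 0"
    and P_null: "ip x x = 0 \<Longrightarrow> P x = 0"
    and ip_complete: "\<And>u :: nat \<Rightarrow> 'b.
        (\<And>\<epsilon>. 0 < \<epsilon> \<Longrightarrow> \<exists>N. \<forall>i\<ge>N. \<forall>j\<ge>N. ip (u i - u j) (u i - u j) < \<epsilon>) \<Longrightarrow>
        \<exists>w. (\<lambda>n. ip (u n - w) (u n - w)) \<longlonglongrightarrow> 0"
begin

sublocale semi_inner_on UNIV ip
  by standard (auto simp: ip_add ip_scale intro: ip_sym)

lemma ip_diff: "ip (x - y) z = ip x z - ip y z" by (rule c_diff) auto
lemma ip_minus: "ip (- x) z = - ip x z" by (rule c_minus) auto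
lemma ip_add_right: "ip z (x + y) = ip z x + ip z y" by (rule c_add_right) auto
lemma ip_diff_right: "ip z (x - y) = ip z x - ip z y" by (rule c_diff_right) auto
lemma ip_scale_right: "ip z (r *\<^sub>R x) = r * ip z x" by (rule c_scale_right) auto
lemmas ip_bilin = ip_add ip_add_right ip_diff ip_diff_right ip_scale ip_scale_right

definition nm :: "'b \<Rightarrow> real" where "nm x = sqrt (ip x x)"

lemma nm_nonneg [simp]: "0 \<le> nm x" by (simp add: nm_def)
lemma nm_square: "(nm x)\<^sup>2 = ip x x" by (simp add: nm_def)
lemma ip_self: "ip x x = (nm x)\<^sup>2" by (simp add: nm_square)
lemma ip_abs_le: "\<bar>ip x y\<bar> \<le> nm x * nm y" unfolding nm_def by (rule c_abs_le) auto
lemma ip_le: "ip x y \<le> nm x * nm y" using ip_abs_le[of x y] by linarith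

lemma ip_zero [simp]: "ip 0 x = 0" using ip_scale[of 0 0 x] by simp
lemma ip_zero_right [simp]: "ip x 0 = 0" by (simp add: ip_sym[of x])
lemma nm_zero [simp]: "nm 0 = 0" by (simp add: nm_def)
lemma nm_scale: "nm (r *\<^sub>R x) = \<bar>r\<bar> * nm x"
  unfolding nm_def by (simp add: ip_bilin real_sqrt_mult mult.assoc[symmetric])
lemma nm_minus_commute: "nm (x - y) = nm (y - x)"
  unfolding nm_def by (simp add: ip_bilin)

lemma nm_triangle: "nm (x + y) \<le> nm x + nm y"
proof -
  have "(nm (x + y))\<^sup>2 \<le> (nm x + nm y)\<^sup>2"
    unfolding power2_sum nm_square using ip_le[of x y] by (simp add: ip_bilin ip_sym[of y x] algebra_simps)
  then show ?thesis by (rule power2_le_imp_le) simp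
qed

lemma nm_triangle_diff: "nm (x - z) \<le> nm (x - y) + nm (y - z)"
  using nm_triangle[of "x - y" "y - z"] by simp

lemma nm_diff_le: "nm (x - y) \<le> nm x + nm y"
  using nm_triangle_diff[of x y 0] nm_minus_commute[of 0 y] by simp

lemma ip_null: "ip x x = 0 \<Longrightarrow> ip x y = 0"
  using ip_abs_le[of x y] by (simp add: nm_def)

lemma P_add [simp]: "P (x + y) = P x + P y" using P_linear by (rule linear_add)
lemma P_diff [simp]: "P (x - y) = P x - P y" using P_linear by (rule linear_diff)
lemma P_scale [simp]: "P (r *\<^sub>R x) = r *\<^sub>R P x" using P_linear by (rule linear_scale)
lemma P_zero [simp]: "P 0 = 0" using P_linear by (rule linear_0)

lemma P_idem [simp]: "P (P x) = P x"
  using P_null[OF P_equiv, of x] by simp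

lemma ip_P [simp]: "ip (P x) y = ip x y"
  using ip_null[OF P_equiv, of x y] by (simp add: ip_diff)
lemma ip_P_right [simp]: "ip y (P x) = ip y x" using ip_P[of x y] by (simp only: ip_sym[of y])
lemma nm_P_diff [simp]: "nm (P x - y) = nm (x - y)" and nm_P_diff' [simp]: "nm (y - P x) = nm (y - x)"
  and nm_P [simp]: "nm (P x) = nm x"
  unfolding nm_def by (simp_all add: ip_bilin)

lemma P_eqI: "nm (x - y) = 0 \<Longrightarrow> P x = P y"
  using P_null[of "x - y"] by (simp add: nm_def)

lemma rep_eqI: "P x = x \<Longrightarrow> P y = y \<Longrightarrow> nm (x - y) = 0 \<Longrightarrow> x = y"
  by (metis P_eqI)

lemma rep_eqI_ip:
  assumes "P x = x" "P y = y" "\<And>w. ip x w = ip y w" shows "x = y"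
  using assms(1,2) by (rule rep_eqI) (simp add: nm_def ip_diff assms(3)[of "x - y"])

lemma nm_complete:
  assumes "\<And>\<epsilon>. 0 < \<epsilon> \<Longrightarrow> \<exists>N. \<forall>i\<ge>N. \<forall>j\<ge>N. nm (u i - u j) < \<epsilon>"
  shows "\<exists>w. P w = w \<and> (\<lambda>n. nm (u n - w)) \<longlonglongrightarrow> 0"
proof -
  have "\<exists>N. \<forall>i\<ge>N. \<forall>j\<ge>N. ip (u i - u j) (u i - u j) < \<epsilon>" if "\<epsilon> > 0" for \<epsilon>
  proof -
    have "sqrt \<epsilon> > 0" using that by simp
    from assms[OF this] show ?thesis unfolding nm_def by simp
  qed
  from ip_complete[OF this] obtain w where w: "(\<lambda>n. ip (u n - w) (u n - w)) \<longlonglongrightarrow> 0" by blast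
  have "(\<lambda>n. sqrt (ip (u n - w) (u n - w))) \<longlonglongrightarrow> sqrt 0" by (intro tendsto_intros w)
  then have "(\<lambda>n. nm (u n - P w)) \<longlonglongrightarrow> 0" unfolding nm_P_diff' by (simp only: nm_def real_sqrt_zero)
  then show ?thesis using P_idem by blast
qed

lemma limit_unique:
  assumes "P x = x" "P y = y" "F \<noteq> bot" "((\<lambda>n. nm (u n - x)) \<longlongrightarrow> 0) F" "((\<lambda>n. nm (u n - y)) \<longlongrightarrow> 0) F"
  shows "x = y"
proof (rule rep_eqI[OF assms(1,2)])
  have "((\<lambda>n. nm (u n - x) + nm (u n - y)) \<longlongrightarrow> 0 + 0) F" by (intro tendsto_intros assms)
  then have "nm (x - y) \<le> 0 + 0"
  proof (rule tendsto_lowerbound[OF _ always_eventually assms(3)], intro allI)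
    show "nm (x - y) \<le> nm (u n - x) + nm (u n - y)" for n
      using nm_triangle_diff[of x y "u n"] nm_minus_commute[of x "u n"] by simp
  qed
  then show "nm (x - y) = 0" using nm_nonneg[of "x - y"] by linarith
qed

lemma tendsto_ip:
  assumes "((\<lambda>n. nm (u n - x)) \<longlongrightarrow> 0) F"
  shows "((\<lambda>n. ip (u n) z) \<longlongrightarrow> ip x z) F"
proof -
  have "((\<lambda>n. nm (u n - x) * nm z) \<longlongrightarrow> 0 * nm z) F" by (intro tendsto_intros assms)
  then have "((\<lambda>n. ip (u n) z - ip x z) \<longlongrightarrow> 0) F"
    by (rule_tac Lim_null_comparison[rotated], simp)
      (intro always_eventually allI, simp add: ip_diff[symmetric] ip_abs_le)
  then show ?thesis by (simp add: Lim_null[symmetric])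
qed

lemma tendsto_nm:
  assumes "((\<lambda>n. nm (u n - x)) \<longlongrightarrow> 0) F"
  shows "((\<lambda>n. nm (u n)) \<longlongrightarrow> nm x) F"
proof -
  have "\<bar>nm (u n) - nm x\<bar> \<le> nm (u n - x)" for n
    using nm_triangle[of "u n - x" x] nm_triangle[of "x - u n" "u n"] nm_minus_commute[of x "u n"] by simp
  then have "((\<lambda>n. nm (u n) - nm x) \<longlongrightarrow> 0) F"
    by (intro Lim_null_comparison[OF _ assms]) (auto intro!: always_eventually)
  then show ?thesis by (simp add: Lim_null[symmetric])
qed

end

section \<open>Resolvents of closed forms\<close>

locale form_space = hilbert_rep ip P for ip :: "'b::real_vector \<Rightarrow> 'b \<Rightarrow> real" and P +
  fixes D :: "'b set" and b :: "'b \<Rightarrow> 'b \<Rightarrow> real"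
  assumes D_subspace: "subspace D"
    and D_rep: "x \<in> D \<Longrightarrow> P x = x"
    and b_add': "\<And>x y z. x \<in> D \<Longrightarrow> y \<in> D \<Longrightarrow> z \<in> D \<Longrightarrow> b (x + y) z = b x z + b y z"
    and b_scale': "\<And>r x z. x \<in> D \<Longrightarrow> z \<in> D \<Longrightarrow> b (r *\<^sub>R x) z = r * b x z"
    and b_sym': "\<And>x y. x \<in> D \<Longrightarrow> y \<in> D \<Longrightarrow> b x y = b y x"
    and b_nonneg': "\<And>x. x \<in> D \<Longrightarrow> 0 \<le> b x x"
    and D_dense: "\<And>x \<epsilon>. 0 < \<epsilon> \<Longrightarrow> \<exists>u\<in>D. nm (x - u) < \<epsilon>"
    and b_closed: "\<And>u :: nat \<Rightarrow> 'b. (\<And>n. u n \<in> D) \<Longrightarrow>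
        (\<And>\<epsilon>. 0 < \<epsilon> \<Longrightarrow> \<exists>N. \<forall>i\<ge>N. \<forall>j\<ge>N. b (u i - u j) (u i - u j) + ip (u i - u j) (u i - u j) < \<epsilon>) \<Longrightarrow>
        \<exists>w\<in>D. (\<lambda>n. b (u n - w) (u n - w) + ip (u n - w) (u n - w)) \<longlonglongrightarrow> 0"
begin

sublocale dom: semi_inner_on D b
  by standard (use D_subspace b_add' b_scale' b_sym' b_nonneg' in auto)

lemma semi_inner_on_energy:
  assumes "0 < h" shows "semi_inner_on D (\<lambda>x y. h * b x y + ip x y)"
proof
  show "subspace D" by (rule D_subspace)
  show "h * b x y + ip x y = h * b y x + ip y x" if "x \<in> D" "y \<in> D" for x y
    using b_sym'[OF that] ip_sym[of x y] by simp
  show "0 \<le> h * b x x + ip x x" if "x \<in> D" for x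
    using b_nonneg'[OF that] assms by simp
qed (simp_all add: b_add' b_scale' ip_bilin algebra_simps)

text \<open>Closedness of \<open>b\<close> says that \<open>D\<close> is complete for the energy inner product, as
  \<open>h b + (\<cdot>, \<cdot>)\<close> and \<open>b + (\<cdot>, \<cdot>)\<close> are equivalent; on \<open>D\<close> the functional \<open>(f, \<cdot>)\<close> is bounded.\<close>
lemma resolvent_exists:
  assumes h: "0 < h"
  shows "\<exists>u\<in>D. \<forall>v\<in>D. h * b u v + ip u v = ip f v"
proof -
  interpret e: semi_inner_on D "\<lambda>x y. h * b x y + ip x y" by (rule semi_inner_on_energy[OF h])
  have lower: "b x x + ip x x \<le> (1 + 1 / h) * (h * b x x + ip x x)" if "x \<in> D" for x
    using b_nonneg'[OF that] ip_nonneg[of x] h by (simp add: field_simps)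
  have upper: "h * b x x + ip x x \<le> (1 + h) * (b x x + ip x x)" if "x \<in> D" for x
    using b_nonneg'[OF that] ip_nonneg[of x] h by (simp add: field_simps)
  show ?thesis
  proof (rule e.riesz_representation[where K = "nm f"])
    fix u :: "nat \<Rightarrow> 'b"
    assume u: "\<And>n. u n \<in> D"
      and cau: "\<And>\<epsilon>. 0 < \<epsilon> \<Longrightarrow> \<exists>N. \<forall>i\<ge>N. \<forall>j\<ge>N. h * b (u i - u j) (u i - u j) + ip (u i - u j) (u i - u j) < \<epsilon>"
    have "\<exists>w\<in>D. (\<lambda>n. b (u n - w) (u n - w) + ip (u n - w) (u n - w)) \<longlonglongrightarrow> 0"
    proof (rule b_closed[OF u])
      fix \<epsilon> :: real assume "\<epsilon> > 0"
      then have "\<epsilon> / (1 + 1 / h) > 0" using h by (simp add: add_pos_pos)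
      from cau[OF this] obtain N where N: "\<And>i j. i \<ge> N \<Longrightarrow> j \<ge> N \<Longrightarrow>
          h * b (u i - u j) (u i - u j) + ip (u i - u j) (u i - u j) < \<epsilon> / (1 + 1 / h)" by blast
      have "b (u i - u j) (u i - u j) + ip (u i - u j) (u i - u j) < \<epsilon>" if "i \<ge> N" "j \<ge> N" for i j
      proof -
        have "b (u i - u j) (u i - u j) + ip (u i - u j) (u i - u j)
            \<le> (1 + 1 / h) * (h * b (u i - u j) (u i - u j) + ip (u i - u j) (u i - u j))"
          using u by (intro lower) auto
        also have "\<dots> < (1 + 1 / h) * (\<epsilon> / (1 + 1 / h))"
          using N[OF that] h by (intro mult_strict_left_mono) (auto simp: add_pos_pos)
        also have "\<dots> = \<epsilon>"
        proof -
          have "1 + 1 / h \<noteq> 0" using h by (smt (verit) zero_less_divide_1_iff)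
          then show ?thesis by simp
        qed
        finally show ?thesis .
      qed
      then show "\<exists>N. \<forall>i\<ge>N. \<forall>j\<ge>N. b (u i - u j) (u i - u j) + ip (u i - u j) (u i - u j) < \<epsilon>" by blast
    qed
    then obtain w where w: "w \<in> D" "(\<lambda>n. b (u n - w) (u n - w) + ip (u n - w) (u n - w)) \<longlonglongrightarrow> 0" by blast
    have "(\<lambda>n. h * b (u n - w) (u n - w) + ip (u n - w) (u n - w)) \<longlonglongrightarrow> 0"
    proof (rule Lim_null_comparison)
      show "(\<lambda>n. (1 + h) * (b (u n - w) (u n - w) + ip (u n - w) (u n - w))) \<longlonglongrightarrow> 0"
        using tendsto_mult_right_zero[OF w(2)] .
      show "\<forall>\<^sub>F n in sequentially. norm (h * b (u n - w) (u n - w) + ip (u n - w) (u n - w))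
          \<le> (1 + h) * (b (u n - w) (u n - w) + ip (u n - w) (u n - w))"
      proof (intro always_eventually allI)
        fix n
        have "u n - w \<in> D" using u w by simp
        then show "norm (h * b (u n - w) (u n - w) + ip (u n - w) (u n - w))
          \<le> (1 + h) * (b (u n - w) (u n - w) + ip (u n - w) (u n - w))"
          using upper[of "u n - w"] e.c_nonneg[of "u n - w"] by simp
      qed
    qed
    then show "\<exists>w\<in>D. (\<lambda>n. h * b (u n - w) (u n - w) + ip (u n - w) (u n - w)) \<longlonglongrightarrow> 0" using w by blast
  next
    fix x assume x: "x \<in> D"
    have "nm x \<le> sqrt (h * b x x + ip x x)"
      unfolding nm_def using b_nonneg'[OF x] h by simp
    then have "nm f * nm x \<le> nm f * sqrt (h * b x x + ip x x)" by (rule mult_left_mono) simp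
    then show "\<bar>ip f x\<bar> \<le> nm f * sqrt (h * b x x + ip x x)" using ip_abs_le[of f x] by linarith
  qed (simp_all add: ip_bilin)
qed

text \<open>\<open>J h\<close> is \<open>(1 + h L)\<^sup>-\<^sup>1\<close>, that is \<open>\<beta> K\<^sub>\<beta>\<close> for \<open>\<beta> = 1 / h\<close>.\<close>
definition J :: "real \<Rightarrow> 'b \<Rightarrow> 'b" where
  "J h f = (SOME u. u \<in> D \<and> (\<forall>v\<in>D. h * b u v + ip u v = ip f v))"

lemma J_works: "0 < h \<Longrightarrow> J h f \<in> D \<and> (\<forall>v\<in>D. h * b (J h f) v + ip (J h f) v = ip f v)"
  unfolding J_def by (rule someI_ex) (use resolvent_exists in blast)

lemma J_in [simp]: "0 < h \<Longrightarrow> J h f \<in> D"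
  and J_eq: "0 < h \<Longrightarrow> v \<in> D \<Longrightarrow> h * b (J h f) v + ip (J h f) v = ip f v"
  using J_works by blast+

lemma P_J [simp]: "0 < h \<Longrightarrow> P (J h f) = J h f" by (simp add: D_rep)

lemma J_unique:
  assumes h: "0 < h" and u: "u \<in> D" and eq: "\<And>v. v \<in> D \<Longrightarrow> h * b u v + ip u v = ip f v"
  shows "J h f = u"
proof (rule rep_eqI)
  let ?d = "J h f - u"
  have d: "?d \<in> D" using h u by simp
  have "h * b ?d ?d + ip ?d ?d = (h * b (J h f) ?d + ip (J h f) ?d) - (h * b u ?d + ip u ?d)"
    using h u by (simp add: dom.c_diff ip_diff algebra_simps)
  also have "\<dots> = 0" using J_eq[OF h d] eq[OF d] by simp
  finally have "ip ?d ?d \<le> 0" using dom.c_nonneg[OF d] h by (smt (verit) mult_nonneg_nonneg)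
  then show "nm ?d = 0" using ip_nonneg[of ?d] by (simp add: nm_def)
qed (use h u D_rep in auto)

lemma J_add: assumes "0 < h" shows "J h (f + g) = J h f + J h g"
proof (rule J_unique[OF assms])
  fix v assume v: "v \<in> D"
  show "h * b (J h f + J h g) v + ip (J h f + J h g) v = ip (f + g) v"
    using J_eq[OF assms v, of f] J_eq[OF assms v, of g] v assms by (simp add: dom.c_add ip_add algebra_simps)
qed (use assms in simp)

lemma J_scale: assumes "0 < h" shows "J h (r *\<^sub>R f) = r *\<^sub>R J h f"
proof (rule J_unique[OF assms])
  fix v assume v: "v \<in> D"
  have "h * b (r *\<^sub>R J h f) v + ip (r *\<^sub>R J h f) v = r * (h * b (J h f) v + ip (J h f) v)"
    using v assms by (simp add: dom.c_scale ip_scale algebra_simps)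
  then show "h * b (r *\<^sub>R J h f) v + ip (r *\<^sub>R J h f) v = ip (r *\<^sub>R f) v"
    using J_eq[OF assms v, of f] by (simp add: ip_scale)
qed (use assms in simp)

lemma J_diff: "0 < h \<Longrightarrow> J h (f - g) = J h f - J h g"
  using J_add[of h f "(-1) *\<^sub>R g"] J_scale[of h "-1" g] by simp

lemma J_P [simp]: "0 < h \<Longrightarrow> J h (P f) = J h f"
  by (rule J_unique) (auto simp: J_eq)

lemma J_sym: assumes h: "0 < h" shows "ip (J h f) g = ip f (J h g)"
proof -
  have "ip (J h f) g = ip g (J h f)" by (rule ip_sym)
  also have "\<dots> = h * b (J h g) (J h f) + ip (J h g) (J h f)" using h by (simp add: J_eq)
  also have "\<dots> = h * b (J h f) (J h g) + ip (J h f) (J h g)"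
    using h by (simp add: dom.c_sym[of "J h g"] ip_sym[of "J h g"])
  also have "\<dots> = ip f (J h g)" using h by (simp add: J_eq)
  finally show ?thesis .
qed

lemma J_energy: "0 < h \<Longrightarrow> ip f (J h f) = h * b (J h f) (J h f) + ip (J h f) (J h f)"
  by (simp add: J_eq)

lemma J_ip_ge: "0 < h \<Longrightarrow> ip (J h f) (J h f) \<le> ip f (J h f)"
  using J_energy[of h f] dom.c_nonneg[of "J h f"] by simp

lemma nm_J_le: assumes "0 < h" shows "nm (J h f) \<le> nm f"
proof -
  have "(nm (J h f))\<^sup>2 \<le> nm f * nm (J h f)"
    using J_ip_ge[OF assms, of f] ip_le[of f "J h f"] by (simp add: nm_square)
  then show ?thesis
    by (smt (verit) mult_le_cancel_right nm_nonneg power2_eq_square)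
qed

text \<open>The graph of the operator \<open>L\<close>.\<close>
definition gen :: "'b \<Rightarrow> 'b \<Rightarrow> bool" where
  "gen x f \<longleftrightarrow> x \<in> D \<and> P f = f \<and> (\<forall>v\<in>D. b x v = ip f v)"

lemma gen_dom: "gen x f \<Longrightarrow> x \<in> D" and gen_P: "gen x f \<Longrightarrow> P x = x" and gen_P': "gen x f \<Longrightarrow> P f = f"
  and gen_b: "gen x f \<Longrightarrow> v \<in> D \<Longrightarrow> b x v = ip f v"
  unfolding gen_def using D_rep by auto

lemma gen_J: "0 < h \<Longrightarrow> gen (J h f) ((1 / h) *\<^sub>R (P f - J h f))"
  unfolding gen_def by (auto simp: ip_bilin J_eq[of h _ f, symmetric])

lemma J_gen_eq: "0 < h \<Longrightarrow> gen x f \<Longrightarrow> J h (x + h *\<^sub>R f) = x"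
  by (rule J_unique) (auto simp: gen_def ip_bilin)

text \<open>That is, \<open>(1 - J\<^sub>h) x = h J\<^sub>h L x\<close>: one Euler step moves a vector of the domain by
  \<open>O(h)\<close>.\<close>
lemma gen_resolvent: "0 < h \<Longrightarrow> gen x f \<Longrightarrow> x - J h x = h *\<^sub>R J h f"
  using J_gen_eq[of h x f] by (simp add: J_add J_scale algebra_simps)

lemma gen_add: "gen x f \<Longrightarrow> gen y g \<Longrightarrow> gen (x + y) (f + g)"
  and gen_scale: "gen x f \<Longrightarrow> gen (r *\<^sub>R x) (r *\<^sub>R f)"
  unfolding gen_def by (auto simp: dom.c_add dom.c_scale ip_bilin)

lemma gen_diff: "gen x f \<Longrightarrow> gen y g \<Longrightarrow> gen (x - y) (f - g)"
  using gen_add[of x f "(-1) *\<^sub>R y" "(-1) *\<^sub>R g"] gen_scale[of y g "-1"] by simp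

lemma gen_J_comm: assumes h: "0 < h" and g: "gen x f" shows "gen (J h x) (J h f)"
proof -
  have "(1 / h) *\<^sub>R (P x - J h x) = J h f"
    using gen_resolvent[OF h g] h gen_P[OF g] by simp
  then show ?thesis using gen_J[OF h, of x] by simp
qed

lemma J_commute: assumes h: "0 < h" and k: "0 < k" shows "J h (J k f) = J k (J h f)"
proof -
  have "gen (J k (J h f)) (J k ((1 / h) *\<^sub>R (P f - J h f)))"
    by (rule gen_J_comm[OF k gen_J[OF h]])
  then have "gen (J k (J h f)) ((1 / h) *\<^sub>R (J k f - J k (J h f)))"
    using k by (simp add: J_scale J_diff)
  from J_gen_eq[OF h this] show ?thesis using h by simp
qed

text \<open>Completing the square: \<open>J h f\<close> minimises \<open>v \<mapsto> h b(v,v) + \<parallel>f - v\<parallel>\<^sup>2\<close> over \<open>D\<close>.\<close>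
lemma J_minimizes:
  assumes h: "0 < h" and v: "v \<in> D"
  shows "h * b v v + ip (f - v) (f - v) =
    (h * b (J h f) (J h f) + ip (f - J h f) (f - J h f)) +
    (h * b (v - J h f) (v - J h f) + ip (v - J h f) (v - J h f))"
  using J_eq[OF h v, of f] J_eq[OF h J_in[OF h, of f], of f] h v
  by (simp add: dom.c_bilin ip_bilin dom.c_sym[of v "J h f"] ip_sym[of v "J h f"] ip_sym[of v f] ip_sym[of f "J h f"] algebra_simps)

text \<open>The Moreau envelope of the form; it is the Deny--Yosida approximation for \<open>\<beta> = 1 / h\<close>.\<close>
definition env :: "real \<Rightarrow> 'b \<Rightarrow> real" where
  "env h f = (ip f f - ip (J h f) f) / h"

lemma env_eq:
  assumes h: "0 < h" shows "env h f = b (J h f) (J h f) + ip (f - J h f) (f - J h f) / h"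
proof -
  have "h * b (J h f) (J h f) + ip (f - J h f) (f - J h f) = ip f f - ip (J h f) f"
    using J_energy[OF h, of f] by (simp add: ip_bilin ip_sym[of f "J h f"])
  then show ?thesis unfolding env_def using h by (simp add: field_simps)
qed

lemma env_le:
  assumes h: "0 < h" and v: "v \<in> D" shows "env h f \<le> b v v + ip (f - v) (f - v) / h"
proof -
  have "v - J h f \<in> D" using h v by simp
  then have "0 \<le> h * b (v - J h f) (v - J h f) + ip (v - J h f) (v - J h f)"
    using dom.c_nonneg h by simp
  then have "h * b (J h f) (J h f) + ip (f - J h f) (f - J h f) \<le> h * b v v + ip (f - v) (f - v)"
    using J_minimizes[OF h v, of f] by linarith
  then have "(h * b (J h f) (J h f) + ip (f - J h f) (f - J h f)) / h \<le> (h * b v v + ip (f - v) (f - v)) / h"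
    using h by (simp add: divide_right_mono)
  then show ?thesis unfolding env_eq[OF h] using h by (simp add: add_divide_distrib)
qed

lemma env_le_form: "0 < h \<Longrightarrow> v \<in> D \<Longrightarrow> env h v \<le> b v v"
  using env_le[of h v v] by simp

lemma env_mono: assumes "0 < h" "h \<le> k" shows "env k f \<le> env h f"
proof -
  have "env k f \<le> b (J h f) (J h f) + ip (f - J h f) (f - J h f) / k"
    using assms by (intro env_le) auto
  also have "\<dots> \<le> env h f" using assms by (simp add: env_eq frac_le)
  finally show ?thesis .
qed

lemma J_dist_dom: assumes h: "0 < h" and v: "v \<in> D" shows "(nm (v - J h v))\<^sup>2 \<le> h * b v v"
proof -
  have "ip (v - J h v) (v - J h v) / h \<le> b v v"
    using env_le_form[OF h v] dom.c_nonneg[OF J_in[OF h, of v]] unfolding env_eq[OF h] by linarith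
  then show ?thesis using h by (simp add: nm_square field_simps)
qed

text \<open>On \<open>D\<close> the distance is \<open>O(\<surd>h)\<close> by the envelope bound; contractivity and density do the
  rest.\<close>
lemma J_tendsto: "((\<lambda>h. nm (f - J h f)) \<longlongrightarrow> 0) (at_right 0)"
proof (rule tendstoI)
  fix \<epsilon> :: real assume e: "\<epsilon> > 0"
  obtain v where v: "v \<in> D" and fv: "nm (f - v) < \<epsilon> / 3" using D_dense[of "\<epsilon> / 3" f] e by auto
  have "((\<lambda>h. sqrt (h * b v v)) \<longlongrightarrow> sqrt (0 * b v v)) (at_right 0)"
    by (intro tendsto_intros)
  then have "\<forall>\<^sub>F h in at_right 0. sqrt (h * b v v) < \<epsilon> / 3"
    using e by (intro order_tendstoD(2)) auto
  then have "\<forall>\<^sub>F h in at_right 0. h > 0 \<and> sqrt (h * b v v) < \<epsilon> / 3"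
    using eventually_at_right_less[of 0] by eventually_elim auto
  then show "\<forall>\<^sub>F h in at_right 0. dist (nm (f - J h f)) 0 < \<epsilon>"
  proof eventually_elim
    case (elim h)
    then have h: "h > 0" by simp
    have "nm (v - J h v) \<le> sqrt (h * b v v)"
      using J_dist_dom[OF h v] by (simp add: real_le_rsqrt)
    moreover have "nm (J h v - J h f) \<le> nm (v - f)" using nm_J_le[OF h, of "v - f"] h by (simp add: J_diff)
    ultimately have "nm (f - J h f) < \<epsilon>"
      using nm_triangle_diff[of f "J h f" v] nm_triangle_diff[of v "J h f" "J h v"] nm_minus_commute[of v f] fv elim
      by linarith
    then show ?case by simp
  qed
qed

lemma J_seq_tendsto:
  assumes "\<And>n. 0 < h n" "h \<longlonglongrightarrow> 0" shows "(\<lambda>n. nm (f - J (h n) f)) \<longlonglongrightarrow> 0"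
proof -
  have "filterlim h (at_right 0) sequentially"
    using assms by (simp add: filterlim_at order_less_imp_not_eq2)
  from filterlim_compose[OF J_tendsto this] show ?thesis .
qed

text \<open>The increments of the envelope control the energy distance of the vectors \<open>J\<^sub>h f\<close>. As
  the envelopes increase to a finite limit, these are Cauchy for the form norm, and their
  limit is \<open>f\<close>.\<close>
lemma env_bounded_imp_dom:
  assumes f: "P f = f" and M: "\<And>h. 0 < h \<Longrightarrow> env h f \<le> M"
  shows "f \<in> D \<and> b f f \<le> M"
proof -
  define h where "h n = 1 / (real n + 1)" for n
  have hpos: "0 < h n" for n by (simp add: h_def)
  have hle: "h j \<le> h i" if "i \<le> j" for i j using that by (simp add: h_def frac_le)
  have h0: "h \<longlonglongrightarrow> 0" unfolding h_def using LIMSEQ_inverse_real_of_nat by (simp add: inverse_eq_divide add.commute)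
  let ?u = "\<lambda>n. J (h n) f"
  have nmu: "(\<lambda>n. nm (?u n - f)) \<longlonglongrightarrow> 0"
    using J_seq_tendsto[OF hpos h0, of f] nm_minus_commute by simp
  have inc: "incseq (\<lambda>n. env (h n) f)" unfolding incseq_def using env_mono hpos hle by blast
  have step: "b (?u i - ?u j) (?u i - ?u j) \<le> \<bar>env (h i) f - env (h j) f\<bar>" for i j
  proof -
    have *: "b (?u i - ?u j) (?u i - ?u j) \<le> env (h j) f - env (h i) f" if ij: "i \<le> j" for i j
    proof -
      let ?d = "?u j - ?u i"
      have d: "?d \<in> D" using hpos by simp
      have "h i * b ?d ?d \<le> h i * b ?d ?d + ip ?d ?d" by simp
      also have "\<dots> = (h i * b (?u j) (?u j) + ip (f - ?u j) (f - ?u j)) - (h i * b (?u i) (?u i) + ip (f - ?u i) (f - ?u i))"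
        using J_minimizes[OF hpos J_in[OF hpos], of i j f f] by linarith
      also have "\<dots> = h i * (b (?u j) (?u j) + ip (f - ?u j) (f - ?u j) / h i - env (h i) f)"
        using hpos[of i] by (simp add: env_eq field_simps)
      also have "\<dots> \<le> h i * (env (h j) f - env (h i) f)"
        unfolding env_eq[OF hpos[of j]] using hpos[of i] hpos[of j] hle[OF ij]
        by (intro mult_left_mono) (auto simp: frac_le)
      finally have "b ?d ?d \<le> env (h j) f - env (h i) f" using hpos[of i] by simp
      moreover have "b (?u i - ?u j) (?u i - ?u j) = b ?d ?d"
        using hpos by (simp add: dom.c_bilin)
      ultimately show ?thesis by simp
    qed
    have flip: "b (?u j - ?u i) (?u j - ?u i) = b (?u i - ?u j) (?u i - ?u j)"
      using hpos by (simp add: dom.c_bilin)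
    show ?thesis using *[of i j] *[of j i] flip by (cases "i \<le> j") auto
  qed
  have "convergent (\<lambda>n. env (h n) f)"
    using inc M[OF hpos] by (meson incseq_convergent convergentI)
  then have caue: "Cauchy (\<lambda>n. env (h n) f)" by (rule convergent_Cauchy)
  have "\<exists>w\<in>D. (\<lambda>n. b (?u n - w) (?u n - w) + ip (?u n - w) (?u n - w)) \<longlonglongrightarrow> 0"
  proof (rule b_closed)
    fix \<epsilon> :: real assume e: "\<epsilon> > 0"
    obtain N1 where N1: "\<And>i j. i \<ge> N1 \<Longrightarrow> j \<ge> N1 \<Longrightarrow> \<bar>env (h i) f - env (h j) f\<bar> < \<epsilon> / 2"
      using caue e unfolding Cauchy_def dist_real_def by (metis half_gt_zero)
    obtain N2 where N2: "\<And>i. i \<ge> N2 \<Longrightarrow> nm (?u i - f) < sqrt (\<epsilon> / 2) / 2"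
      using LIMSEQ_D[OF nmu, of "sqrt (\<epsilon> / 2) / 2"] e by auto
    have "b (?u i - ?u j) (?u i - ?u j) + ip (?u i - ?u j) (?u i - ?u j) < \<epsilon>"
      if "i \<ge> max N1 N2" "j \<ge> max N1 N2" for i j
    proof -
      have "nm (?u i - ?u j) < sqrt (\<epsilon> / 2)"
        using nm_triangle_diff[of "?u i" "?u j" f] N2[of i] N2[of j] nm_minus_commute[of f "?u j"] that by linarith
      then have "ip (?u i - ?u j) (?u i - ?u j) < \<epsilon> / 2" by (simp add: nm_def)
      then show ?thesis using step[of i j] N1[of i j] that by simp
    qed
    then show "\<exists>N. \<forall>i\<ge>N. \<forall>j\<ge>N. b (?u i - ?u j) (?u i - ?u j) + ip (?u i - ?u j) (?u i - ?u j) < \<epsilon>" by blast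
  qed (use hpos in simp)
  then obtain w where w: "w \<in> D" and lim: "(\<lambda>n. b (?u n - w) (?u n - w) + ip (?u n - w) (?u n - w)) \<longlonglongrightarrow> 0" by blast
  have bw: "(\<lambda>n. b (?u n - w) (?u n - w)) \<longlonglongrightarrow> 0"
    by (rule Lim_null_comparison[OF _ lim]) (use hpos w dom.c_nonneg in \<open>auto intro!: always_eventually\<close>)
  have "(\<lambda>n. ip (?u n - w) (?u n - w)) \<longlonglongrightarrow> 0"
    by (rule Lim_null_comparison[OF _ lim]) (use hpos w dom.c_nonneg in \<open>auto intro!: always_eventually\<close>)
  then have "(\<lambda>n. sqrt (ip (?u n - w) (?u n - w))) \<longlonglongrightarrow> sqrt 0" by (intro tendsto_intros)
  then have "(\<lambda>n. nm (?u n - w)) \<longlonglongrightarrow> 0" by (simp add: nm_def)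
  from limit_unique[OF f D_rep[OF w] _ nmu this] have fw: "f = w" by simp
  have "b w w \<le> M"
  proof (rule LIMSEQ_le_const2)
    have "(\<lambda>n. b (?u n) w) \<longlonglongrightarrow> b w w"
    proof -
      have "(\<lambda>n. sqrt (b (?u n - w) (?u n - w)) * sqrt (b w w)) \<longlonglongrightarrow> sqrt 0 * sqrt (b w w)"
        by (intro tendsto_intros bw)
      then have "(\<lambda>n. b (?u n - w) w) \<longlonglongrightarrow> 0"
        by (rule_tac Lim_null_comparison[rotated], simp)
          (intro always_eventually allI, use dom.c_abs_le hpos w in simp)
      then have "(\<lambda>n. b (?u n - w) w + b w w) \<longlonglongrightarrow> 0 + b w w" by (intro tendsto_intros)
      then show ?thesis using hpos w by (simp add: dom.c_diff)
    qed
    then show "(\<lambda>n. 2 * b (?u n) w - b w w) \<longlonglongrightarrow> b w w"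
      using tendsto_diff[OF tendsto_mult[OF tendsto_const[of 2]] tendsto_const[of "b w w"]] by fastforce
    have "2 * b (?u n) w - b w w \<le> M" for n
    proof -
      have "0 \<le> b (?u n - w) (?u n - w)" using hpos w by (intro dom.c_nonneg) simp
      then have "2 * b (?u n) w - b w w \<le> b (?u n) (?u n)"
        using hpos w by (simp add: dom.c_bilin dom.c_sym[of w "?u n"])
      also have "\<dots> \<le> env (h n) f" using hpos[of n] by (simp add: env_eq)
      also have "\<dots> \<le> M" by (rule M[OF hpos])
      finally show ?thesis .
    qed
    then show "\<exists>N. \<forall>n\<ge>N. 2 * b (?u n) w - b w w \<le> M" by blast
  qed
  then show ?thesis using fw w by simp
qed

end

section \<open>The semigroup of a closed form\<close>

lemma funpow_comp_commute:
  assumes "\<And>x. f (g x) = g (f x)"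
  shows "((\<lambda>x. f (g x)) ^^ n) x = (f ^^ n) ((g ^^ n) x)"
proof (induction n arbitrary: x)
  case (Suc n)
  have c: "g ((f ^^ n) y) = (f ^^ n) (g y)" for y
    by (induction n arbitrary: y) (simp_all add: assms[symmetric])
  show ?case by (simp add: Suc c)
qed simp

context hilbert_rep
begin

definition contr :: "('b \<Rightarrow> 'b) \<Rightarrow> bool" where
  "contr A \<longleftrightarrow> (\<forall>x y. A (x + y) = A x + A y) \<and> (\<forall>r x. A (r *\<^sub>R x) = r *\<^sub>R A x) \<and> (\<forall>x. nm (A x) \<le> nm x)"

lemma contrI: "(\<And>x y. A (x + y) = A x + A y) \<Longrightarrow> (\<And>r x. A (r *\<^sub>R x) = r *\<^sub>R A x) \<Longrightarrow> (\<And>x. nm (A x) \<le> nm x) \<Longrightarrow> contr A"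
  by (simp add: contr_def)

lemma contr_add: "contr A \<Longrightarrow> A (x + y) = A x + A y"
  and contr_scale: "contr A \<Longrightarrow> A (r *\<^sub>R x) = r *\<^sub>R A x"
  and contr_nm: "contr A \<Longrightarrow> nm (A x) \<le> nm x"
  by (auto simp: contr_def)

lemma contr_diff: "contr A \<Longrightarrow> A (x - y) = A x - A y"
  using contr_add[of A x "(-1) *\<^sub>R y"] contr_scale[of A "-1" y] by simp

lemma contr_nm_diff: "contr A \<Longrightarrow> nm (A x - A y) \<le> nm (x - y)"
  using contr_nm[of A "x - y"] by (simp add: contr_diff)

lemma contr_id: "contr (\<lambda>x. x)" by (simp add: contr_def)

lemma contr_comp: "contr A \<Longrightarrow> contr B \<Longrightarrow> contr (\<lambda>x. A (B x))"
  by (rule contrI) (auto simp: contr_add contr_scale intro: order_trans[OF contr_nm contr_nm])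

lemma contr_funpow: "contr A \<Longrightarrow> contr (A ^^ n)"
proof (induction n)
  case 0 then show ?case by (simp add: contr_def)
next
  case (Suc n)
  have "contr (\<lambda>x. A ((A ^^ n) x))" by (rule contr_comp[OF Suc.prems Suc.IH[OF Suc.prems]])
  then show ?case by (simp add: o_def)
qed

text \<open>\<open>A\<^sup>n - B\<^sup>n\<close> telescopes into \<open>n\<close> terms \<open>A\<^sup>i B\<^sup>j (A - B)\<close>, as \<open>A\<close> and \<open>B\<close> commute, and
  contractions do not increase \<open>A x - B x\<close>.\<close>
lemma contr_funpow_diff:
  assumes A: "contr A" and B: "contr B" and comm: "\<And>x. A (B x) = B (A x)"
  shows "nm ((A ^^ n) x - (B ^^ n) x) \<le> real n * nm (A x - B x)"
proof (induction n)
  case (Suc n)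
  have c: "(A ^^ n) (B y) = B ((A ^^ n) y)" for y
    by (induction n arbitrary: y) (simp_all add: comm)
  have "nm ((A ^^ Suc n) x - (B ^^ Suc n) x) \<le>
      nm ((A ^^ Suc n) x - (A ^^ n) (B x)) + nm ((A ^^ n) (B x) - (B ^^ Suc n) x)"
    by (rule nm_triangle_diff)
  also have "(A ^^ Suc n) x - (A ^^ n) (B x) = (A ^^ n) (A x) - (A ^^ n) (B x)"
    by (simp add: funpow_swap1)
  also have "(A ^^ n) (B x) - (B ^^ Suc n) x = B ((A ^^ n) x) - B ((B ^^ n) x)"
    by (simp add: c)
  finally have "nm ((A ^^ Suc n) x - (B ^^ Suc n) x) \<le> nm (A x - B x) + nm ((A ^^ n) x - (B ^^ n) x)"
    using contr_nm_diff[OF contr_funpow[OF A, of n], of "A x" "B x"]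
      contr_nm_diff[OF B, of "(A ^^ n) x" "(B ^^ n) x"] by linarith
  with Suc show ?case by (simp add: algebra_simps)
qed simp

lemma contr_limit:
  assumes E: "\<And>k. contr (E k)" and T: "\<And>x. P (T x) = T x" and lim: "\<And>x. (\<lambda>k::nat. nm (E k x - T x)) \<longlonglongrightarrow> 0"
  shows "contr T"
proof (rule contrI)
  fix x y
  have "(\<lambda>k. nm (E k x - T x) + nm (E k y - T y)) \<longlonglongrightarrow> 0 + 0" by (intro tendsto_intros lim)
  then have "(\<lambda>k. nm (E k (x + y) - (T x + T y))) \<longlonglongrightarrow> 0"
    by (rule_tac Lim_null_comparison[rotated], simp)
      (intro always_eventually allI,
       use nm_triangle[of "E _ x - T x" "E _ y - T y"] in \<open>simp add: contr_add[OF E] add_diff_add\<close>)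
  from limit_unique[OF T _ _ lim this] show "T (x + y) = T x + T y" by (simp add: T)
next
  fix r x
  have "(\<lambda>k. \<bar>r\<bar> * nm (E k x - T x)) \<longlonglongrightarrow> \<bar>r\<bar> * 0" by (intro tendsto_intros lim)
  then have "(\<lambda>k. nm (E k (r *\<^sub>R x) - r *\<^sub>R T x)) \<longlonglongrightarrow> 0"
    by (simp add: contr_scale[OF E] scaleR_diff_right[symmetric] nm_scale del: scaleR_diff_right)
  from limit_unique[OF T _ _ lim this] show "T (r *\<^sub>R x) = r *\<^sub>R T x" by (simp add: T)
next
  fix x
  show "nm (T x) \<le> nm x"
    by (rule LIMSEQ_le_const2[OF tendsto_nm[OF lim]]) (use contr_nm[OF E] in blast)
qed

end

context form_space
begin

lemma contr_J: "0 < h \<Longrightarrow> contr (J h)"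
  by (rule contrI) (auto simp: J_add J_scale nm_J_le)

lemma J_gen_dist: "0 < h \<Longrightarrow> gen x f \<Longrightarrow> nm (x - J h x) \<le> h * nm f"
  using nm_J_le[of h f] by (simp add: gen_resolvent nm_scale)

lemma J_pow_gen_dist:
  assumes h: "0 < h" and g: "gen y g" shows "nm ((J h ^^ n) y - y) \<le> real n * h * nm g"
proof -
  have "nm ((J h ^^ n) y - ((\<lambda>x. x) ^^ n) y) \<le> real n * nm (J h y - y)"
    by (rule contr_funpow_diff[OF contr_J[OF h] contr_id]) simp
  also have "((\<lambda>x. x) ^^ n) y = y" by (induction n) auto
  also have "real n * nm (J h y - y) \<le> real n * (h * nm g)"
    using J_gen_dist[OF h g] by (intro mult_left_mono) (simp_all add: nm_minus_commute)
  finally show ?thesis by (simp add: mult.assoc)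
qed

text \<open>Two implicit Euler steps and one step of the combined length agree to first order with
  \<open>x - (h + k) L x\<close>; the rest is controlled by \<open>g = L L x\<close>.\<close>
lemma J_split:
  assumes h: "0 < h" and k: "0 < k" and xf: "gen x f" and fg: "gen f g"
  shows "nm (J (h + k) x - J h (J k x)) \<le> 2 * (h + k)\<^sup>2 * nm g"
proof -
  have hk: "0 < h + k" using h k by simp
  have 1: "J (h + k) x = x - (h + k) *\<^sub>R J (h + k) f"
    using gen_resolvent[OF hk xf] by (simp add: algebra_simps)
  have 2: "J h (J k x) = x - h *\<^sub>R J h f - k *\<^sub>R J h (J k f)"
  proof -
    have "J k x = x - k *\<^sub>R J k f" using gen_resolvent[OF k xf] by (simp add: algebra_simps)
    then have "J h (J k x) = J h x - k *\<^sub>R J h (J k f)" using h by (simp add: J_diff J_scale)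
    then show ?thesis using gen_resolvent[OF h xf] by (simp add: algebra_simps)
  qed
  have eq: "J (h + k) x - J h (J k x) = h *\<^sub>R (J h f - J (h + k) f) + k *\<^sub>R (J h (J k f) - J (h + k) f)"
    unfolding 1 2 by (simp add: algebra_simps)
  have a: "nm (f - J h f) \<le> h * nm g" "nm (f - J k f) \<le> k * nm g" "nm (f - J (h + k) f) \<le> (h + k) * nm g"
    using J_gen_dist fg h k hk by auto
  have "nm (J h f - J (h + k) f) \<le> h * nm g + (h + k) * nm g"
    using nm_triangle_diff[of "J h f" "J (h + k) f" f] a nm_minus_commute[of f] by simp
  also have "\<dots> \<le> 2 * (h + k) * nm g" using h k mult_nonneg_nonneg[of k "nm g"] by (simp add: algebra_simps)
  finally have b1: "nm (J h f - J (h + k) f) \<le> 2 * (h + k) * nm g" .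
  have "nm (J h (J k f) - J h f) \<le> nm (J k f - f)" by (rule contr_nm_diff[OF contr_J[OF h]])
  then have "nm (J h (J k f) - f) \<le> k * nm g + h * nm g"
    using nm_triangle_diff[of "J h (J k f)" f "J h f"] a nm_minus_commute[of f] by simp
  then have b2: "nm (J h (J k f) - J (h + k) f) \<le> 2 * (h + k) * nm g"
    using nm_triangle_diff[of "J h (J k f)" "J (h + k) f" f] a by (simp add: algebra_simps)
  have "nm (J (h + k) x - J h (J k x)) \<le> h * nm (J h f - J (h + k) f) + k * nm (J h (J k f) - J (h + k) f)"
    unfolding eq using h k
    by (intro order_trans[OF nm_triangle]) (simp add: nm_scale)
  also have "\<dots> \<le> h * (2 * (h + k) * nm g) + k * (2 * (h + k) * nm g)"
    using h k b1 b2 by (intro add_mono mult_left_mono) auto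
  also have "\<dots> = 2 * (h + k)\<^sup>2 * nm g" by (simp add: power2_eq_square algebra_simps)
  finally show ?thesis .
qed

text \<open>The domain of \<open>L \<circ> L\<close> is dense, since it contains \<open>J\<^sub>h J\<^sub>h x\<close>, which tends to \<open>x\<close>.\<close>
lemma gen2_dense:
  assumes "0 < \<epsilon>" shows "\<exists>y f g. gen y f \<and> gen f g \<and> nm (x - y) < \<epsilon>"
proof -
  have "\<forall>\<^sub>F h in at_right 0. nm (x - J h x) < \<epsilon> / 2"
    using J_tendsto[of x] assms by (intro order_tendstoD(2)) auto
  then have "\<forall>\<^sub>F h in at_right 0. nm (x - J h x) < \<epsilon> / 2 \<and> 0 < h"
    using eventually_at_right_less[of 0] by eventually_elim auto
  then obtain h where h: "0 < h" and d: "nm (x - J h x) < \<epsilon> / 2"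
    by (metis (no_types, lifting) eventually_happens trivial_limit_at_right_real)
  let ?y = "J h (J h x)"
  have "gen ?y ((1 / h) *\<^sub>R (J h x - ?y))" using gen_J[OF h, of "J h x"] h by simp
  moreover have "gen ((1 / h) *\<^sub>R (J h x - ?y)) ((1 / h) *\<^sub>R ((1 / h) *\<^sub>R (P x - J h x) - (1 / h) *\<^sub>R (J h x - ?y)))"
    using gen_scale[OF gen_diff[OF gen_J[OF h, of x] gen_J[OF h, of "J h x"]], of "1 / h"] h by simp
  moreover have "nm (x - ?y) < \<epsilon>"
    using nm_triangle_diff[of x ?y "J h x"] contr_nm_diff[OF contr_J[OF h], of x "J h x"] d by linarith
  ultimately show ?thesis by blast
qed

text \<open>Implicit Euler steps towards \<open>exp (- t L)\<close>. Dyadic step numbers make consecutive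
  approximations comparable: \<open>euler t (Suc k)\<close> is \<open>euler (t / 2) k\<close> applied twice.\<close>
definition euler :: "real \<Rightarrow> nat \<Rightarrow> 'b \<Rightarrow> 'b" where
  "euler t k = J (t / 2 ^ k) ^^ (2 ^ k)"

lemma contr_euler: "0 < t \<Longrightarrow> contr (euler t k)"
  unfolding euler_def by (rule contr_funpow[OF contr_J]) simp

text \<open>Each of the \<open>2\<^sup>k\<close> steps contributes an error \<open>O(4\<^sup>-\<^sup>k)\<close>. With \<open>s = t\<close> this makes the
  scheme Cauchy; for general \<open>s\<close> and \<open>t\<close> it yields the semigroup law in the limit.\<close>
lemma euler_product_dist:
  assumes s: "0 < s" and t: "0 < t" and xf: "gen x f" and fg: "gen f g"
  shows "nm (euler (s + t) k x - euler s k (euler t k x)) \<le> 2 * (s + t)\<^sup>2 * nm g / 2 ^ k"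
proof -
  let ?a = "s / 2 ^ k" and ?b = "t / 2 ^ k"
  have ab: "0 < ?a" "0 < ?b" using s t by auto
  have abs: "0 < ?a + ?b" using ab by linarith
  have comm: "J ?a (J ?b y) = J ?b (J ?a y)" for y using J_commute[OF ab] .
  have e1: "euler s k (euler t k x) = ((\<lambda>x. J ?a (J ?b x)) ^^ (2 ^ k)) x"
    unfolding euler_def by (rule funpow_comp_commute[symmetric]) (rule comm)
  have e2: "euler (s + t) k x = (J (?a + ?b) ^^ (2 ^ k)) x"
    unfolding euler_def by (simp add: add_divide_distrib)
  have "nm ((J (?a + ?b) ^^ (2 ^ k)) x - ((\<lambda>x. J ?a (J ?b x)) ^^ (2 ^ k)) x)
      \<le> real (2 ^ k) * nm (J (?a + ?b) x - J ?a (J ?b x))"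
  proof (rule contr_funpow_diff)
    show "contr (\<lambda>x. J ?a (J ?b x))" by (rule contr_comp[OF contr_J[OF ab(1)] contr_J[OF ab(2)]])
    show "J (?a + ?b) (J ?a (J ?b y)) = J ?a (J ?b (J (?a + ?b) y))" for y
      by (simp only: J_commute[OF abs ab(1)] J_commute[OF abs ab(2)])
  qed (rule contr_J[OF abs])
  also have "real (2 ^ k) * nm (J (?a + ?b) x - J ?a (J ?b x)) \<le> real (2 ^ k) * (2 * (?a + ?b)\<^sup>2 * nm g)"
    by (intro mult_left_mono J_split[OF ab xf fg]) simp
  also have "real (2 ^ k) * (2 * (?a + ?b)\<^sup>2 * nm g) = 2 * (s + t)\<^sup>2 * nm g / 2 ^ k"
    by (simp add: add_divide_distrib[symmetric] power_divide power2_eq_square)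
  finally show ?thesis unfolding e1 e2 .
qed

lemma euler_step_dist:
  assumes t: "0 < t" and xf: "gen x f" and fg: "gen f g"
  shows "nm (euler t k x - euler t (Suc k) x) \<le> 2 * t\<^sup>2 * nm g / 2 ^ k"
proof -
  have "euler (t/2) k (euler (t/2) k x) = euler t (Suc k) x"
  proof -
    have "t / 2 ^ Suc k = t / 2 / 2 ^ k" "(2::nat) ^ Suc k = 2 ^ k + 2 ^ k" by simp_all
    then show ?thesis unfolding euler_def by (simp only: funpow_add o_apply)
  qed
  then show ?thesis using euler_product_dist[OF half_gt_zero[OF t] half_gt_zero[OF t] xf fg, of k] by simp
qed

lemma euler_converges:
  assumes t: "0 < t"
  shows "\<exists>y. P y = y \<and> (\<lambda>k. nm (euler t k x - y)) \<longlonglongrightarrow> 0"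
proof (rule nm_complete)
  fix \<epsilon> :: real assume e: "\<epsilon> > 0"
  obtain y f g where yf: "gen y f" and fg: "gen f g" and xy: "nm (x - y) < \<epsilon> / 6"
    using gen2_dense[of "\<epsilon> / 6" x] e by auto
  define C where "C = 2 * t\<^sup>2 * nm g"
  have C: "0 \<le> C" by (simp add: C_def)
  have tel: "nm (euler t k y - euler t (k + n) y) \<le> 2 * C / 2 ^ k - 2 * C / 2 ^ (k + n)" for k n
  proof (induction n)
    case (Suc n)
    have "nm (euler t k y - euler t (k + Suc n) y) \<le> (2 * C / 2 ^ k - 2 * C / 2 ^ (k + n)) + C / 2 ^ (k + n)"
      using nm_triangle_diff[of "euler t k y" "euler t (k + Suc n) y" "euler t (k + n) y"] Suc
        euler_step_dist[OF t yf fg, of "k + n"] unfolding C_def add_Suc_right by linarith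
    also have "\<dots> = 2 * C / 2 ^ k - 2 * C / 2 ^ (k + Suc n)" by (simp add: field_simps)
    finally show ?case .
  qed simp
  have tel': "nm (euler t k y - euler t l y) \<le> 2 * C / 2 ^ k" if "k \<le> l" for k l
  proof -
    obtain n where "l = k + n" using \<open>k \<le> l\<close> le_Suc_ex by blast
    then show ?thesis using tel[of k n] C by (smt (verit) divide_nonneg_nonneg zero_le_power)
  qed
  have "(\<lambda>k. 2 * C / 2 ^ k) \<longlonglongrightarrow> 0"
    using tendsto_mult_right_zero[OF LIMSEQ_power_zero[of "1/2::real"], of "2 * C"] by (simp add: power_divide)
  then have "\<forall>\<^sub>F k in sequentially. 2 * C / 2 ^ k < \<epsilon> / 3" using e by (intro order_tendstoD(2)) auto
  then obtain N where N: "\<And>k. k \<ge> N \<Longrightarrow> 2 * C / 2 ^ k < \<epsilon> / 3" by (auto simp: eventually_sequentially)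
  have "nm (euler t i x - euler t j x) < \<epsilon>" if "i \<ge> N" "j \<ge> N" for i j
  proof -
    have "nm (euler t i y - euler t j y) < \<epsilon> / 3"
      using tel'[of i j] tel'[of j i] N[OF that(1)] N[OF that(2)] nm_minus_commute[of "euler t i y"]
      by (cases "i \<le> j") auto
    moreover have "nm (euler t i x - euler t i y) \<le> nm (x - y)" "nm (euler t j x - euler t j y) \<le> nm (x - y)"
      using contr_nm_diff[OF contr_euler[OF t]] by auto
    ultimately show ?thesis
      using nm_triangle_diff[of "euler t i x" "euler t j x" "euler t i y"]
        nm_triangle_diff[of "euler t i y" "euler t j x" "euler t j y"]
        nm_minus_commute[of "euler t j y" "euler t j x"] xy e by linarith
  qed
  then show "\<exists>N. \<forall>i\<ge>N. \<forall>j\<ge>N. nm (euler t i x - euler t j x) < \<epsilon>" by blast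
qed

text \<open>Euler steps need a positive length; at time \<open>0\<close> the identity on representatives is
  \<open>P\<close>.\<close>
definition lim_sg :: "real \<Rightarrow> 'b \<Rightarrow> 'b" where
  "lim_sg t x = (if t = 0 then P x else SOME y. P y = y \<and> (\<lambda>k. nm (euler t k x - y)) \<longlonglongrightarrow> 0)"

lemma lim_sg_works:
  assumes "0 < t" shows "P (lim_sg t x) = lim_sg t x \<and> (\<lambda>k. nm (euler t k x - lim_sg t x)) \<longlonglongrightarrow> 0"
  using someI_ex[OF euler_converges[OF assms, of x]] assms by (simp add: lim_sg_def)

lemma lim_sg_P: "0 \<le> t \<Longrightarrow> P (lim_sg t x) = lim_sg t x"
  using lim_sg_works[of t x] by (cases "t = 0") (auto simp: lim_sg_def)

lemma contr_lim_sg: assumes "0 \<le> t" shows "contr (lim_sg t)"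
proof (cases "t = 0")
  case True
  then have "lim_sg t = P" by (auto simp: lim_sg_def)
  then show ?thesis by (simp add: contr_def)
next
  case False
  then have t: "0 < t" using assms by simp
  show ?thesis
    by (rule contr_limit[where E = "euler t"]) (use contr_euler[OF t] lim_sg_works[OF t] in auto)
qed

lemma lim_sg_add_time:
  assumes s: "0 \<le> s" and t: "0 \<le> t" shows "lim_sg (s + t) x = lim_sg s (lim_sg t x)"
proof -
  consider "s = 0" | "t = 0" | "0 < s" "0 < t" using s t by linarith
  then show ?thesis
  proof cases
    case 1
    then show ?thesis using lim_sg_P[OF t, of x] by (simp add: lim_sg_def[of 0])
  next
    case 2
    have "nm (lim_sg s (P x) - lim_sg s x) \<le> nm (P x - x)" by (rule contr_nm_diff[OF contr_lim_sg[OF s]])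
    also have "\<dots> = 0" by simp
    finally have "nm (lim_sg s (P x) - lim_sg s x) = 0" using nm_nonneg by (simp add: order_antisym)
    then have "lim_sg s (P x) = lim_sg s x" by (rule rep_eqI[OF lim_sg_P[OF s] lim_sg_P[OF s]])
    then show ?thesis using 2 by (simp add: lim_sg_def[of 0])
  next
    case 3
    then have st: "0 < s + t" by simp
    have core: "lim_sg (s + t) y = lim_sg s (lim_sg t y)" if yf: "gen y f" and fg: "gen f g" for y f g
    proof (rule limit_unique[where u = "\<lambda>k. euler (s + t) k y" and F = sequentially])
      show "P (lim_sg s (lim_sg t y)) = lim_sg s (lim_sg t y)" using lim_sg_P[OF s] .
      have "(\<lambda>k. 2 * (s + t)\<^sup>2 * nm g / 2 ^ k) \<longlonglongrightarrow> 0"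
        using tendsto_mult_right_zero[OF LIMSEQ_power_zero[of "1/2::real"], of "2 * (s + t)\<^sup>2 * nm g"]
        by (simp add: power_divide)
      then have "(\<lambda>k. 2 * (s + t)\<^sup>2 * nm g / 2 ^ k + (nm (euler t k y - lim_sg t y)
          + nm (euler s k (lim_sg t y) - lim_sg s (lim_sg t y)))) \<longlonglongrightarrow> 0 + (0 + 0)"
        using lim_sg_works[OF 3(1)] lim_sg_works[OF 3(2)] by (intro tendsto_add) auto
      moreover have "nm (euler (s + t) k y - lim_sg s (lim_sg t y)) \<le> 2 * (s + t)\<^sup>2 * nm g / 2 ^ k
          + (nm (euler t k y - lim_sg t y) + nm (euler s k (lim_sg t y) - lim_sg s (lim_sg t y)))" for k
        using euler_product_dist[OF 3 yf fg, of k]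
          nm_triangle_diff[of "euler (s + t) k y" "lim_sg s (lim_sg t y)" "euler s k (euler t k y)"]
          nm_triangle_diff[of "euler s k (euler t k y)" "lim_sg s (lim_sg t y)" "euler s k (lim_sg t y)"]
          contr_nm_diff[OF contr_euler[OF 3(1)], of k "euler t k y" "lim_sg t y"] by linarith
      ultimately show "(\<lambda>k. nm (euler (s + t) k y - lim_sg s (lim_sg t y))) \<longlonglongrightarrow> 0"
        by (intro Lim_null_comparison[of "\<lambda>k. nm (euler (s + t) k y - lim_sg s (lim_sg t y))"])
          (auto intro!: always_eventually)
    qed (use lim_sg_works[OF st] in auto)
    show ?thesis
    proof (rule rep_eqI)
      have "nm (lim_sg (s + t) x - lim_sg s (lim_sg t x)) \<le> 0 + \<epsilon>" if e: "\<epsilon> > 0" for \<epsilon>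
      proof -
        obtain y f g where yf: "gen y f" and fg: "gen f g" and xy: "nm (x - y) < \<epsilon> / 2"
          using gen2_dense[of "\<epsilon> / 2" x] e by auto
        have "nm (lim_sg (s + t) x - lim_sg (s + t) y) \<le> nm (x - y)"
          using contr_nm_diff[OF contr_lim_sg[of "s + t"]] st by simp
        moreover have "nm (lim_sg s (lim_sg t y) - lim_sg s (lim_sg t x)) \<le> nm (y - x)"
          using contr_nm_diff[OF contr_comp[OF contr_lim_sg[OF s] contr_lim_sg[OF t]]] .
        ultimately show ?thesis
          using nm_triangle_diff[of "lim_sg (s + t) x" "lim_sg s (lim_sg t x)" "lim_sg (s + t) y"]
            core[OF yf fg] xy nm_minus_commute[of x y] by simp
      qed
      then have "nm (lim_sg (s + t) x - lim_sg s (lim_sg t x)) \<le> 0" by (rule field_le_epsilon)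
      then show "nm (lim_sg (s + t) x - lim_sg s (lim_sg t x)) = 0" using nm_nonneg by (simp add: order_antisym)
    qed (use lim_sg_P s t in auto)
  qed
qed

text \<open>Summing \<open>J\<^sup>j x - J\<^sup>j\<^sup>+\<^sup>1 x = h J\<^sup>j\<^sup>+\<^sup>1 L x\<close> gives \<open>x - J\<^sup>n x \<approx> n h L x\<close>. The error is the
  displacement of \<open>f = L x\<close>, which need not lie in the domain and is therefore approximated
  by some \<open>y\<close> that does.\<close>
lemma J_pow_generator_dist:
  assumes h: "0 < h" and xf: "gen x f" and yg: "gen y g"
  shows "nm (x - (J h ^^ n) x - (real n * h) *\<^sub>R f) \<le> real n * h * (2 * nm (f - y)) + (real n * h)\<^sup>2 * nm g"
proof (induction n)
  case (Suc n)
  let ?r = "\<lambda>n. x - (J h ^^ n) x - (real n * h) *\<^sub>R f"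
  have "(J h ^^ n) x - (J h ^^ Suc n) x = (J h ^^ n) (x - J h x)"
    by (simp add: contr_diff[OF contr_funpow[OF contr_J[OF h]]] funpow_swap1)
  also have "\<dots> = h *\<^sub>R (J h ^^ Suc n) f"
    using gen_resolvent[OF h xf] by (simp add: contr_scale[OF contr_funpow[OF contr_J[OF h]]] funpow_swap1)
  finally have inc: "?r (Suc n) = ?r n + h *\<^sub>R ((J h ^^ Suc n) f - f)"
    by (simp add: algebra_simps)
  have "nm ((J h ^^ Suc n) f - f) \<le> nm ((J h ^^ Suc n) f - (J h ^^ Suc n) y) + nm ((J h ^^ Suc n) y - y) + nm (y - f)"
    using nm_triangle_diff[of "(J h ^^ Suc n) f" f "(J h ^^ Suc n) y"] nm_triangle_diff[of "(J h ^^ Suc n) y" f y] by linarith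
  also have "\<dots> \<le> 2 * nm (f - y) + real (Suc n) * h * nm g"
    using contr_nm_diff[OF contr_funpow[OF contr_J[OF h]], of "Suc n" f y] J_pow_gen_dist[OF h yg, of "Suc n"]
      nm_minus_commute[of y f] by linarith
  finally have "h * nm ((J h ^^ Suc n) f - f) \<le> h * (2 * nm (f - y) + real (Suc n) * h * nm g)"
    using h by (intro mult_left_mono) auto
  then have "nm (?r (Suc n)) \<le> real n * h * (2 * nm (f - y)) + (real n * h)\<^sup>2 * nm g + h * (2 * nm (f - y) + real (Suc n) * h * nm g)"
    using nm_triangle[of "?r n" "h *\<^sub>R ((J h ^^ Suc n) f - f)"] Suc unfolding inc nm_scale abs_of_pos[OF h] by linarith
  also have "\<dots> \<le> real (Suc n) * h * (2 * nm (f - y)) + (real (Suc n) * h)\<^sup>2 * nm g"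
  proof -
    have "0 \<le> real n * h\<^sup>2 * nm g" by simp
    then show ?thesis by (simp add: power2_eq_square algebra_simps)
  qed
  finally show ?case .
qed simp

lemma lim_sg_generator_dist:
  assumes t: "0 < t" and xf: "gen x f" and yg: "gen y g"
  shows "nm ((1 / t) *\<^sub>R (x - lim_sg t x) - f) \<le> 2 * nm (f - y) + t * nm g"
proof -
  have "nm (x - euler t k x - t *\<^sub>R f) \<le> t * (2 * nm (f - y)) + t\<^sup>2 * nm g" for k
    using J_pow_generator_dist[OF _ xf yg, of "t / 2 ^ k" "2 ^ k"] t by (simp add: euler_def)
  moreover have "(\<lambda>k. nm (x - euler t k x - t *\<^sub>R f)) \<longlonglongrightarrow> nm (x - lim_sg t x - t *\<^sub>R f)"
  proof (rule tendsto_nm)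
    have "nm (x - euler t k x - t *\<^sub>R f - (x - lim_sg t x - t *\<^sub>R f)) = nm (euler t k x - lim_sg t x)" for k
      using nm_minus_commute[of "lim_sg t x" "euler t k x"] by (simp add: algebra_simps)
    then show "(\<lambda>k. nm (x - euler t k x - t *\<^sub>R f - (x - lim_sg t x - t *\<^sub>R f))) \<longlonglongrightarrow> 0"
      using lim_sg_works[OF t] by simp
  qed
  ultimately have "nm (x - lim_sg t x - t *\<^sub>R f) \<le> t * (2 * nm (f - y)) + t\<^sup>2 * nm g"
    by (intro LIMSEQ_le_const2) auto
  moreover have "(1 / t) *\<^sub>R (x - lim_sg t x) - f = (1 / t) *\<^sub>R (x - lim_sg t x - t *\<^sub>R f)"
    using t by (simp add: algebra_simps)
  ultimately have "nm ((1 / t) *\<^sub>R (x - lim_sg t x) - f) \<le> (1 / t) * (t * (2 * nm (f - y)) + t\<^sup>2 * nm g)"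
    using t by (simp only: nm_scale) (intro mult_mono, auto)
  also have "\<dots> = 2 * nm (f - y) + t * nm g" using t by (simp add: field_simps power2_eq_square)
  finally show ?thesis .
qed

lemma eventually_small_right:
  fixes a c \<epsilon> :: real
  assumes "2 * a < \<epsilon>" shows "\<forall>\<^sub>F t in at_right 0. 0 < t \<and> 2 * a + t * c < \<epsilon>"
proof -
  have "((\<lambda>t. 2 * a + t * c) \<longlongrightarrow> 2 * a + 0 * c) (at_right 0)" by (intro tendsto_intros)
  then have "\<forall>\<^sub>F t in at_right 0. 2 * a + t * c < \<epsilon>" using assms by (intro order_tendstoD(2)) auto
  then show ?thesis using eventually_at_right_less[of 0] by eventually_elim auto
qed

lemma lim_sg_generator:
  assumes xf: "gen x f" shows "((\<lambda>t. nm ((1 / t) *\<^sub>R (x - lim_sg t x) - f)) \<longlongrightarrow> 0) (at_right 0)"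
proof (rule tendstoI)
  fix \<epsilon> :: real assume e: "\<epsilon> > 0"
  obtain y g z where yg: "gen y g" and fy: "nm (f - y) < \<epsilon> / 2" using gen2_dense[of "\<epsilon> / 2" f] e by auto
  have "\<forall>\<^sub>F t in at_right 0. 0 < t \<and> 2 * nm (f - y) + t * nm g < \<epsilon>"
    using fy by (intro eventually_small_right) simp
  then show "\<forall>\<^sub>F t in at_right 0. dist (nm ((1 / t) *\<^sub>R (x - lim_sg t x) - f)) 0 < \<epsilon>"
  proof eventually_elim
    case (elim t)
    then show ?case using lim_sg_generator_dist[OF _ xf yg, of t] by simp
  qed
qed

lemma lim_sg_continuous: "((\<lambda>t. nm (lim_sg t x - x)) \<longlongrightarrow> 0) (at_right 0)"
proof (rule tendstoI)
  fix \<epsilon> :: real assume e: "\<epsilon> > 0"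
  obtain y g z where yg: "gen y g" and xy: "nm (x - y) < \<epsilon> / 2" using gen2_dense[of "\<epsilon> / 2" x] e by auto
  have "\<forall>\<^sub>F t in at_right 0. 0 < t \<and> 2 * nm (x - y) + t * nm g < \<epsilon>"
    using xy by (intro eventually_small_right) simp
  then show "\<forall>\<^sub>F t in at_right 0. dist (nm (lim_sg t x - x)) 0 < \<epsilon>"
  proof eventually_elim
    case (elim t)
    then have t: "0 < t" by simp
    have "nm (lim_sg t y - y) \<le> t * nm g"
    proof (rule LIMSEQ_le_const2)
      show "(\<lambda>k. nm (euler t k y - y)) \<longlonglongrightarrow> nm (lim_sg t y - y)"
        by (rule tendsto_nm) (use lim_sg_works[OF t, of y] in simp)
      show "\<exists>N. \<forall>k\<ge>N. nm (euler t k y - y) \<le> t * nm g"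
      proof (intro exI allI impI)
        fix k
        show "nm (euler t k y - y) \<le> t * nm g"
          using J_pow_gen_dist[OF _ yg, of "t / 2 ^ k" "2 ^ k"] t by (simp add: euler_def)
      qed
    qed
    moreover have "nm (lim_sg t x - lim_sg t y) \<le> nm (x - y)"
      using contr_nm_diff[OF contr_lim_sg] t by simp
    ultimately have "nm (lim_sg t x - x) \<le> 2 * nm (x - y) + t * nm g"
      using nm_triangle_diff[of "lim_sg t x" x "lim_sg t y"] nm_triangle_diff[of "lim_sg t y" x y]
        nm_minus_commute[of y x] by linarith
    then show ?case using elim by simp
  qed
qed

text \<open>The semigroup \<open>exp (- t L)\<close> on representatives, characterised by its generator.\<close>
definition sgroup :: "(real \<Rightarrow> 'b \<Rightarrow> 'b) \<Rightarrow> bool" where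
  "sgroup T \<longleftrightarrow>
     (\<forall>t\<ge>0. contr (T t)) \<and> (\<forall>t\<ge>0. \<forall>x. P (T t x) = T t x) \<and> (\<forall>x. T 0 x = P x) \<and>
     (\<forall>s\<ge>0. \<forall>t\<ge>0. \<forall>x. T (s + t) x = T s (T t x)) \<and>
     (\<forall>x. ((\<lambda>t. nm (T t x - x)) \<longlongrightarrow> 0) (at_right 0)) \<and>
     (\<forall>x f. P x = x \<longrightarrow> P f = f \<longrightarrow>
        (gen x f \<longleftrightarrow> ((\<lambda>h. nm ((1 / h) *\<^sub>R (x - T h x) - f)) \<longlongrightarrow> 0) (at_right 0)))"

theorem sgroup_exists: "\<exists>T. sgroup T"
proof -
  have "gen x f" if x: "P x = x" and f: "P f = f"
    and lim: "((\<lambda>h. nm ((1 / h) *\<^sub>R (x - lim_sg h x) - f)) \<longlongrightarrow> 0) (at_right 0)" for x f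
  proof -
    \<comment> \<open>\<open>1 + L\<close> is onto, and the generator is dissipative, so it cannot properly extend \<open>L\<close>.\<close>
    define y where "y = J 1 (x + f)"
    have y: "gen y (x + f - y)" using gen_J[of 1 "x + f"] x f by (simp add: y_def)
    define z where "z = x - y"
    have Pz: "P z = z" using gen_P[OF y] x by (simp add: z_def)
    have "((\<lambda>h. nm ((1 / h) *\<^sub>R (x - lim_sg h x) - f) + nm ((1 / h) *\<^sub>R (y - lim_sg h y) - (x + f - y))) \<longlongrightarrow> 0 + 0) (at_right 0)"
      by (intro tendsto_add lim lim_sg_generator[OF y])
    then have "((\<lambda>h. nm ((1 / h) *\<^sub>R (z - lim_sg h z) - (- z))) \<longlongrightarrow> 0) (at_right 0)"
    proof (rule_tac Lim_null_comparison[rotated], simp)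
      show "\<forall>\<^sub>F h in at_right 0. norm (nm ((1 / h) *\<^sub>R (z - lim_sg h z) - (- z)))
         \<le> nm ((1 / h) *\<^sub>R (x - lim_sg h x) - f) + nm ((1 / h) *\<^sub>R (y - lim_sg h y) - (x + f - y))"
        using eventually_at_right_less[of 0]
      proof eventually_elim
        case (elim h)
        have "(1 / h) *\<^sub>R (z - lim_sg h z) - (- z) =
           ((1 / h) *\<^sub>R (x - lim_sg h x) - f) - ((1 / h) *\<^sub>R (y - lim_sg h y) - (x + f - y))"
          using elim by (simp add: z_def contr_diff[OF contr_lim_sg] algebra_simps)
        then show ?case by (metis nm_diff_le nm_nonneg real_norm_def abs_of_nonneg)
      qed
    qed
    from tendsto_ip[OF this, of z] have l: "((\<lambda>h. ip ((1 / h) *\<^sub>R (z - lim_sg h z)) z) \<longlongrightarrow> ip (- z) z) (at_right 0)" .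
    have "0 \<le> ip (- z) z"
    proof (rule tendsto_lowerbound[OF l])
      show "\<forall>\<^sub>F h in at_right 0. 0 \<le> ip ((1 / h) *\<^sub>R (z - lim_sg h z)) z"
        using eventually_at_right_less[of 0]
      proof eventually_elim
        case (elim h)
        have "ip (lim_sg h z) z \<le> nm (lim_sg h z) * nm z" by (rule ip_le)
        also have "\<dots> \<le> nm z * nm z" using contr_nm[OF contr_lim_sg, of h z] elim by (intro mult_right_mono) auto
        also have "\<dots> = ip z z" by (simp add: ip_self power2_eq_square)
        finally show ?case using elim by (simp add: ip_bilin)
      qed
    qed simp
    then have "ip z z = 0" using ip_nonneg[of z] by (simp add: ip_minus)
    then have "z = 0" using P_null[of z] Pz by simp
    then show ?thesis using y by (simp add: z_def)
  qed
  then have "sgroup lim_sg"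
    unfolding sgroup_def
    using contr_lim_sg lim_sg_P lim_sg_add_time lim_sg_continuous lim_sg_generator by (auto simp: lim_sg_def[of 0])
  then show ?thesis by blast
qed

end

section \<open>Approximating forms and the Laplace transform\<close>

context hilbert_rep
begin

definition defect_form :: "('b \<Rightarrow> 'b) \<Rightarrow> 'b \<Rightarrow> real" where
  "defect_form S u = ip u u - ip (S u) u"

lemma contr_ip_le: assumes "contr S" shows "ip (S u) u \<le> ip u u"
proof -
  have "ip (S u) u \<le> nm (S u) * nm u" by (rule ip_le)
  also have "\<dots> \<le> nm u * nm u" by (rule mult_right_mono[OF contr_nm[OF assms]]) simp
  also have "\<dots> = ip u u" by (simp add: ip_self power2_eq_square)
  finally show ?thesis .
qed

lemma defect_form_nonneg: "contr S \<Longrightarrow> 0 \<le> defect_form S u"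
  using contr_ip_le[of S u] by (simp add: defect_form_def)

text \<open>A nonnegative quadratic form lies above its tangents.\<close>
lemma defect_form_tangent:
  assumes S: "contr S" and sym: "\<And>x y. ip (S x) y = ip x (S y)"
  shows "2 * ip u (w - S w) - defect_form S w \<le> defect_form S u"
proof -
  have "0 \<le> defect_form S (u - w)" by (rule defect_form_nonneg[OF S])
  also have "\<dots> = defect_form S u - 2 * ip u (w - S w) + defect_form S w"
    using sym[of u w] ip_sym[of w u] ip_sym[of "S w" u]
    by (simp add: defect_form_def contr_diff[OF S] ip_bilin)
  finally show ?thesis by simp
qed

text \<open>The tangent at \<open>w\<close> is weakly continuous and touches the form at \<open>w\<close>.\<close>
lemma defect_form_weakly_lsc:
  fixes u :: "nat \<Rightarrow> 'b"
  assumes S: "contr S" and sym: "\<And>x y. ip (S x) y = ip x (S y)"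
    and weak: "\<And>v. (\<lambda>n. ip (u n) v) \<longlonglongrightarrow> ip w v" and c: "c < defect_form S w"
  shows "\<forall>\<^sub>F n in sequentially. c < defect_form S (u n)"
proof -
  have "(\<lambda>n. 2 * ip (u n) (w - S w) - defect_form S w) \<longlonglongrightarrow> 2 * ip w (w - S w) - defect_form S w"
    by (intro tendsto_intros weak)
  also have "2 * ip w (w - S w) - defect_form S w = defect_form S w"
    by (simp add: defect_form_def ip_bilin ip_sym[of w "S w"])
  finally have "\<forall>\<^sub>F n in sequentially. c < 2 * ip (u n) (w - S w) - defect_form S w"
    using c by (rule order_tendstoD(1))
  then show ?thesis
  proof eventually_elim
    case (elim n)
    show ?case by (rule less_le_trans[OF elim defect_form_tangent[OF S sym]])
  qed
qed

end

locale semigroup_space = form_space ip P D b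
  for ip :: "'b::real_vector \<Rightarrow> 'b \<Rightarrow> real" and P D b +
  fixes T :: "real \<Rightarrow> 'b \<Rightarrow> 'b"
  assumes sg: "sgroup T"
begin

lemma T_contr: "0 \<le> t \<Longrightarrow> contr (T t)"
  and T_P [simp]: "0 \<le> t \<Longrightarrow> P (T t x) = T t x"
  and T_0 [simp]: "T 0 x = P x"
  and T_plus: "0 \<le> s \<Longrightarrow> 0 \<le> t \<Longrightarrow> T (s + t) x = T s (T t x)"
  and T_cont: "((\<lambda>t. nm (T t x - x)) \<longlongrightarrow> 0) (at_right 0)"
  and T_gen_iff: "P x = x \<Longrightarrow> P f = f \<Longrightarrow>
        gen x f \<longleftrightarrow> ((\<lambda>h. nm ((1 / h) *\<^sub>R (x - T h x) - f)) \<longlongrightarrow> 0) (at_right 0)"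
  using sg by (simp_all add: sgroup_def)

lemma T_gen_lim: "gen x f \<Longrightarrow> ((\<lambda>h. nm ((1 / h) *\<^sub>R (x - T h x) - f)) \<longlongrightarrow> 0) (at_right 0)"
  using T_gen_iff[of x f] gen_P gen_P' by blast

lemma T_arg_P [simp]: assumes "0 \<le> t" shows "T t (P x) = T t x"
proof (rule rep_eqI)
  have "nm (T t (P x) - T t x) \<le> nm (P x - x)" by (rule contr_nm_diff[OF T_contr[OF assms]])
  also have "\<dots> = 0" by simp
  finally show "nm (T t (P x) - T t x) = 0" using nm_nonneg by (simp add: order_antisym)
qed (use assms in auto)

lemma T_commute: "0 \<le> s \<Longrightarrow> 0 \<le> t \<Longrightarrow> T s (T t x) = T t (T s x)"
  using T_plus[of s t x] T_plus[of t s x] by (simp add: add.commute)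

text \<open>\<open>T\<^sub>t\<close> is continuous, so it may be applied to the difference quotients that define
  \<open>L x\<close>.\<close>
lemma gen_T:
  assumes t: "0 \<le> t" and g: "gen x f" shows "gen (T t x) (T t f)"
proof -
  have "((\<lambda>h. nm ((1 / h) *\<^sub>R (T t x - T h (T t x)) - T t f)) \<longlongrightarrow> 0) (at_right 0)"
  proof (rule Lim_null_comparison[OF _ T_gen_lim[OF g]])
    show "\<forall>\<^sub>F h in at_right 0. norm (nm ((1 / h) *\<^sub>R (T t x - T h (T t x)) - T t f))
        \<le> nm ((1 / h) *\<^sub>R (x - T h x) - f)"
      using eventually_at_right_less[of 0]
    proof eventually_elim
      case (elim h)
      have "(1 / h) *\<^sub>R (T t x - T h (T t x)) - T t f = T t ((1 / h) *\<^sub>R (x - T h x) - f)"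
        using elim t T_commute[of h t x] by (simp add: contr_diff[OF T_contr[OF t]] contr_scale[OF T_contr[OF t]])
      then show ?case using contr_nm[OF T_contr[OF t]] by simp
    qed
  qed
  then show ?thesis using T_gen_iff[of "T t x" "T t f"] t by simp
qed

lemma T_J_commute:
  assumes t: "0 \<le> t" and h: "0 < h" shows "T t (J h x) = J h (T t x)"
proof -
  have "gen (T t (J h x)) (T t ((1 / h) *\<^sub>R (P x - J h x)))"
    by (rule gen_T[OF t gen_J[OF h]])
  also have "T t ((1 / h) *\<^sub>R (P x - J h x)) = (1 / h) *\<^sub>R (T t x - T t (J h x))"
    using t by (simp add: contr_diff[OF T_contr[OF t]] contr_scale[OF T_contr[OF t]])
  finally have "gen (T t (J h x)) ((1 / h) *\<^sub>R (T t x - T t (J h x)))" .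
  from J_gen_eq[OF h this] show ?thesis using h by simp
qed

lemma T_funpow: assumes "0 \<le> h" shows "T (real (Suc n) * h) x = (T h ^^ Suc n) x"
proof (induction n)
  case (Suc n)
  have "real (Suc (Suc n)) * h = h + real (Suc n) * h" by (simp add: algebra_simps)
  then have "T (real (Suc (Suc n)) * h) x = T h (T (real (Suc n) * h) x)"
    using assms by (simp only:) (rule T_plus, auto)
  with Suc show ?case by simp
qed simp

text \<open>Euler's formula for an arbitrary semigroup with the right generator; it transfers
  properties of the resolvent to the semigroup. On the domain of \<open>L\<close>, \<open>T\<^sub>h\<close> and \<open>J\<^sub>h\<close> agree up
  to \<open>o(h)\<close>, and the errors of \<open>t / h\<close> steps add up.\<close>
lemma T_exponential_formula:
  assumes t: "0 < t"
  shows "(\<lambda>n. nm ((J (t / real (Suc n)) ^^ Suc n) x - T t x)) \<longlonglongrightarrow> 0"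
proof -
  define h where "h n = t / real (Suc n)" for n
  have hpos: "0 < h n" for n using t by (simp add: h_def)
  have nh: "real (Suc n) * h n = t" for n by (simp add: h_def del: of_nat_Suc)
  have h0: "h \<longlonglongrightarrow> 0"
    unfolding h_def using tendsto_mult_right_zero[OF LIMSEQ_inverse_real_of_nat, of t] by (simp add: divide_inverse)
  have hr: "filterlim h (at_right 0) sequentially"
    using hpos h0 by (simp add: filterlim_at order_less_imp_not_eq2)
  have core: "(\<lambda>n. nm ((J (h n) ^^ Suc n) y - T t y)) \<longlonglongrightarrow> 0" if g: "gen y f" for y f
  proof (rule Lim_null_comparison)
    have "(\<lambda>n. nm (f - J (h n) f) + nm ((1 / h n) *\<^sub>R (y - T (h n) y) - f)) \<longlonglongrightarrow> 0 + 0"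
      by (intro tendsto_add J_seq_tendsto hpos h0 filterlim_compose[OF T_gen_lim[OF g] hr])
    then show "(\<lambda>n. t * (nm (f - J (h n) f) + nm ((1 / h n) *\<^sub>R (y - T (h n) y) - f))) \<longlonglongrightarrow> 0"
      using tendsto_mult_right_zero by fastforce
    show "\<forall>\<^sub>F n in sequentially. norm (nm ((J (h n) ^^ Suc n) y - T t y))
        \<le> t * (nm (f - J (h n) f) + nm ((1 / h n) *\<^sub>R (y - T (h n) y) - f))"
    proof (intro always_eventually allI)
      fix n
      have "nm ((J (h n) ^^ Suc n) y - (T (h n) ^^ Suc n) y) \<le> real (Suc n) * nm (J (h n) y - T (h n) y)"
        by (rule contr_funpow_diff[OF contr_J[OF hpos] T_contr])
          (use hpos[of n] T_J_commute[of "h n" "h n"] in \<open>auto intro: less_imp_le\<close>)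
      also have "(T (h n) ^^ Suc n) y = T t y" using T_funpow[of "h n" n y] hpos[of n] unfolding nh by simp
      also have "J (h n) y - T (h n) y = h n *\<^sub>R ((f - J (h n) f) + ((1 / h n) *\<^sub>R (y - T (h n) y) - f))"
        using gen_resolvent[OF hpos[of n] g] hpos[of n] by (simp add: algebra_simps)
      also have "real (Suc n) * nm \<dots> = t * nm ((f - J (h n) f) + ((1 / h n) *\<^sub>R (y - T (h n) y) - f))"
        using hpos[of n] nh[of n] by (simp add: nm_scale mult.assoc[symmetric] del: of_nat_Suc)
      also have "\<dots> \<le> t * (nm (f - J (h n) f) + nm ((1 / h n) *\<^sub>R (y - T (h n) y) - f))"
        using t by (intro mult_left_mono nm_triangle) simp
      finally show "norm (nm ((J (h n) ^^ Suc n) y - T t y))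
        \<le> t * (nm (f - J (h n) f) + nm ((1 / h n) *\<^sub>R (y - T (h n) y) - f))" by simp
    qed
  qed
  have "(\<lambda>n. nm ((J (h n) ^^ Suc n) x - T t x)) \<longlonglongrightarrow> 0"
  proof (rule LIMSEQ_I)
    fix \<epsilon> :: real assume e: "\<epsilon> > 0"
    obtain y f g where g: "gen y f" and xy: "nm (x - y) < \<epsilon> / 3" using gen2_dense[of "\<epsilon> / 3" x] e by auto
    obtain N where N: "\<And>n. n \<ge> N \<Longrightarrow> nm ((J (h n) ^^ Suc n) y - T t y) < \<epsilon> / 3"
      using LIMSEQ_D[OF core[OF g], of "\<epsilon> / 3"] e by auto
    have "nm ((J (h n) ^^ Suc n) x - T t x) < \<epsilon>" if "n \<ge> N" for n
    proof -
      have "nm ((J (h n) ^^ Suc n) x - (J (h n) ^^ Suc n) y) \<le> nm (x - y)"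
        by (rule contr_nm_diff[OF contr_funpow[OF contr_J[OF hpos]]])
      moreover have "nm (T t y - T t x) \<le> nm (y - x)" using t by (intro contr_nm_diff T_contr) simp
      ultimately show ?thesis
        using N[OF that] xy nm_minus_commute[of y x]
          nm_triangle_diff[of "(J (h n) ^^ Suc n) x" "T t x" "(J (h n) ^^ Suc n) y"]
          nm_triangle_diff[of "(J (h n) ^^ Suc n) y" "T t x" "T t y"] by linarith
    qed
    then show "\<exists>N. \<forall>n\<ge>N. norm (nm ((J (h n) ^^ Suc n) x - T t x) - 0) < \<epsilon>" by auto
  qed
  then show ?thesis by (simp only: h_def)
qed

lemma J_funpow_sym: "0 < h \<Longrightarrow> ip ((J h ^^ n) x) y = ip x ((J h ^^ n) y)"
  by (induction n arbitrary: x y) (simp_all add: J_sym funpow_swap1)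

lemma T_sym: assumes "0 \<le> t" shows "ip (T t x) y = ip x (T t y)"
proof (cases "t = 0")
  case False
  then have t: "0 < t" using assms by simp
  have "(\<lambda>n. ip ((J (t / real (Suc n)) ^^ Suc n) x) y) \<longlonglongrightarrow> ip (T t x) y"
    by (rule tendsto_ip[OF T_exponential_formula[OF t]])
  moreover have "(\<lambda>n. ip ((J (t / real (Suc n)) ^^ Suc n) y) x) \<longlonglongrightarrow> ip (T t y) x"
    by (rule tendsto_ip[OF T_exponential_formula[OF t]])
  moreover have "ip ((J (t / real (Suc n)) ^^ Suc n) x) y = ip ((J (t / real (Suc n)) ^^ Suc n) y) x" for n
    using J_funpow_sym[of "t / real (Suc n)" "Suc n" x y] t ip_sym[of x] by simp
  ultimately have "ip (T t x) y = ip (T t y) x" using LIMSEQ_unique by auto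
  then show ?thesis by (simp add: ip_sym[of x "T t y"])
qed simp

lemma T_small:
  assumes "0 < \<epsilon>" shows "\<exists>\<delta>>0. \<forall>r. 0 \<le> r \<and> r < \<delta> \<longrightarrow> nm (T r x - x) < \<epsilon>"
proof -
  have "\<forall>\<^sub>F r in at_right 0. nm (T r x - x) < \<epsilon>" using T_cont[of x] assms by (rule order_tendstoD(2))
  then obtain \<delta> where \<delta>: "\<delta> > 0" and d: "\<And>r. 0 < r \<Longrightarrow> r < \<delta> \<Longrightarrow> nm (T r x - x) < \<epsilon>"
    by (auto simp: eventually_at_right_field)
  have "nm (T 0 x - x) < \<epsilon>" using assms by simp
  then show ?thesis using \<delta> d by (metis order_le_less)
qed

lemma T_dist: assumes "0 \<le> s" "0 \<le> t" shows "nm (T s x - T t x) \<le> nm (T \<bar>s - t\<bar> x - x)"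
proof -
  have *: "nm (T s x - T t x) \<le> nm (T (s - t) x - x)" if "0 \<le> t" "t \<le> s" for s t
  proof -
    have "T s x = T t (T (s - t) x)" using T_plus[of t "s - t" x] that by simp
    then show ?thesis using contr_nm_diff[OF T_contr[OF that(1)], of "T (s - t) x" x] by simp
  qed
  show ?thesis using *[of t s] *[of s t] assms nm_minus_commute[of "T s x"] by (cases "t \<le> s") auto
qed

lemma T_seq_continuous:
  assumes "\<And>n. 0 \<le> s n" "s \<longlonglongrightarrow> t" "0 \<le> t" shows "(\<lambda>n. nm (T (s n) x - T t x)) \<longlonglongrightarrow> 0"
proof (rule LIMSEQ_I)
  fix \<epsilon> :: real assume e: "\<epsilon> > 0"
  obtain \<delta> where \<delta>: "\<delta> > 0" and d: "\<And>r. 0 \<le> r \<Longrightarrow> r < \<delta> \<Longrightarrow> nm (T r x - x) < \<epsilon>"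
    using T_small[OF e] by blast
  obtain N where N: "\<And>n. n \<ge> N \<Longrightarrow> \<bar>s n - t\<bar> < \<delta>" using LIMSEQ_D[OF assms(2) \<delta>] by auto
  have "nm (T (s n) x - T t x) < \<epsilon>" if "n \<ge> N" for n
    using T_dist[OF assms(1,3), of n x] d[of "\<bar>s n - t\<bar>"] N[OF that] by simp
  then show "\<exists>N. \<forall>n\<ge>N. norm (nm (T (s n) x - T t x) - 0) < \<epsilon>" by auto
qed

definition tform :: "real \<Rightarrow> 'b \<Rightarrow> real" where
  "tform t u = defect_form (T t) u / t"

text \<open>On a grid of mesh \<open>h\<close> the second differences of \<open>n \<mapsto> (T\<^sub>n\<^sub>h u, u)\<close> are the squares
  \<open>\<parallel>T\<^sub>n\<^sub>h\<^sub>/\<^sub>2 (u - T\<^sub>h u)\<parallel>\<^sup>2\<close>, so the sequence is convex and its slopes from \<open>0\<close> are monotone.\<close>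
lemma defect_T_grid:
  assumes h: "0 \<le> h" and nm: "n \<le> m"
  shows "real n * defect_form (T (real m * h)) u \<le> real m * defect_form (T (real n * h)) u"
proof -
  define a where "a n = ip (T (real n * h) u) u" for n :: nat
  have a0: "a 0 = ip u u" by (simp add: a_def)
  have convex: "a (Suc n) - a (Suc (Suc n)) \<le> a n - a (Suc n)" for n
  proof -
    let ?v = "u - T h u" and ?r = "real n * h / 2"
    have r: "0 \<le> ?r" using h by simp
    have "0 \<le> ip (T ?r ?v) (T ?r ?v)" by simp
    also have "\<dots> = ip (T ?r (T ?r ?v)) ?v" by (simp add: T_sym[OF r])
    also have "T ?r (T ?r ?v) = T (real n * h) ?v" using T_plus[OF r r, of ?v] by (simp only: field_sum_of_halves)
    also have "\<dots> = T (real n * h) u - T (real n * h) (T h u)"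
      using h by (simp add: contr_diff[OF T_contr])
    also have "T (real n * h) (T h u) = T (real (Suc n) * h) u"
      using T_plus[of "real n * h" h u] h by (simp add: algebra_simps)
    also have "ip (T (real n * h) u - T (real (Suc n) * h) u) ?v =
        a n - a (Suc n) - ip (T h (T (real n * h) u)) u + ip (T h (T (real (Suc n) * h) u)) u"
      using h by (simp add: ip_bilin a_def T_sym[OF h])
    also have "T h (T (real n * h) u) = T (real (Suc n) * h) u"
      using T_plus[of h "real n * h" u] h by (simp add: algebra_simps)
    also have "T h (T (real (Suc n) * h) u) = T (real (Suc (Suc n)) * h) u"
      using T_plus[of h "real (Suc n) * h" u] h by (simp add: algebra_simps)
    finally show ?thesis by (simp add: a_def)
  qed
  define d where "d n = a n - a (Suc n)" for n
  have dec: "d j \<le> d i" if "i \<le> j" for i j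
    using that
  proof (induction rule: dec_induct)
    case (step n)
    then show ?case using convex[of n] by (simp add: d_def)
  qed simp
  have low: "real n * d m \<le> a 0 - a n" if "n \<le> m" for n m
    using that
  proof (induction n)
    case (Suc n)
    then have "real n * d m \<le> a 0 - a n" "d m \<le> d n" using dec[of n m] by auto
    then show ?case by (simp add: d_def algebra_simps)
  qed simp
  have "real n * (a 0 - a m) \<le> real m * (a 0 - a n)"
    using nm
  proof (induction rule: dec_induct)
    case (step m)
    then show ?case using low[of n m] by (simp add: d_def algebra_simps)
  qed simp
  then show ?thesis by (simp add: defect_form_def a_def)
qed

text \<open>The slope of the concave function \<open>t \<mapsto> (u - T\<^sub>t u, u)\<close> from \<open>0\<close> decreases. Grids with
  \<open>N\<close> points on \<open>[0, s]\<close> reach \<open>t\<close> only in the limit, where continuity of the semigroup is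
  used.\<close>
lemma tform_mono:
  assumes t: "0 < t" and ts: "t \<le> s" shows "tform s u \<le> tform t u"
proof -
  have s: "0 < s" using assms by simp
  define N where "N k = Suc k" for k :: nat
  \<comment> \<open>the largest grid point of mesh \<open>s / N k\<close> below \<open>t\<close>\<close>
  define n where "n k = nat \<lfloor>t / s * real (N k)\<rfloor>" for k
  have r: "0 \<le> t / s" "t / s \<le> 1" using t ts s by auto
  have n1: "real (n k) \<le> t / s * real (N k)" "t / s * real (N k) - 1 \<le> real (n k)" for k
  proof -
    have "0 \<le> t / s * real (N k)" by (intro mult_nonneg_nonneg r(1)) simp
    then have "0 \<le> \<lfloor>t / s * real (N k)\<rfloor>" by (simp only: zero_le_floor)
    then have e: "real (n k) = of_int \<lfloor>t / s * real (N k)\<rfloor>" unfolding n_def by (rule of_nat_nat)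
    show "real (n k) \<le> t / s * real (N k)" "t / s * real (N k) - 1 \<le> real (n k)" unfolding e by linarith+
  qed
  have nN: "n k \<le> N k" for k
  proof -
    have "real (n k) \<le> 1 * real (N k)" using n1(1)[of k] r(2) by (meson mult_right_mono of_nat_0_le_iff order_trans)
    then show ?thesis by simp
  qed
  have lim: "(\<lambda>k. real (n k) / real (N k)) \<longlonglongrightarrow> t / s"
  proof (rule tendsto_sandwich)
    show "\<forall>\<^sub>F k in sequentially. t / s - 1 / real (N k) \<le> real (n k) / real (N k)"
    proof (intro always_eventually allI)
      fix k
      have "(t / s * real (N k) - 1) / real (N k) \<le> real (n k) / real (N k)"
        by (rule divide_right_mono[OF n1(2)]) simp
      then show "t / s - 1 / real (N k) \<le> real (n k) / real (N k)"
        by (simp add: N_def diff_divide_distrib del: of_nat_Suc)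
    qed
    show "\<forall>\<^sub>F k in sequentially. real (n k) / real (N k) \<le> t / s"
      using n1(1) by (auto intro!: always_eventually simp: N_def pos_divide_le_eq simp del: of_nat_Suc)
    show "(\<lambda>k. t / s - 1 / real (N k)) \<longlonglongrightarrow> t / s"
      using tendsto_diff[OF tendsto_const[of "t / s"] LIMSEQ_inverse_real_of_nat]
      by (simp add: N_def inverse_eq_divide del: of_nat_Suc)
  qed simp
  have "(\<lambda>k. real (n k) / real (N k) * s) \<longlonglongrightarrow> t / s * s" by (intro tendsto_intros lim)
  then have "(\<lambda>k. real (n k) / real (N k) * s) \<longlonglongrightarrow> t" using s by simp
  then have "(\<lambda>k. nm (T (real (n k) / real (N k) * s) u - T t u)) \<longlonglongrightarrow> 0"
    using s t by (intro T_seq_continuous) auto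
  then have "(\<lambda>k. defect_form (T (real (n k) / real (N k) * s)) u) \<longlonglongrightarrow> defect_form (T t) u"
    unfolding defect_form_def by (intro tendsto_intros tendsto_ip)
  moreover have "(\<lambda>k. real (n k) / real (N k) * defect_form (T s) u) \<longlonglongrightarrow> t / s * defect_form (T s) u"
    by (intro tendsto_intros lim)
  moreover have "real (n k) / real (N k) * defect_form (T s) u \<le> defect_form (T (real (n k) / real (N k) * s)) u" for k
    using defect_T_grid[of "s / real (N k)" "n k" "N k" u] nN[of k] s
    by (simp add: N_def field_simps del: of_nat_Suc)
  ultimately have "t / s * defect_form (T s) u \<le> defect_form (T t) u"
    by (intro LIMSEQ_le) auto
  then show ?thesis using s t by (simp add: tform_def field_simps)
qed

lemma tform_gen_tendsto:
  assumes g: "gen v f" shows "((\<lambda>t. ip u ((1 / t) *\<^sub>R (v - T t v))) \<longlongrightarrow> ip u f) (at_right 0)"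
  using tendsto_ip[OF T_gen_lim[OF g], of u] by (simp add: ip_sym[of u])

lemma tform_eq: "tform t v = ip v ((1 / t) *\<^sub>R (v - T t v))"
  by (simp add: tform_def defect_form_def ip_bilin ip_sym[of v "T t v"])

text \<open>On the domain of \<open>L\<close> the limit \<open>t \<rightarrow> 0\<close> is \<open>(L v, v) = b v v\<close>, and monotonicity
  applies. A general \<open>u\<close> is approximated by \<open>J\<^sub>h u\<close>, whose energy does not exceed that of
  \<open>u\<close>.\<close>
lemma tform_le_form:
  assumes t: "0 < t" and u: "u \<in> D" shows "tform t u \<le> b u u"
proof -
  have core: "tform t v \<le> b v v" if g: "gen v f" for v f
  proof (rule tendsto_lowerbound)
    show "((\<lambda>s. tform s v) \<longlongrightarrow> b v v) (at_right 0)"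
      using tform_gen_tendsto[OF g, of v] gen_b[OF g gen_dom[OF g]] by (simp add: tform_eq ip_sym[of v f])
    have "\<forall>\<^sub>F s in at_right 0. 0 < s \<and> s < t"
      using t eventually_at_right_real by fastforce
    then show "\<forall>\<^sub>F s in at_right 0. tform t v \<le> tform s v"
      by eventually_elim (auto intro: tform_mono)
  qed simp
  define h where "h n = 1 / real (Suc n)" for n
  have hpos: "0 < h n" for n by (simp add: h_def)
  have h0: "h \<longlonglongrightarrow> 0" unfolding h_def using LIMSEQ_inverse_real_of_nat by (simp add: inverse_eq_divide)
  let ?v = "\<lambda>n. J (h n) u"
  have nv: "(\<lambda>n. nm (?v n - u)) \<longlonglongrightarrow> 0"
    using J_seq_tendsto[OF hpos h0, of u] by (simp add: nm_minus_commute[of u])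
  have "tform t (?v n) \<le> b u u" for n
  proof -
    have "tform t (?v n) \<le> b (?v n) (?v n)" by (rule core[OF gen_J[OF hpos]])
    also have "\<dots> \<le> env (h n) u" using hpos[of n] by (simp add: env_eq)
    also have "\<dots> \<le> b u u" by (rule env_le_form[OF hpos u])
    finally show ?thesis .
  qed
  moreover have "(\<lambda>n. tform t (?v n)) \<longlonglongrightarrow> tform t u"
  proof -
    have Tv: "(\<lambda>n. nm (T t (?v n) - T t u)) \<longlonglongrightarrow> 0"
      by (rule Lim_null_comparison[OF _ nv]) (use t contr_nm_diff[OF T_contr] in \<open>auto intro!: always_eventually\<close>)
    have e: "ip (?v n) (?v n) - ip (T t (?v n)) (?v n) = (nm (?v n))\<^sup>2 - ip (T t (?v n) - T t u) (?v n) - ip (?v n) (T t u)" for n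
      by (simp add: nm_square ip_bilin ip_sym[of "?v n" "T t u"])
    have small: "(\<lambda>n. ip (T t (?v n) - T t u) (?v n)) \<longlonglongrightarrow> 0"
    proof (rule Lim_null_comparison)
      show "(\<lambda>n. nm (T t (?v n) - T t u) * nm u) \<longlonglongrightarrow> 0" using tendsto_mult_left_zero[OF Tv] .
      show "\<forall>\<^sub>F n in sequentially. norm (ip (T t (?v n) - T t u) (?v n)) \<le> nm (T t (?v n) - T t u) * nm u"
      proof (intro always_eventually allI)
        fix n
        have "\<bar>ip (T t (?v n) - T t u) (?v n)\<bar> \<le> nm (T t (?v n) - T t u) * nm (?v n)" by (rule ip_abs_le)
        also have "\<dots> \<le> nm (T t (?v n) - T t u) * nm u" using nm_J_le[OF hpos] by (intro mult_left_mono) auto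
        finally show "norm (ip (T t (?v n) - T t u) (?v n)) \<le> nm (T t (?v n) - T t u) * nm u" by simp
      qed
    qed
    have "(\<lambda>n. (nm (?v n))\<^sup>2 - ip (T t (?v n) - T t u) (?v n) - ip (?v n) (T t u)) \<longlonglongrightarrow> (nm u)\<^sup>2 - 0 - ip u (T t u)"
      by (intro tendsto_intros tendsto_nm[OF nv] small tendsto_ip[OF nv])
    then show ?thesis
      unfolding tform_def defect_form_def e using t
      by (intro tendsto_divide) (auto simp: nm_square ip_sym[of u "T t u"])
  qed
  ultimately show ?thesis by (intro LIMSEQ_le_const2) auto
qed

text \<open>Testing against \<open>v = J h w\<close> bounds the envelopes of \<open>w\<close> by the limit of the approximating forms.\<close>
lemma tform_bounded_imp_dom:
  assumes w: "P w = w" and M: "\<And>t. 0 < t \<Longrightarrow> tform t w \<le> M"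
  shows "w \<in> D \<and> b w w \<le> M"
proof (rule env_bounded_imp_dom[OF w])
  fix h :: real assume h: "0 < h"
  let ?v = "J h w" let ?f = "(1 / h) *\<^sub>R (P w - J h w)"
  have g: "gen ?v ?f" by (rule gen_J[OF h])
  have "2 * ip w ?f - ip ?v ?f \<le> M"
  proof (rule tendsto_upperbound)
    show "((\<lambda>t. 2 * ip w ((1 / t) *\<^sub>R (?v - T t ?v)) - ip ?v ((1 / t) *\<^sub>R (?v - T t ?v))) \<longlongrightarrow> 2 * ip w ?f - ip ?v ?f) (at_right 0)"
      by (intro tendsto_intros tform_gen_tendsto[OF g])
    show "\<forall>\<^sub>F t in at_right 0. 2 * ip w ((1 / t) *\<^sub>R (?v - T t ?v)) - ip ?v ((1 / t) *\<^sub>R (?v - T t ?v)) \<le> M"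
      using eventually_at_right_less[of 0]
    proof eventually_elim
      case (elim t)
      have "(2 * ip w (?v - T t ?v) - defect_form (T t) ?v) / t \<le> tform t w"
        unfolding tform_def using elim
        by (intro divide_right_mono defect_form_tangent T_contr T_sym) auto
      also have "(2 * ip w (?v - T t ?v) - defect_form (T t) ?v) / t =
          2 * ip w ((1 / t) *\<^sub>R (?v - T t ?v)) - tform t ?v"
        by (simp add: tform_def ip_scale_right diff_divide_distrib)
      finally show ?case using M[OF elim] unfolding tform_eq by simp
    qed
  qed simp
  moreover have "env h w \<le> 2 * ip w ?f - ip ?v ?f"
  proof -
    have "2 * ip w ?f - ip ?v ?f = env h w + ip (w - ?v) (w - ?v) / h"
      using h w by (simp add: env_def ip_bilin ip_sym[of w ?v] field_simps)
    then show ?thesis using h by simp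
  qed
  ultimately show "env h w \<le> M" by simp
qed

lemma T_ip_has_derivative:
  assumes g: "gen x f" and s: "0 \<le> s"
  shows "((\<lambda>s. ip (T s x) y) has_real_derivative - ip (T s f) y) (at s within {0..})"
  unfolding has_field_derivative_iff
proof (rule tendstoI)
  fix \<epsilon> :: real assume e: "\<epsilon> > 0"
  define \<eta> where "\<eta> = \<epsilon> / (2 * (nm y + 1))"
  have y1: "0 < nm y + 1" using nm_nonneg[of y] by linarith
  have eta: "\<eta> > 0" using e y1 by (simp add: \<eta>_def)
  have "\<forall>\<^sub>F r in at_right 0. nm ((1 / r) *\<^sub>R (x - T r x) - f) < \<eta>"
    using T_gen_lim[OF g] eta by (rule order_tendstoD(2))
  then obtain d1 where d1: "d1 > 0" "\<And>r. 0 < r \<Longrightarrow> r < d1 \<Longrightarrow> nm ((1 / r) *\<^sub>R (x - T r x) - f) < \<eta>"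
    by (auto simp: eventually_at_right_field)
  obtain d2 where d2: "d2 > 0" "\<And>r. 0 \<le> r \<Longrightarrow> r < d2 \<Longrightarrow> nm (T r f - f) < \<eta>" using T_small[OF eta] by blast
  have main: "\<bar>(ip (T s' x) y - ip (T s x) y) / (s' - s) + ip (T s f) y\<bar> < \<epsilon>"
    if s': "0 \<le> s'" "s' \<noteq> s" "\<bar>s' - s\<bar> < min d1 d2" for s'
  proof -
    define r where "r = \<bar>s' - s\<bar>"
    have r: "0 < r" "r < d1" "r < d2" using s' by (auto simp: r_def)
    define z where "z = (1 / (s' - s)) *\<^sub>R (T s' x - T s x) + T s f"
    let ?q = "(1 / r) *\<^sub>R (x - T r x) - f"
    have "nm z \<le> nm ?q + nm (T r f - f)"
    proof (cases "s < s'")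
      case True
      then have "s' = s + r" by (simp add: r_def)
      then have "z = T s ((-1) *\<^sub>R ?q)"
        using r s T_plus[of s r x] unfolding z_def
        by (simp add: contr_diff[OF T_contr[OF s]] contr_scale[OF T_contr[OF s]] contr_add[OF T_contr[OF s]] algebra_simps)
      then have "nm z \<le> nm ((-1) *\<^sub>R ?q)" using contr_nm[OF T_contr[OF s]] by simp
      also have "\<dots> = nm ?q" by (subst nm_scale) simp
      finally show ?thesis using nm_nonneg[of "T r f - f"] by linarith
    next
      case False
      then have ss: "s = s' + r" "s' - s = - r" using s' by (auto simp: r_def)
      have "z = T s' ((T r f - f) - ?q)"
        using r s' T_plus[of s' r x] T_plus[of s' r f] unfolding z_def ss(2) unfolding ss(1)
        by (simp add: contr_diff[OF T_contr[OF s'(1)]] contr_scale[OF T_contr[OF s'(1)]] contr_add[OF T_contr[OF s'(1)]] algebra_simps)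
      then have "nm z \<le> nm ((T r f - f) - ?q)" using contr_nm[OF T_contr[OF s'(1)]] by simp
      then show ?thesis using nm_diff_le[of "T r f - f" ?q] by linarith
    qed
    also have "\<dots> < 2 * \<eta>" using d1(2)[of r] d2(2)[of r] r by simp
    finally have z: "nm z < 2 * \<eta>" .
    have "\<bar>ip z y\<bar> \<le> nm z * nm y" by (rule ip_abs_le)
    also have "\<dots> \<le> nm z * (nm y + 1)" by (intro mult_left_mono) auto
    also have "\<dots> < 2 * \<eta> * (nm y + 1)" using z y1 by (rule mult_strict_right_mono)
    also have "\<dots> = \<epsilon>" using y1 by (simp add: \<eta>_def field_simps)
    finally show ?thesis by (simp add: z_def ip_bilin diff_divide_distrib)
  qed
  show "\<forall>\<^sub>F s' in at s within {0..}. dist ((ip (T s' x) y - ip (T s x) y) / (s' - s)) (- ip (T s f) y) < \<epsilon>"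
    unfolding eventually_at
  proof (intro exI conjI ballI impI)
    show "0 < min d1 d2" using d1 d2 by simp
  next
    fix s' assume "s' \<in> {0..}" "s' \<noteq> s \<and> dist s' s < min d1 d2"
    then show "dist ((ip (T s' x) y - ip (T s x) y) / (s' - s)) (- ip (T s f) y) < \<epsilon>"
      using main[of s'] by (simp add: dist_real_def)
  qed
qed

text \<open>\<open>J\<^sub>h f\<close> is the Laplace transform of \<open>T\<^sub>s f\<close>: the integrand is the derivative of
  \<open>- e\<^sup>-\<^sup>s\<^sup>/\<^sup>h (T\<^sub>s J\<^sub>h f, y)\<close>, because \<open>L J\<^sub>h f = (f - J\<^sub>h f) / h\<close>.\<close>
lemma resolvent_laplace:
  assumes h: "0 < h" and N: "0 \<le> N"
  shows "((\<lambda>s. exp (- s / h) / h * ip (T s f) y) has_integral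
          (ip (J h f) y - exp (- N / h) * ip (T N (J h f)) y)) {0..N}"
proof -
  let ?x = "J h f" and ?g = "(1 / h) *\<^sub>R (P f - J h f)"
  define F where "F s = - (exp (- s / h) * ip (T s ?x) y)" for s
  have "(F has_vector_derivative exp (- s / h) / h * ip (T s f) y) (at s within {0..N})" if s: "s \<in> {0..N}" for s
  proof -
    have s0: "0 \<le> s" using s by simp
    have d: "((\<lambda>s. ip (T s ?x) y) has_real_derivative - ip (T s ?g) y) (at s within {0..N})"
      by (rule has_field_derivative_subset[OF T_ip_has_derivative[OF gen_J[OF h] s0]]) auto
    have "(F has_real_derivative - (exp (- s / h) * (- 1 / h) * ip (T s ?x) y + exp (- s / h) * (- ip (T s ?g) y))) (at s within {0..N})"
      unfolding F_def by (rule derivative_eq_intros refl d | use h in \<open>simp add: algebra_simps\<close>)+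
    also have "- (exp (- s / h) * (- 1 / h) * ip (T s ?x) y + exp (- s / h) * (- ip (T s ?g) y)) = exp (- s / h) / h * ip (T s f) y"
      using h s0 by (simp add: contr_diff[OF T_contr[OF s0]] contr_scale[OF T_contr[OF s0]] ip_bilin field_simps)
    finally show ?thesis by (simp add: has_real_derivative_iff_has_vector_derivative)
  qed
  from fundamental_theorem_of_calculus[OF N this] show ?thesis using h by (simp add: F_def)
qed

end

section \<open>Completeness of \<open>L\<^sup>2\<close> and choice of representatives\<close>

lemma scaleR_fun_apply [simp]: "(c *\<^sub>R f) x = c *\<^sub>R f x"
  by (simp add: scaleR_fun_def)

lemma L2D: "u \<in> L2 m \<Longrightarrow> u \<in> borel_measurable m" "u \<in> L2 m \<Longrightarrow> integrable m (\<lambda>x. (u x)\<^sup>2)"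
  by (auto simp: L2_def)

lemma L2_product_integrable:
  assumes "u \<in> L2 m" "v \<in> L2 m" shows "integrable m (\<lambda>x. u x * v x)"
proof (rule Bochner_Integration.integrable_bound)
  show "integrable m (\<lambda>x. (u x)\<^sup>2 + (v x)\<^sup>2)" using assms by (auto simp: L2_def)
  show "(\<lambda>x. u x * v x) \<in> borel_measurable m" using assms by (auto simp: L2_def)
  show "AE x in m. norm (u x * v x) \<le> norm ((u x)\<^sup>2 + (v x)\<^sup>2)"
  proof (intro AE_I2)
    fix x
    have "2 * \<bar>u x\<bar> * \<bar>v x\<bar> \<le> \<bar>u x\<bar>\<^sup>2 + \<bar>v x\<bar>\<^sup>2" by (rule sum_squares_bound)
    moreover have "0 \<le> \<bar>u x\<bar> * \<bar>v x\<bar>" by simp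
    moreover have "norm (u x * v x) = \<bar>u x\<bar> * \<bar>v x\<bar>" by (simp add: abs_mult)
    ultimately have "norm (u x * v x) \<le> (u x)\<^sup>2 + (v x)\<^sup>2" unfolding power2_abs by linarith
    then show "norm (u x * v x) \<le> norm ((u x)\<^sup>2 + (v x)\<^sup>2)" by simp
  qed
qed

lemma L2_dominated:
  assumes v: "v \<in> L2 m" and u: "u \<in> borel_measurable m" and le: "AE x in m. \<bar>u x\<bar> \<le> \<bar>v x\<bar>"
  shows "u \<in> L2 m"
proof -
  have "integrable m (\<lambda>x. (u x)\<^sup>2)"
  proof (rule Bochner_Integration.integrable_bound[OF L2D(2)[OF v]])
    show "AE x in m. norm ((u x)\<^sup>2) \<le> norm ((v x)\<^sup>2)"
      using le by eventually_elim (simp add: abs_le_square_iff)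
  qed (use u in measurable)
  then show ?thesis using u by (simp add: L2_def)
qed

lemma L2_add: assumes "u \<in> L2 m" "v \<in> L2 m" shows "(\<lambda>x. u x + v x) \<in> L2 m"
proof -
  have "integrable m (\<lambda>x. (u x)\<^sup>2 + (v x)\<^sup>2 + 2 * (u x * v x))"
    using assms L2_product_integrable[OF assms] by (auto simp: L2_def)
  then show ?thesis using L2D(1)[OF assms(1)] L2D(1)[OF assms(2)]
    by (auto simp: L2_def power2_sum mult.assoc)
qed

lemma L2_scale: "u \<in> L2 m \<Longrightarrow> (\<lambda>x. c * u x) \<in> L2 m"
  by (auto simp: L2_def power_mult_distrib)

lemma L2_zero: "(\<lambda>x. 0) \<in> L2 m" by (simp add: L2_def)

lemma L2_diff: "u \<in> L2 m \<Longrightarrow> v \<in> L2 m \<Longrightarrow> (\<lambda>x. u x - v x) \<in> L2 m"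
  using L2_add[OF _ L2_scale[of v m "-1"], of u] by simp

lemma L2_subspace: "subspace (L2 m)"
  unfolding subspace_def using L2_add L2_scale L2_zero
  by (auto simp: plus_fun_def zero_fun_def scaleR_fun_def)

lemma L2_indicator: "u \<in> L2 m \<Longrightarrow> Y \<in> sets m \<Longrightarrow> (\<lambda>x. indicator Y x * u x) \<in> L2 m"
  by (rule L2_dominated[of u]) (auto simp: abs_mult indicator_def dest: L2D)

lemma L2_inner_add:
  "u \<in> L2 m \<Longrightarrow> v \<in> L2 m \<Longrightarrow> w \<in> L2 m \<Longrightarrow> L2_inner m (\<lambda>x. u x + v x) w = L2_inner m u w + L2_inner m v w"
  by (simp add: L2_inner_def distrib_right L2_product_integrable)

lemma L2_inner_scale: "L2_inner m (\<lambda>x. c * u x) w = c * L2_inner m u w"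
  by (simp add: L2_inner_def mult.assoc)

lemma L2_inner_commute: "L2_inner m u v = L2_inner m v u"
  by (simp add: L2_inner_def mult.commute)

lemma L2_inner_self: "L2_inner m u u = (\<integral>x. (u x)\<^sup>2 \<partial>m)"
  by (simp add: L2_inner_def power2_eq_square)

lemma L2_inner_nonneg: "0 \<le> L2_inner m u u"
  by (simp add: L2_inner_self)

lemma L2_norm_square: "(L2_norm m u)\<^sup>2 = L2_inner m u u"
  by (simp add: L2_norm_def L2_inner_nonneg)

lemma L2_inner_cong_AE:
  assumes "u \<in> borel_measurable m" "v \<in> borel_measurable m" "u' \<in> borel_measurable m" "v' \<in> borel_measurable m"
    and "AE x in m. u x = u' x" "AE x in m. v x = v' x"
  shows "L2_inner m u v = L2_inner m u' v'"
  unfolding L2_inner_def using assms by (intro integral_cong_AE) auto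

lemma L2_norm_zero_iff:
  assumes "u \<in> L2 m" shows "L2_inner m u u = 0 \<longleftrightarrow> (AE x in m. u x = 0)"
  unfolding L2_inner_self using integral_nonneg_eq_0_iff_AE[of m "\<lambda>x. (u x)\<^sup>2"] L2D(2)[OF assms] by simp

text \<open>Along a fast subsequence the weights \<open>2\<^sup>k\<close> make \<open>\<Sum> 2\<^sup>k d\<^sub>k\<^sup>2\<close> integrable, and
  \<open>2 |d\<^sub>k| \<le> 2\<^sup>-\<^sup>k + 2\<^sup>k d\<^sub>k\<^sup>2\<close> then gives pointwise convergence almost everywhere. Fatou's lemma
  identifies the pointwise limit as a limit in norm.\<close>
lemma L2_complete:
  fixes u :: "nat \<Rightarrow> 'a \<Rightarrow> real"
  assumes u: "\<And>n. u n \<in> L2 m"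
    and cau: "\<And>\<epsilon>. 0 < \<epsilon> \<Longrightarrow> \<exists>N. \<forall>i\<ge>N. \<forall>j\<ge>N. L2_inner m (\<lambda>x. u i x - u j x) (\<lambda>x. u i x - u j x) < \<epsilon>"
  shows "\<exists>w\<in>L2 m. (\<lambda>n. L2_inner m (\<lambda>x. u n x - w x) (\<lambda>x. u n x - w x)) \<longlonglongrightarrow> 0"
proof -
  have um [measurable]: "u n \<in> borel_measurable m" for n using L2D(1)[OF u] .
  let ?D = "\<lambda>i j. \<integral>x. (u i x - u j x)\<^sup>2 \<partial>m"
  have Dint: "integrable m (\<lambda>x. (u i x - u j x)\<^sup>2)" for i j using L2D(2)[OF L2_diff[OF u u]] .
  have "\<exists>N. \<forall>i\<ge>N. \<forall>j\<ge>N. ?D i j < 1 / 8 ^ k" for k :: nat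
    using cau[of "1 / 8 ^ k"] by (simp add: L2_inner_self)
  then obtain N where N: "\<And>k i j. i \<ge> N k \<Longrightarrow> j \<ge> N k \<Longrightarrow> ?D i j < 1 / 8 ^ k" by metis
  \<comment> \<open>maxima of the thresholds, to make the subsequence increase\<close>
  define r where "r k = Max (N ` {..k})" for k
  have rN: "N k \<le> r k" for k unfolding r_def by simp
  have rr: "r k \<le> r (Suc k)" for k unfolding r_def by (rule Max_mono) auto
  define d where "d k x = u (r (Suc k)) x - u (r k) x" for k x
  have dm [measurable]: "d k \<in> borel_measurable m" for k unfolding d_def by measurable
  have dint: "integrable m (\<lambda>x. (d k x)\<^sup>2)" for k unfolding d_def by (rule Dint)
  have d8: "(\<integral>x. (d k x)\<^sup>2 \<partial>m) \<le> 1 / 8 ^ k" for k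
    unfolding d_def using N[of k "r (Suc k)" "r k"] rN[of k] rr[of k] by simp
  have "(\<integral>\<^sup>+ x. (\<Sum>k. ennreal (2 ^ k * (d k x)\<^sup>2)) \<partial>m) = (\<Sum>k. \<integral>\<^sup>+ x. ennreal (2 ^ k * (d k x)\<^sup>2) \<partial>m)"
    by (intro nn_integral_suminf) measurable
  also have "\<dots> \<le> (\<Sum>k. ennreal ((1/4) ^ k))"
  proof (intro suminf_le)
    fix k
    have "(\<integral>\<^sup>+ x. ennreal (2 ^ k * (d k x)\<^sup>2) \<partial>m) = ennreal (\<integral>x. 2 ^ k * (d k x)\<^sup>2 \<partial>m)"
      using dint[of k] by (intro nn_integral_eq_integral) auto
    also have "\<dots> \<le> ennreal (2 ^ k * (1 / 8 ^ k))"
      using mult_left_mono[OF d8[of k], of "2 ^ k"] by (intro ennreal_leI) simp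
    also have "(2::real) ^ k * (1 / 8 ^ k) = (1 / 4) ^ k" by (simp add: power_divide[symmetric])
    finally show "(\<integral>\<^sup>+ x. ennreal (2 ^ k * (d k x)\<^sup>2) \<partial>m) \<le> ennreal ((1/4) ^ k)" .
  qed auto
  also have "\<dots> = ennreal (\<Sum>k. (1/4) ^ k)"
    by (intro suminf_ennreal2 summable_geometric) auto
  also have "\<dots> < \<infinity>" by simp
  finally have fin: "(\<integral>\<^sup>+ x. (\<Sum>k. ennreal (2 ^ k * (d k x)\<^sup>2)) \<partial>m) \<noteq> \<infinity>" by simp
  have "AE x in m. (\<Sum>k. ennreal (2 ^ k * (d k x)\<^sup>2)) \<noteq> \<infinity>"
    by (rule nn_integral_PInf_AE[OF _ fin]) measurable
  then have conv: "AE x in m. convergent (\<lambda>k. u (r k) x)"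
  proof eventually_elim
    case (elim x)
    then have s: "summable (\<lambda>k. 2 ^ k * (d k x)\<^sup>2)" by (intro summable_suminf_not_top) auto
    have "summable (\<lambda>k. (1/2) ^ k + 2 ^ k * (d k x)\<^sup>2)"
      by (intro summable_add s summable_geometric) simp
    then have "summable (\<lambda>k. d k x)"
    proof (rule summable_comparison_test'[where N = 0])
      fix k
      have "0 \<le> ((1/2) ^ k + 2 ^ k * \<bar>d k x\<bar>\<^sup>2) - 2 * \<bar>d k x\<bar>"
      proof -
        have "0 \<le> 2 ^ k * (\<bar>d k x\<bar> - (1/2) ^ k)\<^sup>2" by simp
        also have "\<dots> = 2 ^ k * (1/2)^k * (1/2) ^ k + 2 ^ k * \<bar>d k x\<bar>\<^sup>2 - 2 * (2 ^ k * (1/2) ^ k) * \<bar>d k x\<bar>"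
          by (simp add: power2_diff power2_eq_square algebra_simps)
        also have "(2::real) ^ k * (1/2)^k = 1" by (simp add: power_mult_distrib[symmetric])
        finally show ?thesis by simp
      qed
      then show "norm (d k x) \<le> (1/2) ^ k + 2 ^ k * (d k x)\<^sup>2" by simp
    qed
    then have "convergent (\<lambda>n. \<Sum>k<n. d k x)" by (simp add: summable_iff_convergent)
    moreover have "(\<Sum>k<n. d k x) = u (r n) x - u (r 0) x" for n
      unfolding d_def by (rule sum_lessThan_telescope)
    ultimately have "convergent (\<lambda>n. u (r n) x - u (r 0) x)" by simp
    then show ?case using convergent_add[OF _ convergent_const[of "u (r 0) x"]] by fastforce
  qed
  define w where "w x = lim (\<lambda>k. u (r k) x)" for x
  have wm [measurable]: "w \<in> borel_measurable m" unfolding w_def by measurable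
  have wlim: "AE x in m. (\<lambda>k. u (r k) x) \<longlonglongrightarrow> w x"
    using conv by eventually_elim (simp add: w_def convergent_LIMSEQ_iff)
  have rk: "k \<le> l \<Longrightarrow> N k \<le> r l" for k l unfolding r_def by (simp add: Max_ge_iff)
  have fatou: "(\<integral>\<^sup>+ x. ennreal ((u i x - w x)\<^sup>2) \<partial>m) \<le> ennreal (1 / 8 ^ k)" if i: "i \<ge> N k" for i k
  proof -
    have "(\<integral>\<^sup>+ x. ennreal ((u i x - w x)\<^sup>2) \<partial>m) = (\<integral>\<^sup>+ x. liminf (\<lambda>l. ennreal ((u i x - u (r l) x)\<^sup>2)) \<partial>m)"
    proof (rule nn_integral_cong_AE)
      show "AE x in m. ennreal ((u i x - w x)\<^sup>2) = liminf (\<lambda>l. ennreal ((u i x - u (r l) x)\<^sup>2))"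
        using wlim
      proof eventually_elim
        case (elim x)
        have "(\<lambda>l. ennreal ((u i x - u (r l) x)\<^sup>2)) \<longlonglongrightarrow> ennreal ((u i x - w x)\<^sup>2)"
          by (intro tendsto_intros elim)
        then show ?case using lim_imp_Liminf[OF trivial_limit_sequentially] by metis
      qed
    qed
    also have "\<dots> \<le> liminf (\<lambda>l. \<integral>\<^sup>+ x. ennreal ((u i x - u (r l) x)\<^sup>2) \<partial>m)"
      by (rule nn_integral_liminf) measurable
    also have "\<dots> \<le> ennreal (1 / 8 ^ k)"
    proof (rule Liminf_le)
      show "\<forall>\<^sub>F l in sequentially. (\<integral>\<^sup>+ x. ennreal ((u i x - u (r l) x)\<^sup>2) \<partial>m) \<le> ennreal (1 / 8 ^ k)"
        unfolding eventually_sequentially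
      proof (intro exI allI impI)
        fix l assume "k \<le> l"
        have "(\<integral>\<^sup>+ x. ennreal ((u i x - u (r l) x)\<^sup>2) \<partial>m) = ennreal (?D i (r l))"
          by (intro nn_integral_eq_integral Dint) auto
        also have "\<dots> \<le> ennreal (1 / 8 ^ k)" using N[OF i rk[OF \<open>k \<le> l\<close>]] by (intro ennreal_leI) simp
        finally show "(\<integral>\<^sup>+ x. ennreal ((u i x - u (r l) x)\<^sup>2) \<partial>m) \<le> ennreal (1 / 8 ^ k)" .
      qed
    qed simp
    finally show ?thesis .
  qed
  have dw: "(\<lambda>x. u i x - w x) \<in> L2 m" if "i \<ge> N 0" for i
  proof -
    have "(\<integral>\<^sup>+ x. ennreal ((u i x - w x)\<^sup>2) \<partial>m) < \<infinity>" using fatou[OF that] by (simp add: le_less_trans)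
    then have "integrable m (\<lambda>x. (u i x - w x)\<^sup>2)" by (intro integrableI_nonneg) auto
    then show ?thesis by (simp add: L2_def)
  qed
  have wL: "w \<in> L2 m" using L2_diff[OF u dw[of "N 0"], of "N 0"] by simp
  have le: "L2_inner m (\<lambda>x. u i x - w x) (\<lambda>x. u i x - w x) \<le> 1 / 8 ^ k" if "i \<ge> N k" for i k
  proof -
    have "ennreal (\<integral>x. (u i x - w x)\<^sup>2 \<partial>m) = (\<integral>\<^sup>+ x. ennreal ((u i x - w x)\<^sup>2) \<partial>m)"
      by (intro nn_integral_eq_integral[symmetric] L2D(2)[OF L2_diff[OF u wL]]) auto
    then have "ennreal (\<integral>x. (u i x - w x)\<^sup>2 \<partial>m) \<le> ennreal (1 / 8 ^ k)" using fatou[OF that] by (simp only:)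
    then show ?thesis unfolding L2_inner_self by (subst (asm) ennreal_le_iff) simp_all
  qed
  have "(\<lambda>n. L2_inner m (\<lambda>x. u n x - w x) (\<lambda>x. u n x - w x)) \<longlonglongrightarrow> 0"
  proof (rule LIMSEQ_I)
    fix \<epsilon> :: real assume e: "\<epsilon> > 0"
    obtain k where k: "(1/8::real) ^ k < \<epsilon>" using real_arch_pow_inv[OF e, of "1/8"] by auto
    have "L2_inner m (\<lambda>x. u n x - w x) (\<lambda>x. u n x - w x) < \<epsilon>" if "n \<ge> N k" for n
      using le[OF that] k by (simp add: power_divide)
    then show "\<exists>no. \<forall>n\<ge>no. norm (L2_inner m (\<lambda>x. u n x - w x) (\<lambda>x. u n x - w x) - 0) < \<epsilon>"
      by (intro exI[of _ "N k"]) (simp add: abs_of_nonneg[OF L2_inner_nonneg])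
  qed
  then show ?thesis using wL by blast
qed

text \<open>Project along \<open>N\<close> onto a complement of \<open>N\<close> in \<open>V\<close>, built from a basis of \<open>N\<close> that is
  extended to \<open>V\<close> and then to the whole space.\<close>
lemma linear_representatives_exist:
  fixes N V :: "'b::real_vector set"
  assumes N: "subspace N" and V: "subspace V" and NV: "N \<subseteq> V"
  shows "\<exists>P. linear P \<and> (\<forall>x. P x \<in> V) \<and> (\<forall>x\<in>V. P x - x \<in> N) \<and> (\<forall>x\<in>N. P x = 0) \<and> (\<forall>x. P (P x) = P x)"
proof -
  obtain A where A: "A \<subseteq> N" "independent A" "N \<subseteq> span A"
    using maximal_independent_subset[of N] by blast
  obtain B where B: "A \<subseteq> B" "B \<subseteq> V" "independent B" "V \<subseteq> span B"
    using maximal_independent_subset_extend[of A V] A NV by blast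
  obtain C where C: "B \<subseteq> C" "independent C" "span C = UNIV"
    using maximal_independent_subset_extend[of B UNIV] B by (metis subset_UNIV top.extremum_uniqueI)
  obtain P where P: "linear P" and PC: "\<And>x. x \<in> C \<Longrightarrow> P x = (if x \<in> B - A then x else 0)"
    using linear_independent_extend[OF C(2), of "\<lambda>x. if x \<in> B - A then x else 0"] by blast
  have PV: "P x \<in> V" for x
  proof -
    have "x \<in> span C" using C by simp
    then show ?thesis
    proof (induction rule: span_induct)
      case base
      show ?case using linear_subspace_vimage[OF P V] by (simp add: vimage_def)
    next
      case (step x)
      then show ?case using PC[of x] B V by (auto simp: subspace_0)
    qed
  qed
  have PN: "P x = 0" if "x \<in> N" for x
  proof -
    have "x \<in> span A" using that A by blast
    moreover have "P y = (\<lambda>_. 0) y" if "y \<in> A" for y using PC[of y] that B C by auto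
    ultimately show ?thesis using linear_eq_on_span[OF P linear_zero, of A x] by simp
  qed
  have PP: "P (P x) = P x" for x
  proof -
    have "(P \<circ> P) x = P x"
    proof (rule linear_eq_on_span[OF linear_compose[OF P P] P, of C])
      show "(P \<circ> P) y = P y" if "y \<in> C" for y
        using that PC[of y] linear_0[OF P] by auto
    qed (use C in simp)
    then show ?thesis by simp
  qed
  have "P x - x \<in> N" if "x \<in> V" for x
  proof -
    have l: "linear (\<lambda>x. P x - x)" by (intro linear_compose_sub P linear_ident)
    have "x \<in> span B" using that B by blast
    then show ?thesis
    proof (induction rule: span_induct)
      case base
      show ?case using linear_subspace_vimage[OF l N] by (simp add: vimage_def)
    next
      case (step x)
      show ?case
      proof (cases "x \<in> A")
        case True
        then show ?thesis using PN[of x] A N by (auto simp: subspace_neg)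
      next
        case False
        then show ?thesis using PC[of x] step C N by (auto simp: subspace_0)
      qed
    qed
  qed
  then show ?thesis using P PV PN PP by blast
qed

definition is_L2_rep :: "'a measure \<Rightarrow> (('a \<Rightarrow> real) \<Rightarrow> 'a \<Rightarrow> real) \<Rightarrow> bool" where
  "is_L2_rep m P \<longleftrightarrow> linear P \<and> (\<forall>x. P x \<in> L2 m) \<and> (\<forall>x\<in>L2 m. AE y in m. P x y = x y) \<and>
     (\<forall>x\<in>L2 m. (AE y in m. x y = 0) \<longrightarrow> P x = 0) \<and> (\<forall>x. P (P x) = P x)"

definition L2_rep :: "'a measure \<Rightarrow> ('a \<Rightarrow> real) \<Rightarrow> 'a \<Rightarrow> real" where
  "L2_rep m = (SOME P. is_L2_rep m P)"

lemma is_L2_rep_L2_rep: "is_L2_rep m (L2_rep m)"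
  unfolding L2_rep_def
proof (rule someI_ex[where P = "is_L2_rep m"])
  let ?N = "{u \<in> L2 m. AE y in m. u y = 0}"
  have "subspace ?N"
    using L2_subspace[of m] unfolding subspace_def by (auto simp: zero_fun_def elim: AE_mp)
  moreover have "?N \<subseteq> L2 m" by blast
  ultimately obtain P where P: "linear P" "\<forall>x. P x \<in> L2 m" "\<forall>x\<in>L2 m. P x - x \<in> ?N" "\<forall>x\<in>?N. P x = 0" "\<forall>x. P (P x) = P x"
    using linear_representatives_exist[OF _ L2_subspace[of m], of ?N] by blast
  then show "\<exists>P. is_L2_rep m P"
    unfolding is_L2_rep_def by (intro exI[of _ P]) auto
qed

lemma L2_rep_in [simp]: "L2_rep m x \<in> L2 m"
  and L2_rep_AE: "x \<in> L2 m \<Longrightarrow> AE y in m. L2_rep m x y = x y"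
  and L2_rep_null: "x \<in> L2 m \<Longrightarrow> AE y in m. x y = 0 \<Longrightarrow> L2_rep m x = 0"
  and L2_rep_idem: "L2_rep m (L2_rep m x) = L2_rep m x"
  using is_L2_rep_L2_rep[of m] unfolding is_L2_rep_def by blast+

text \<open>The detour through representatives makes the inner product total and bilinear on all
  functions.\<close>
definition L2_ip :: "'a measure \<Rightarrow> ('a \<Rightarrow> real) \<Rightarrow> ('a \<Rightarrow> real) \<Rightarrow> real" where
  "L2_ip m u v = L2_inner m (L2_rep m u) (L2_rep m v)"

lemma L2_ip_eq: "u \<in> L2 m \<Longrightarrow> v \<in> L2 m \<Longrightarrow> L2_ip m u v = L2_inner m u v"
  unfolding L2_ip_def using L2_rep_AE[of u m] L2_rep_AE[of v m] L2D(1) L2_rep_in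
  by (intro L2_inner_cong_AE) blast+

lemma hilbert_rep_L2: "hilbert_rep (L2_ip m) (L2_rep m)"
proof (rule hilbert_rep.intro)
  have lin: "linear (L2_rep m)" using is_L2_rep_L2_rep[of m] unfolding is_L2_rep_def by blast
  have add: "L2_rep m (x + y) = (\<lambda>z. L2_rep m x z + L2_rep m y z)" for x y
    by (simp add: linear_add[OF lin] fun_eq_iff)
  have scale: "L2_rep m (r *\<^sub>R x) = (\<lambda>z. r * L2_rep m x z)" for r x
    by (simp add: linear_scale[OF lin] fun_eq_iff)
  have diff: "L2_rep m (x - y) = (\<lambda>z. L2_rep m x z - L2_rep m y z)" for x y
    by (simp add: linear_diff[OF lin] fun_eq_iff)
  show "L2_ip m (x + y) z = L2_ip m x z + L2_ip m y z" for x y z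
    by (simp add: L2_ip_def add L2_inner_add)
  show "L2_ip m (r *\<^sub>R x) z = r * L2_ip m x z" for r x z
    by (simp add: L2_ip_def scale L2_inner_scale)
  show "L2_ip m x y = L2_ip m y x" for x y by (simp add: L2_ip_def L2_inner_commute)
  show "0 \<le> L2_ip m x x" for x by (simp add: L2_ip_def L2_inner_nonneg)
  show "linear (L2_rep m)" by (rule lin)
  show "L2_ip m (L2_rep m x - x) (L2_rep m x - x) = 0" for x
    by (simp add: L2_ip_def diff L2_rep_idem L2_inner_def)
  show "L2_rep m x = 0" if "L2_ip m x x = 0" for x
    using that L2_rep_null[of "L2_rep m x" m] L2_norm_zero_iff[of "L2_rep m x" m] by (simp add: L2_ip_def L2_rep_idem)
  show "\<exists>w. (\<lambda>n. L2_ip m (u n - w) (u n - w)) \<longlonglongrightarrow> 0"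
    if "\<And>\<epsilon>. 0 < \<epsilon> \<Longrightarrow> \<exists>N. \<forall>i\<ge>N. \<forall>j\<ge>N. L2_ip m (u i - u j) (u i - u j) < \<epsilon>" for u :: "nat \<Rightarrow> 'a \<Rightarrow> real"
  proof -
    have "\<exists>w\<in>L2 m. (\<lambda>n. L2_inner m (\<lambda>x. L2_rep m (u n) x - w x) (\<lambda>x. L2_rep m (u n) x - w x)) \<longlonglongrightarrow> 0"
      using that by (intro L2_complete) (auto simp: L2_ip_def diff)
    then obtain w where w: "w \<in> L2 m" "(\<lambda>n. L2_inner m (\<lambda>x. L2_rep m (u n) x - w x) (\<lambda>x. L2_rep m (u n) x - w x)) \<longlonglongrightarrow> 0"
      by blast
    have "L2_ip m (u n - w) (u n - w) = L2_inner m (\<lambda>x. L2_rep m (u n) x - w x) (\<lambda>x. L2_rep m (u n) x - w x)" for n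
    proof -
      have "L2_rep m (u n) - w \<in> L2 m" by (rule subspace_diff[OF L2_subspace L2_rep_in w(1)])
      then have "L2_ip m (L2_rep m (u n) - w) (L2_rep m (u n) - w) = L2_inner m (\<lambda>x. L2_rep m (u n) x - w x) (\<lambda>x. L2_rep m (u n) x - w x)"
        by (simp add: L2_ip_eq fun_diff_def)
      moreover have "L2_rep m (L2_rep m (u n) - w) = L2_rep m (u n - w)"
        by (simp add: diff L2_rep_idem)
      ultimately show ?thesis by (simp add: L2_ip_def)
    qed
    then show ?thesis using w(2) by (intro exI[of _ w]) (simp only:)
  qed
qed

section \<open>Markov operators on \<open>L\<^sup>2\<close>\<close>

lemma fun_plus_eq: "(\<lambda>x. u x + v x) = u + v" for u v :: "'a \<Rightarrow> real" by (simp add: fun_eq_iff)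
lemma fun_minus_eq: "(\<lambda>x. u x - v x) = u - v" for u v :: "'a \<Rightarrow> real" by (simp add: fun_eq_iff)
lemma fun_scale_eq: "(\<lambda>x. c * u x) = c *\<^sub>R u" for u :: "'a \<Rightarrow> real" by (simp add: fun_eq_iff)

context hilbert_rep
begin

lemma defect_form_add:
  assumes S: "contr S" and sym: "\<And>x y. ip (S x) y = ip x (S y)"
  shows "defect_form S (v + w) = defect_form S v + 2 * ip (v - S v) w + defect_form S w"
proof -
  have "ip (S w) v = ip (S v) w" using sym[of w v] ip_sym[of w "S v"] by simp
  then show ?thesis using ip_sym[of w v]
    by (simp add: defect_form_def contr_add[OF S] ip_bilin algebra_simps)
qed

end

locale L2_space = sigma_finite_measure m for m :: "'a measure"
begin

sublocale hilbert_rep "L2_ip m" "L2_rep m" by (rule hilbert_rep_L2)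

lemma rep_L2: "L2_rep m x = x \<Longrightarrow> x \<in> L2 m" using L2_rep_in[of m x] by simp

lemma L2_plus [simp]: "u \<in> L2 m \<Longrightarrow> v \<in> L2 m \<Longrightarrow> u + v \<in> L2 m"
  and L2_minus [simp]: "u \<in> L2 m \<Longrightarrow> v \<in> L2 m \<Longrightarrow> u - v \<in> L2 m"
  and L2_scaleR [simp]: "u \<in> L2 m \<Longrightarrow> c *\<^sub>R u \<in> L2 m"
  and L2_zero_fun [simp]: "0 \<in> L2 m"
  using L2_subspace[of m] by (auto simp: subspace_add subspace_diff subspace_scale subspace_0)

lemma nm_L2: "u \<in> L2 m \<Longrightarrow> nm u = L2_norm m u"
  by (simp add: nm_def L2_norm_def L2_ip_eq)

lemma rep_eq_iff: assumes "u \<in> L2 m" "v \<in> L2 m" shows "L2_rep m u = L2_rep m v \<longleftrightarrow> (AE x in m. u x = v x)"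
proof
  assume "L2_rep m u = L2_rep m v"
  then show "AE x in m. u x = v x"
    using L2_rep_AE[OF assms(1)] L2_rep_AE[OF assms(2)] by auto
next
  assume "AE x in m. u x = v x"
  then have "AE x in m. (u - v) x = 0" by auto
  then have "L2_rep m (u - v) = 0" using assms by (intro L2_rep_null) auto
  then show "L2_rep m u = L2_rep m v" by simp
qed

text \<open>A norm convergent sequence has a subsequence that converges almost everywhere.\<close>
lemma nm_limit_closed:
  assumes u: "\<And>n. u n \<in> L2 m" and w: "w \<in> L2 m" and lim: "(\<lambda>n. nm (u n - w)) \<longlonglongrightarrow> 0"
    and C: "closed C" and uC: "\<And>n. AE x in m. u n x \<in> C"
  shows "AE x in m. w x \<in> C"
proof -
  have "(\<lambda>n. (nm (u n - w))\<^sup>2) \<longlonglongrightarrow> 0\<^sup>2" by (intro tendsto_intros lim)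
  then have "(\<lambda>n. \<integral>x. norm ((u n x - w x)\<^sup>2) \<partial>m) \<longlonglongrightarrow> 0"
    using u w by (simp add: nm_square L2_ip_eq L2_inner_self)
  then obtain r where "AE x in m. (\<lambda>n. (u (r n) x - w x)\<^sup>2) \<longlonglongrightarrow> 0"
    using tendsto_L1_AE_subseq[of m "\<lambda>n x. (u n x - w x)\<^sup>2"] L2D(2)[OF L2_diff[OF u w]] by blast
  moreover have "AE x in m. \<forall>n. u n x \<in> C" using uC by (simp add: AE_all_countable)
  ultimately show ?thesis
  proof eventually_elim
    case (elim x)
    have "(\<lambda>n. sqrt ((u (r n) x - w x)\<^sup>2)) \<longlonglongrightarrow> sqrt 0" by (intro tendsto_intros elim)
    then have "(\<lambda>n. u (r n) x) \<longlonglongrightarrow> w x" by (simp add: tendsto_rabs_zero_iff Lim_null[of _ "w x"])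
    then show ?case using closed_sequentially[OF C] elim(2) by metis
  qed
qed

subsection \<open>Cut-off functions\<close>

lemma is_cutoff_seq_cutoff: "is_cutoff_seq m (cutoff_seq m)"
proof -
  obtain f :: "'a \<Rightarrow> real" where f: "f \<in> borel_measurable m" "\<And>x. 0 < f x" "integrable m f"
    using obtain_positive_integrable_function by metis
  \<comment> \<open>multiples of a strictly positive integrable function, truncated at \<open>1\<close>\<close>
  have "is_cutoff_seq m (\<lambda>k x. min 1 (real (Suc k) * f x))"
    unfolding is_cutoff_seq_def
  proof (intro conjI allI ballI)
    fix k :: nat
    show "integrable m (\<lambda>x. min 1 (real (Suc k) * f x))"
    proof (rule Bochner_Integration.integrable_bound)
      show "integrable m (\<lambda>x. real (Suc k) * f x)" using f by simp
      show "AE x in m. norm (min 1 (real (Suc k) * f x)) \<le> norm (real (Suc k) * f x)"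
        using f(2) by (auto intro!: AE_I2 simp: abs_of_nonneg less_imp_le simp del: of_nat_Suc)
    qed (use f in measurable)
  next
    fix k :: nat and x
    show "0 < min 1 (real (Suc k) * f x)" "min 1 (real (Suc k) * f x) \<le> 1" using f(2)[of x] by auto
    show "min 1 (real (Suc k) * f x) \<le> min 1 (real (Suc (Suc k)) * f x)"
      using f(2)[of x] by (intro min.mono mult_right_mono) auto
  next
    fix x
    obtain N where N: "1 < real N * f x" using f(2)[of x] reals_Archimedean3 by blast
    have "min 1 (real (Suc k) * f x) = 1" if "k \<ge> N" for k
    proof -
      have "real N * f x \<le> real (Suc k) * f x" using that f(2)[of x] by (intro mult_right_mono) auto
      then show ?thesis using N by simp
    qed
    then show "(\<lambda>k. min 1 (real (Suc k) * f x)) \<longlonglongrightarrow> 1"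
      by (intro tendsto_eventually) (auto simp: eventually_sequentially simp del: of_nat_Suc)
  qed
  then show ?thesis unfolding cutoff_seq_def by (rule someI[where P = "is_cutoff_seq m"])
qed

abbreviation phi :: "nat \<Rightarrow> 'a \<Rightarrow> real" where "phi \<equiv> cutoff_seq m"

lemma phi_integrable: "integrable m (phi k)"
  and phi_bounds: "x \<in> space m \<Longrightarrow> 0 < phi k x" "x \<in> space m \<Longrightarrow> phi k x \<le> 1"
  and phi_mono_Suc: "x \<in> space m \<Longrightarrow> phi k x \<le> phi (Suc k) x"
  and phi_tendsto: "x \<in> space m \<Longrightarrow> (\<lambda>k. phi k x) \<longlonglongrightarrow> 1"
  using is_cutoff_seq_cutoff unfolding is_cutoff_seq_def by auto

lemma phi_mono: "x \<in> space m \<Longrightarrow> incseq (\<lambda>k. phi k x)"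
  using phi_mono_Suc by (intro incseq_SucI) auto

lemma phi_measurable [measurable]: "phi k \<in> borel_measurable m"
  using phi_integrable[of k] by auto

lemma phi_L2: "phi k \<in> L2 m"
proof -
  have "integrable m (\<lambda>x. (phi k x)\<^sup>2)"
  proof (rule Bochner_Integration.integrable_bound[OF phi_integrable[of k]])
    show "AE x in m. norm ((phi k x)\<^sup>2) \<le> norm (phi k x)"
    proof (rule AE_I2)
      fix x assume "x \<in> space m"
      then have "0 < phi k x" "phi k x \<le> 1" by (rule phi_bounds)+
      then show "norm ((phi k x)\<^sup>2) \<le> norm (phi k x)" by (simp add: power2_eq_square mult_left_le)
    qed
  qed measurable
  then show ?thesis by (simp add: L2_def)
qed

lemma phi_AE: "AE x in m. 0 \<le> phi k x \<and> phi k x \<le> 1"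
  using phi_bounds by (auto intro!: AE_I2 less_imp_le)

lemma ip_phi_tendsto_integral:
  assumes g: "g \<in> L2 m" and gi: "integrable m g" shows "(\<lambda>k. L2_ip m g (phi k)) \<longlonglongrightarrow> (\<integral>x. g x \<partial>m)"
proof -
  have "(\<lambda>k. \<integral>x. g x * phi k x \<partial>m) \<longlonglongrightarrow> (\<integral>x. g x \<partial>m)"
  proof (rule integral_dominated_convergence[where w = "\<lambda>x. \<bar>g x\<bar>"])
    show "AE x in m. (\<lambda>k. g x * phi k x) \<longlonglongrightarrow> g x"
    proof (rule AE_I2)
      fix x assume "x \<in> space m"
      from tendsto_mult[OF tendsto_const[of "g x"] phi_tendsto[OF this]]
      show "(\<lambda>k. g x * phi k x) \<longlonglongrightarrow> g x" by simp
    qed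
    show "AE x in m. norm (g x * phi k x) \<le> \<bar>g x\<bar>" for k
      using phi_bounds[of _ k] by (auto intro!: AE_I2 mult_left_le simp: abs_mult abs_of_pos)
  qed (use g gi in \<open>auto dest: L2D\<close>)
  then show ?thesis using g by (simp add: L2_ip_eq phi_L2 L2_inner_def)
qed

text \<open>Monotone convergence along the cut-offs: integrability of a nonnegative function is
  read off from inner products, which are all that symmetry of an operator controls.\<close>
lemma integrable_if_phi_bounded:
  assumes g: "g \<in> L2 m" and pos: "AE x in m. 0 \<le> g x" and le: "\<And>k. L2_ip m g (phi k) \<le> c"
  shows "integrable m g \<and> (\<integral>x. g x \<partial>m) \<le> c"
proof -
  let ?I = "\<lambda>k. \<integral>x. g x * phi k x \<partial>m"
  have I: "?I k \<le> c" for k using le[of k] g by (simp add: L2_ip_eq phi_L2 L2_inner_def)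
  have int: "integrable m (\<lambda>x. g x * phi k x)" for k using L2_product_integrable[OF g phi_L2] .
  have mono: "AE x in m. mono (\<lambda>k. g x * phi k x)"
    using pos AE_space
  proof eventually_elim
    case (elim x)
    then show ?case using phi_mono[of x] by (auto simp: mono_def incseq_def intro: mult_left_mono)
  qed
  have inc: "incseq ?I"
  proof (rule incseq_SucI)
    fix k
    show "?I k \<le> ?I (Suc k)"
    proof (intro integral_mono_AE int)
      show "AE x in m. g x * phi k x \<le> g x * phi (Suc k) x"
        using mono
      proof eventually_elim
        case (elim x)
        have "k \<le> Suc k" by simp
        with elim show ?case unfolding mono_def by blast
      qed
    qed
  qed
  obtain l where l: "?I \<longlonglongrightarrow> l"
    by (rule incseq_convergent[OF inc, of c]) (use I in auto)
  have lc: "l \<le> c" by (rule LIMSEQ_le_const2[OF l]) (use I in auto)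
  have lim: "AE x in m. (\<lambda>k. g x * phi k x) \<longlonglongrightarrow> g x"
  proof (rule AE_I2)
    fix x assume "x \<in> space m"
    from tendsto_mult[OF tendsto_const[of "g x"] phi_tendsto[OF this]]
    show "(\<lambda>k. g x * phi k x) \<longlonglongrightarrow> g x" by simp
  qed
  have "integrable m g" "(\<integral>x. g x \<partial>m) = l"
    using integrable_monotone_convergence[OF int mono lim l L2D(1)[OF g]]
      integral_monotone_convergence[OF int mono lim l L2D(1)[OF g]] by auto
  then show ?thesis using lc by simp
qed

definition pos_L12 :: "('a \<Rightarrow> real) \<Rightarrow> bool" where
  "pos_L12 f \<longleftrightarrow> f \<in> L2 m \<and> integrable m f \<and> (AE x in m. 0 \<le> f x)"

lemma pos_L12D: "pos_L12 f \<Longrightarrow> f \<in> L2 m" "pos_L12 f \<Longrightarrow> integrable m f" "pos_L12 f \<Longrightarrow> AE x in m. 0 \<le> f x"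
  by (auto simp: pos_L12_def)

lemma pos_L12_rep: assumes "pos_L12 f" shows "pos_L12 (L2_rep m f)" "(\<integral>x. L2_rep m f x \<partial>m) = (\<integral>x. f x \<partial>m)"
proof -
  note ae = L2_rep_AE[OF pos_L12D(1)[OF assms]]
  have meas: "L2_rep m f \<in> borel_measurable m" by (rule L2D(1)[OF L2_rep_in])
  show "pos_L12 (L2_rep m f)"
    unfolding pos_L12_def using assms ae meas
    by (auto simp: pos_L12_def intro: integrable_cong_AE_imp[of m f] elim: AE_mp)
  show "(\<integral>x. L2_rep m f x \<partial>m) = (\<integral>x. f x \<partial>m)"
    using ae meas pos_L12D(2)[OF assms] by (intro integral_cong_AE) auto
qed

subsection \<open>Symmetric Markov operators\<close>

text \<open>Often called sub-Markovian: mass may be lost.\<close>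
definition markov_op :: "(('a \<Rightarrow> real) \<Rightarrow> 'a \<Rightarrow> real) \<Rightarrow> bool" where
  "markov_op S \<longleftrightarrow> contr S \<and> (\<forall>x. L2_rep m (S x) = S x) \<and> (\<forall>x y. L2_ip m (S x) y = L2_ip m x (S y)) \<and>
     (\<forall>f\<in>L2 m. (AE x in m. 0 \<le> f x \<and> f x \<le> 1) \<longrightarrow> (AE x in m. 0 \<le> S f x \<and> S f x \<le> 1))"

lemma markov_contr: "markov_op S \<Longrightarrow> contr S"
  and markov_rep: "markov_op S \<Longrightarrow> L2_rep m (S x) = S x"
  and markov_sym: "markov_op S \<Longrightarrow> L2_ip m (S x) y = L2_ip m x (S y)"
  and markov_unit: "markov_op S \<Longrightarrow> f \<in> L2 m \<Longrightarrow> AE x in m. 0 \<le> f x \<and> f x \<le> 1 \<Longrightarrow> AE x in m. 0 \<le> S f x \<and> S f x \<le> 1"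
  unfolding markov_op_def by blast+

lemma markov_L2: "markov_op S \<Longrightarrow> S x \<in> L2 m"
  by (rule rep_L2[OF markov_rep])

lemma markov_arg_rep: assumes "markov_op S" shows "S (L2_rep m x) = S x"
proof (rule rep_eqI)
  have "nm (S (L2_rep m x) - S x) \<le> nm (L2_rep m x - x)" by (rule contr_nm_diff[OF markov_contr[OF assms]])
  also have "\<dots> = 0" by simp
  finally show "nm (S (L2_rep m x) - S x) = 0" using nm_nonneg by (simp add: order_antisym)
qed (auto simp: markov_rep[OF assms])

text \<open>Positivity of \<open>S\<close> on unbounded functions comes from truncation and scaling.\<close>
lemma markov_pos:
  assumes S: "markov_op S" and f: "f \<in> L2 m" and pos: "AE x in m. 0 \<le> f x"
  shows "AE x in m. 0 \<le> S f x"
proof -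
  have fm [measurable]: "f \<in> borel_measurable m" using L2D(1)[OF f] .
  define g where "g n x = min (max (f x) 0) (real (Suc n))" for n x
  have gm [measurable]: "g n \<in> borel_measurable m" for n unfolding g_def by measurable
  have gL: "g n \<in> L2 m" for n
    by (rule L2_dominated[OF f]) (auto simp: g_def)
  have "AE x in m. S (g n) x \<in> {0..}" for n
  proof -
    define h where "h = (1 / real (Suc n)) *\<^sub>R g n"
    have hL: "h \<in> L2 m" unfolding h_def by (rule L2_scaleR[OF gL])
    have "AE x in m. 0 \<le> h x \<and> h x \<le> 1" by (intro AE_I2) (auto simp: g_def h_def simp del: of_nat_Suc)
    from markov_unit[OF S hL this] have hpos: "AE x in m. 0 \<le> S h x" by (rule AE_mp) (rule AE_I2, simp)
    have Sg: "S (g n) = real (Suc n) *\<^sub>R S h"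
      unfolding h_def by (subst contr_scale[OF markov_contr[OF S], symmetric]) (simp del: of_nat_Suc)
    show ?thesis unfolding Sg using hpos by eventually_elim (simp del: of_nat_Suc)
  qed
  moreover have "(\<lambda>n. nm (S (g n) - S f)) \<longlonglongrightarrow> 0"
  proof (rule Lim_null_comparison)
    show "\<forall>\<^sub>F n in sequentially. norm (nm (S (g n) - S f)) \<le> nm (g n - f)"
      using contr_nm_diff[OF markov_contr[OF S]] by (auto intro!: always_eventually)
    have "(\<lambda>n. \<integral>x. (g n x - f x)\<^sup>2 \<partial>m) \<longlonglongrightarrow> (\<integral>x. 0 \<partial>m)"
    proof (rule integral_dominated_convergence[where w = "\<lambda>x. (f x)\<^sup>2"])
      show "AE x in m. (\<lambda>n. (g n x - f x)\<^sup>2) \<longlonglongrightarrow> 0"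
        using pos
      proof eventually_elim
        case (elim x)
        obtain N where N: "f x < real N" using reals_Archimedean2 by blast
        have "(g n x - f x)\<^sup>2 = 0" if "n \<ge> N" for n using that N elim by (simp add: g_def)
        then show ?case by (intro tendsto_eventually) (auto simp: eventually_sequentially)
      qed
      show "AE x in m. norm ((g n x - f x)\<^sup>2) \<le> (f x)\<^sup>2" for n
        using pos by eventually_elim (auto simp: g_def abs_le_square_iff[symmetric] simp del: of_nat_Suc)
    qed (use L2D(2)[OF f] in auto)
    then have "(\<lambda>n. sqrt (\<integral>x. (g n x - f x)\<^sup>2 \<partial>m)) \<longlonglongrightarrow> sqrt 0" by (intro tendsto_intros) simp
    then show "(\<lambda>n. nm (g n - f)) \<longlonglongrightarrow> 0"
      using f gL by (simp add: nm_def L2_ip_eq L2_inner_self)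
  qed
  ultimately have "AE x in m. S f x \<in> {0..}"
    by (intro nm_limit_closed[where u = "\<lambda>n. S (g n)" and w = "S f"]) (auto simp: markov_L2[OF S])
  then show ?thesis by simp
qed

lemma markov_mono:
  assumes S: "markov_op S" and fg: "f \<in> L2 m" "g \<in> L2 m" and le: "AE x in m. f x \<le> g x"
  shows "AE x in m. S f x \<le> S g x"
proof -
  have "AE x in m. 0 \<le> S (g - f) x" using fg le by (intro markov_pos[OF S]) auto
  then show ?thesis by (simp add: contr_diff[OF markov_contr[OF S]])
qed

lemma ip_le_integral:
  assumes f: "pos_L12 f" and g: "g \<in> L2 m" and le: "AE x in m. g x \<le> 1"
  shows "L2_ip m f g \<le> (\<integral>x. f x \<partial>m)"
proof -
  have "(\<integral>x. f x * g x \<partial>m) \<le> (\<integral>x. f x \<partial>m)"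
  proof (rule integral_mono_AE)
    show "AE x in m. f x * g x \<le> f x"
      using le pos_L12D(3)[OF f] by eventually_elim (rule mult_left_le)
  qed (use pos_L12D[OF f] L2_product_integrable[OF _ g] in auto)
  then show ?thesis using pos_L12D(1)[OF f] g by (simp add: L2_ip_eq L2_inner_def)
qed

text \<open>\<open>(S f, \<phi>\<^sub>k) = (f, S \<phi>\<^sub>k) \<le> \<integral> f\<close>, as \<open>S \<phi>\<^sub>k \<le> 1\<close>.\<close>
lemma markov_mass:
  assumes S: "markov_op S" and f: "pos_L12 f"
  shows "pos_L12 (S f)" "(\<integral>x. S f x \<partial>m) \<le> (\<integral>x. f x \<partial>m)"
proof -
  have pos: "AE x in m. 0 \<le> S f x" using pos_L12D[OF f] by (intro markov_pos[OF S]) auto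
  have "L2_ip m (S f) (phi k) \<le> (\<integral>x. f x \<partial>m)" for k
    unfolding markov_sym[OF S]
    using markov_unit[OF S phi_L2 phi_AE, of k] by (intro ip_le_integral[OF f] markov_L2[OF S]) auto
  from integrable_if_phi_bounded[OF markov_L2[OF S] pos this]
  show "pos_L12 (S f)" "(\<integral>x. S f x \<partial>m) \<le> (\<integral>x. f x \<partial>m)"
    using pos markov_L2[OF S] by (auto simp: pos_L12_def)
qed

lemma markov_comp: assumes S: "markov_op S" and T: "markov_op T" and c: "\<And>x. S (T x) = T (S x)"
  shows "markov_op (\<lambda>x. S (T x))"
  unfolding markov_op_def
proof (intro conjI allI ballI impI)
  show "contr (\<lambda>x. S (T x))" by (rule contr_comp[OF markov_contr[OF S] markov_contr[OF T]])
  show "L2_rep m (S (T x)) = S (T x)" for x by (rule markov_rep[OF S])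
  show "L2_ip m (S (T x)) y = L2_ip m x (S (T y))" for x y
    by (simp add: markov_sym[OF S] markov_sym[OF T] c)
  show "AE x in m. 0 \<le> S (T f) x \<and> S (T f) x \<le> 1"
    if "f \<in> L2 m" "AE x in m. 0 \<le> f x \<and> f x \<le> 1" for f
    by (rule markov_unit[OF S markov_L2[OF T] markov_unit[OF T that]])
qed

lemma markov_rep_op: "markov_op (L2_rep m)"
  unfolding markov_op_def
proof (intro conjI allI ballI impI)
  show "contr (L2_rep m)" by (rule contrI) auto
  show "AE x in m. 0 \<le> L2_rep m f x \<and> L2_rep m f x \<le> 1"
    if "f \<in> L2 m" "AE x in m. 0 \<le> f x \<and> f x \<le> 1" for f
    using L2_rep_AE[OF that(1)] that(2) by eventually_elim simp
qed auto

lemma markov_limit: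
  assumes E: "\<And>n::nat. markov_op (E n)" and T: "contr T" "\<And>x. L2_rep m (T x) = T x" "\<And>x y. L2_ip m (T x) y = L2_ip m x (T y)"
    and lim: "\<And>x. (\<lambda>n. nm (E n x - T x)) \<longlonglongrightarrow> 0"
  shows "markov_op T"
  unfolding markov_op_def
proof (intro conjI allI ballI impI)
  show "AE x in m. 0 \<le> T f x \<and> T f x \<le> 1"
    if f: "f \<in> L2 m" "AE x in m. 0 \<le> f x \<and> f x \<le> 1" for f
  proof -
    have "AE x in m. T f x \<in> {0..1}"
      using markov_unit[OF E f]
      by (intro nm_limit_closed[OF markov_L2[OF E] rep_L2[OF T(2)] lim]) auto
    then show ?thesis by (rule AE_mp) (rule AE_I2, simp)
  qed
qed (use T in auto)

text \<open>For \<open>v = (u \<or> 0) \<and> 1\<close> and \<open>w = u - v\<close> the cross term \<open>(v - S v, w)\<close> is nonnegative, because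
  \<open>v - S v\<close> has the sign of \<open>w\<close> wherever \<open>w \<noteq> 0\<close>.\<close>
lemma defect_form_unit_contraction:
  assumes S: "markov_op S" and u: "u \<in> L2 m"
  shows "(\<lambda>x. min (max (u x) 0) 1) \<in> L2 m" "defect_form S (\<lambda>x. min (max (u x) 0) 1) \<le> defect_form S u"
proof -
  let ?v = "\<lambda>x. min (max (u x) 0) 1"
  show v: "?v \<in> L2 m" by (rule L2_dominated[OF u]) (use L2D(1)[OF u] in auto)
  let ?w = "u - ?v"
  have w: "?w \<in> L2 m" using u v by simp
  have "AE x in m. 0 \<le> S ?v x \<and> S ?v x \<le> 1" by (rule markov_unit[OF S v]) auto
  then have "AE x in m. 0 \<le> (?v - S ?v) x * ?w x"
  proof eventually_elim
    case (elim x)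
    consider "u x < 0" | "0 \<le> u x" "u x \<le> 1" | "1 < u x" by linarith
    then show ?case
    proof cases
      case 1
      then have "(?v - S ?v) x = - S ?v x" "?w x = u x" by auto
      then show ?thesis using elim 1 by (simp only:) (rule mult_nonpos_nonpos, auto)
    next
      case 3
      then have "(?v - S ?v) x = 1 - S ?v x" "?w x = u x - 1" by auto
      then show ?thesis using elim 3 by (simp only:) (rule mult_nonneg_nonneg, auto)
    qed simp
  qed
  then have "0 \<le> L2_inner m (?v - S ?v) ?w" unfolding L2_inner_def by (rule integral_nonneg_AE)
  then have cross: "0 \<le> L2_ip m (?v - S ?v) ?w" using v w markov_L2[OF S] by (simp add: L2_ip_eq)
  have "u = ?v + ?w" by simp
  then have "defect_form S u = defect_form S (?v + ?w)" by (simp only:)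
  also have "\<dots> = defect_form S ?v + 2 * L2_ip m (?v - S ?v) ?w + defect_form S ?w"
    by (rule defect_form_add[OF markov_contr[OF S] markov_sym[OF S]])
  finally show "defect_form S ?v \<le> defect_form S u"
    using cross defect_form_nonneg[OF markov_contr[OF S], of ?w] by linarith
qed

end

section \<open>Dirichlet forms as forms on a Hilbert space\<close>

locale dirichlet_space = L2_space m for m :: "'a measure" +
  fixes Q :: "'a qform"
  assumes dirichlet: "dirichlet_form m Q"
begin

lemma qf: "quadratic_form m Q" using dirichlet by (simp add: dirichlet_form_def)

lemma qdom_L2: "u \<in> qdom Q \<Longrightarrow> u \<in> L2 m"
  and qdom_zero: "(\<lambda>x. 0) \<in> qdom Q"
  and qdom_plus: "u \<in> qdom Q \<Longrightarrow> v \<in> qdom Q \<Longrightarrow> u + v \<in> qdom Q"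
  and qdom_scale: "u \<in> qdom Q \<Longrightarrow> c *\<^sub>R u \<in> qdom Q"
  and qdom_cong: "u \<in> qdom Q \<Longrightarrow> v \<in> L2 m \<Longrightarrow> AE x in m. u x = v x \<Longrightarrow> v \<in> qdom Q"
  and qval_cong: "u \<in> qdom Q \<Longrightarrow> v \<in> L2 m \<Longrightarrow> AE x in m. u x = v x \<Longrightarrow> qval Q v = qval Q u"
  and qval_scale: "u \<in> qdom Q \<Longrightarrow> qval Q (c *\<^sub>R u) = c\<^sup>2 * qval Q u"
  and qbil_plus: "u \<in> qdom Q \<Longrightarrow> v \<in> qdom Q \<Longrightarrow> w \<in> qdom Q \<Longrightarrow> qbil Q (u + v) w = qbil Q u w + qbil Q v w"
  and qbil_scale: "u \<in> qdom Q \<Longrightarrow> w \<in> qdom Q \<Longrightarrow> qbil Q (c *\<^sub>R u) w = c * qbil Q u w"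
proof -
  note c1 = qf[unfolded quadratic_form_def]
  note c2 = c1[THEN conjunct2] note c3 = c2[THEN conjunct2] note c4 = c3[THEN conjunct2]
  note c5 = c4[THEN conjunct2] note c6 = c5[THEN conjunct2] note c7 = c6[THEN conjunct2]
  note c8 = c7[THEN conjunct2]
  show "u \<in> qdom Q \<Longrightarrow> u \<in> L2 m" using c1[THEN conjunct1] by blast
  show "(\<lambda>x. 0) \<in> qdom Q" by (rule c2[THEN conjunct1])
  show "u \<in> qdom Q \<Longrightarrow> v \<in> qdom Q \<Longrightarrow> u + v \<in> qdom Q" unfolding fun_plus_eq[symmetric] fun_scale_eq[symmetric] using c3[THEN conjunct1] by blast
  show "u \<in> qdom Q \<Longrightarrow> c *\<^sub>R u \<in> qdom Q" unfolding fun_plus_eq[symmetric] fun_scale_eq[symmetric] using c4[THEN conjunct1] by blast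
  show "u \<in> qdom Q \<Longrightarrow> v \<in> L2 m \<Longrightarrow> AE x in m. u x = v x \<Longrightarrow> v \<in> qdom Q"
    "u \<in> qdom Q \<Longrightarrow> v \<in> L2 m \<Longrightarrow> AE x in m. u x = v x \<Longrightarrow> qval Q v = qval Q u"
    using c5[THEN conjunct1] by blast+
  show "u \<in> qdom Q \<Longrightarrow> qval Q (c *\<^sub>R u) = c\<^sup>2 * qval Q u" unfolding fun_plus_eq[symmetric] fun_scale_eq[symmetric] using c6[THEN conjunct1] by blast
  show "u \<in> qdom Q \<Longrightarrow> v \<in> qdom Q \<Longrightarrow> w \<in> qdom Q \<Longrightarrow> qbil Q (u + v) w = qbil Q u w + qbil Q v w"
    unfolding fun_plus_eq[symmetric] fun_scale_eq[symmetric] using c7[THEN conjunct1] by blast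
  show "u \<in> qdom Q \<Longrightarrow> w \<in> qdom Q \<Longrightarrow> qbil Q (c *\<^sub>R u) w = c * qbil Q u w" unfolding fun_plus_eq[symmetric] fun_scale_eq[symmetric] using c8 by blast
qed

lemma qdom_minus: "u \<in> qdom Q \<Longrightarrow> v \<in> qdom Q \<Longrightarrow> u - v \<in> qdom Q"
  using qdom_plus[of u "(-1) *\<^sub>R v"] qdom_scale[of v "-1"] by simp

lemma qval_nonneg: "u \<in> qdom Q \<Longrightarrow> 0 \<le> qval Q u"
  using dirichlet by (simp add: dirichlet_form_def)

lemma qbil_def': "qbil Q u v = (qval Q (u + v) - qval Q (u - v)) / 4"
  by (simp only: qbil_def fun_plus_eq[symmetric] fun_minus_eq[symmetric])

lemma qbil_commute: assumes "u \<in> qdom Q" "v \<in> qdom Q" shows "qbil Q u v = qbil Q v u"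
proof -
  have "qval Q (u - v) = qval Q (v - u)"
    using qval_scale[of "v - u" "-1"] qdom_minus[of v u] assms by simp
  then show ?thesis by (simp add: qbil_def' add.commute)
qed

lemma qbil_self: assumes "u \<in> qdom Q" shows "qbil Q u u = qval Q u"
proof -
  have "qval Q (0 *\<^sub>R u) = 0" using qval_scale[OF assms, of 0] by simp
  moreover have "qval Q (2 *\<^sub>R u) = 4 * qval Q u" using qval_scale[OF assms, of 2] by simp
  moreover have "u + u = 2 *\<^sub>R u" by (simp add: fun_eq_iff)
  ultimately show ?thesis unfolding qbil_def' by simp
qed

lemma qbil_cong:
  assumes "u \<in> qdom Q" "v \<in> qdom Q" "u' \<in> L2 m" "v' \<in> L2 m" "AE x in m. u x = u' x" "AE x in m. v x = v' x"
  shows "qbil Q u' v' = qbil Q u v"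
proof -
  have "qval Q (u' + v') = qval Q (u + v)"
    by (rule qval_cong) (use assms in \<open>auto simp: qdom_plus intro: L2_plus\<close>)
  moreover have "qval Q (u' - v') = qval Q (u - v)"
    by (rule qval_cong) (use assms in \<open>auto simp: qdom_minus intro: L2_minus\<close>)
  ultimately show ?thesis by (simp add: qbil_def')
qed

lemma AE_rep: assumes "u \<in> L2 m" shows "AE x in m. u x = L2_rep m u x"
  using L2_rep_AE[OF assms] by eventually_elim simp

lemma rep_qdom: "u \<in> qdom Q \<Longrightarrow> L2_rep m u \<in> qdom Q"
  by (rule qdom_cong[OF _ L2_rep_in AE_rep[OF qdom_L2]])

lemma qval_rep: "u \<in> qdom Q \<Longrightarrow> qval Q (L2_rep m u) = qval Q u"
  by (rule qval_cong[OF _ L2_rep_in AE_rep[OF qdom_L2]])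

definition rdom :: "('a \<Rightarrow> real) set" where "rdom = {u \<in> qdom Q. L2_rep m u = u}"

lemma rdomD: "u \<in> rdom \<Longrightarrow> u \<in> qdom Q" "u \<in> rdom \<Longrightarrow> L2_rep m u = u"
  by (auto simp: rdom_def)

lemma rep_in_rdom: "u \<in> qdom Q \<Longrightarrow> L2_rep m u \<in> rdom"
  by (simp add: rdom_def rep_qdom)

lemma rep_in_rdom_iff: "u \<in> L2 m \<Longrightarrow> L2_rep m u \<in> rdom \<longleftrightarrow> u \<in> qdom Q"
  using rep_in_rdom[of u] qdom_cong[OF rdomD(1) _ L2_rep_AE, of u] by blast

sublocale form_space "L2_ip m" "L2_rep m" rdom "qbil Q"
proof
  show "subspace rdom"
    unfolding subspace_def using qdom_zero by (auto simp: rdom_def qdom_plus qdom_scale zero_fun_def[symmetric])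
  show "L2_rep m x = x" if "x \<in> rdom" for x using that by (rule rdomD)
  show "qbil Q (x + y) z = qbil Q x z + qbil Q y z" if "x \<in> rdom" "y \<in> rdom" "z \<in> rdom" for x y z
    using that by (intro qbil_plus rdomD)
  show "qbil Q (r *\<^sub>R x) z = r * qbil Q x z" if "x \<in> rdom" "z \<in> rdom" for r x z
    using that by (intro qbil_scale rdomD)
  show "qbil Q x y = qbil Q y x" if "x \<in> rdom" "y \<in> rdom" for x y
    using that by (intro qbil_commute rdomD)
  show "0 \<le> qbil Q x x" if "x \<in> rdom" for x
    using rdomD(1)[OF that] by (simp add: qbil_self qval_nonneg)
  show "\<exists>u\<in>rdom. nm (x - u) < \<epsilon>" if e: "0 < \<epsilon>" for x \<epsilon>
  proof -
    have "densely_defined m Q" using dirichlet by (simp add: dirichlet_form_def)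
    then obtain u where u: "u \<in> qdom Q" "L2_norm m (\<lambda>y. L2_rep m x y - u y) < \<epsilon>"
      unfolding densely_defined_def using e L2_rep_in by metis
    have "nm (x - L2_rep m u) = nm (L2_rep m x - u)" by simp
    also have "\<dots> = L2_norm m (\<lambda>y. L2_rep m x y - u y)"
      using qdom_L2[OF u(1)] by (subst nm_L2) (auto simp: fun_minus_eq[of "L2_rep m x" u])
    finally show ?thesis using u rep_in_rdom by (intro bexI[of _ "L2_rep m u"]) auto
  qed
  fix u :: "nat \<Rightarrow> 'a \<Rightarrow> real"
  assume u: "\<And>n. u n \<in> rdom"
    and cau: "\<And>\<epsilon>. 0 < \<epsilon> \<Longrightarrow> \<exists>N. \<forall>i\<ge>N. \<forall>j\<ge>N. qbil Q (u i - u j) (u i - u j) + L2_ip m (u i - u j) (u i - u j) < \<epsilon>"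
  have fns: "form_norm_sq m Q (\<lambda>x. v x - w x) = qbil Q (v - w) (v - w) + L2_ip m (v - w) (v - w)"
    if "v \<in> qdom Q" "w \<in> qdom Q" for v w
    using that by (simp add: form_norm_sq_def fun_minus_eq[of v w] qbil_self qdom_minus L2_norm_square L2_ip_eq qdom_L2)
  have "closed_form m Q" using dirichlet by (simp add: dirichlet_form_def)
  then have "\<exists>w\<in>qdom Q. (\<lambda>n. form_norm_sq m Q (\<lambda>x. u n x - w x)) \<longlonglongrightarrow> 0"
    unfolding closed_form_def using rdomD(1)[OF u] cau by (simp add: fns)
  then obtain w where w: "w \<in> qdom Q" "(\<lambda>n. form_norm_sq m Q (\<lambda>x. u n x - w x)) \<longlonglongrightarrow> 0" by blast
  have "form_norm_sq m Q (\<lambda>x. u n x - w x) =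
      qbil Q (u n - L2_rep m w) (u n - L2_rep m w) + L2_ip m (u n - L2_rep m w) (u n - L2_rep m w)" for n
  proof -
    have d: "u n - w \<in> qdom Q" using rdomD(1)[OF u] w by (simp add: qdom_minus)
    have "L2_rep m (u n - w) = u n - L2_rep m w" using rdomD(2)[OF u] by simp
    moreover have "qbil Q (L2_rep m (u n - w)) (L2_rep m (u n - w)) = qbil Q (u n - w) (u n - w)"
      using qval_rep[OF d] by (simp only: qbil_self[OF d] qbil_self[OF rep_qdom[OF d]])
    moreover have "L2_ip m (L2_rep m (u n - w)) (L2_rep m (u n - w)) = L2_ip m (u n - w) (u n - w)" by (simp only: ip_P ip_P_right)
    ultimately show ?thesis using fns[OF rdomD(1)[OF u] w(1)] by simp
  qed
  then show "\<exists>w\<in>rdom. (\<lambda>n. qbil Q (u n - w) (u n - w) + L2_ip m (u n - w) (u n - w)) \<longlonglongrightarrow> 0"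
    using w rep_in_rdom[OF w(1)] by (intro bexI[of _ "L2_rep m w"]) auto
qed

lemma form_op_iff_gen:
  assumes u: "u \<in> L2 m" and f: "f \<in> L2 m"
  shows "form_op m Q u f \<longleftrightarrow> gen (L2_rep m u) (L2_rep m f)"
proof
  assume a: "form_op m Q u f"
  then have uD: "u \<in> qdom Q" by (simp add: form_op_def)
  show "gen (L2_rep m u) (L2_rep m f)"
    unfolding gen_def
  proof (intro conjI ballI)
    fix v assume v: "v \<in> rdom"
    have "qbil Q (L2_rep m u) v = qbil Q u v"
      by (rule qbil_cong[OF uD rdomD(1)[OF v] L2_rep_in qdom_L2[OF rdomD(1)[OF v]] AE_rep[OF u] AE_I2[OF refl]])
    then show "qbil Q (L2_rep m u) v = L2_ip m (L2_rep m f) v"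
      using a v f by (simp add: form_op_def rdomD L2_ip_eq qdom_L2)
  qed (auto simp: rep_in_rdom[OF uD])
next
  assume g: "gen (L2_rep m u) (L2_rep m f)"
  then have uD: "u \<in> qdom Q" using rep_in_rdom_iff[OF u] gen_dom by blast
  show "form_op m Q u f"
    unfolding form_op_def
  proof (intro conjI ballI uD f)
    fix v assume v: "v \<in> qdom Q"
    have "qbil Q (L2_rep m u) (L2_rep m v) = qbil Q u v"
      by (rule qbil_cong[OF uD v L2_rep_in L2_rep_in AE_rep[OF u] AE_rep[OF qdom_L2[OF v]]])
    moreover have "qbil Q (L2_rep m u) (L2_rep m v) = L2_ip m (L2_rep m f) (L2_rep m v)"
      by (rule gen_b[OF g rep_in_rdom[OF v]])
    ultimately show "qbil Q u v = L2_inner m f v" using f qdom_L2[OF v] by (simp add: L2_ip_eq)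
  qed
qed

text \<open>\<open>(L + \<beta>)\<^sup>-\<^sup>1 = \<beta>\<^sup>-\<^sup>1 J\<^sub>1\<^sub>/\<^sub>\<beta>\<close>; the choice in the definition is unique up to null sets.\<close>
lemma form_resolvent_eq:
  assumes beta: "0 < \<beta>" and f: "f \<in> L2 m"
  shows "form_resolvent m Q \<beta> f \<in> L2 m" "L2_rep m (form_resolvent m Q \<beta> f) = (1 / \<beta>) *\<^sub>R J (1 / \<beta>) f"
proof -
  let ?R = "\<lambda>u. \<exists>g. form_op m Q u g \<and> (AE x in m. g x + \<beta> * u x = f x)"
  have h: "0 < 1 / \<beta>" using beta by simp
  have "?R (form_resolvent m Q \<beta> f)"
    unfolding form_resolvent_def
  proof (rule someI_ex[where P = ?R])
    let ?u = "(1 / \<beta>) *\<^sub>R J (1 / \<beta>) f" and ?g = "L2_rep m f - J (1 / \<beta>) f"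
    have "gen ?u ((1 / \<beta>) *\<^sub>R ((1 / (1 / \<beta>)) *\<^sub>R ?g))" by (rule gen_scale[OF gen_J[OF h]])
    then have g: "gen ?u ?g" using beta by simp
    have "form_op m Q ?u ?g"
      using form_op_iff_gen[OF rep_L2[OF gen_P[OF g]] rep_L2[OF gen_P'[OF g]]] g
      by (simp only: gen_P[OF g] gen_P'[OF g])
    moreover have "AE x in m. ?g x + \<beta> * ?u x = f x"
      using L2_rep_AE[OF f] beta by (auto elim: AE_mp)
    ultimately show "\<exists>u. ?R u" by blast
  qed
  then obtain g where g: "form_op m Q (form_resolvent m Q \<beta> f) g"
      and ae: "AE x in m. g x + \<beta> * form_resolvent m Q \<beta> f x = f x" by blast
  let ?u = "form_resolvent m Q \<beta> f"
  show u: "?u \<in> L2 m" using g qdom_L2 by (auto simp: form_op_def)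
  have gL: "g \<in> L2 m" using g by (simp add: form_op_def)
  have "gen (L2_rep m ?u) (L2_rep m g)" using g u gL by (simp add: form_op_iff_gen)
  from J_gen_eq[OF h this] have J: "J (1 / \<beta>) (L2_rep m (?u + (1 / \<beta>) *\<^sub>R g)) = L2_rep m ?u"
    by simp
  have "L2_rep m (g + \<beta> *\<^sub>R ?u) = L2_rep m f" using ae u gL f by (subst rep_eq_iff) auto
  then have "L2_rep m (?u + (1 / \<beta>) *\<^sub>R g) = (1 / \<beta>) *\<^sub>R L2_rep m f"
  proof -
    have "?u + (1 / \<beta>) *\<^sub>R g = (1 / \<beta>) *\<^sub>R (g + \<beta> *\<^sub>R ?u)" using beta by (simp add: scaleR_add_right add.commute)
    then show ?thesis using \<open>L2_rep m (g + \<beta> *\<^sub>R ?u) = L2_rep m f\<close> by (simp only: P_scale)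
  qed
  with J show "L2_rep m ?u = (1 / \<beta>) *\<^sub>R J (1 / \<beta>) f" using h by (simp add: J_scale)
qed

lemma quotient_norm:
  assumes "u \<in> L2 m" "f \<in> L2 m" "w \<in> L2 m"
  shows "L2_norm m (\<lambda>x. (u x - w x) / h - f x) = nm ((1 / h) *\<^sub>R (u - w) - f)"
proof -
  have "(\<lambda>x. (u x - w x) / h - f x) = (1 / h) *\<^sub>R (u - w) - f" by (simp add: fun_eq_iff)
  then show ?thesis using assms by (simp add: nm_L2)
qed

text \<open>Semigroups on representatives are semigroups on \<open>L\<^sup>2\<close>, so the semigroup of the form
  exists and the choice of it is not vacuous.\<close>
lemma sgroup_is_form_semigroup: assumes S: "sgroup S" shows "is_form_semigroup m Q S"
proof -
  interpret S: semigroup_space "L2_ip m" "L2_rep m" rdom "qbil Q" S by standard (rule S)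
  have SL: "0 \<le> t \<Longrightarrow> S t f \<in> L2 m" for t f using rep_L2[OF S.T_P] .
  have "contraction_semigroup m S"
    unfolding contraction_semigroup_def
  proof (intro conjI allI impI ballI)
    fix t :: real and f assume t: "0 \<le> t" and f: "f \<in> L2 m"
    show "S t f \<in> L2 m" using SL[OF t] .
    show "L2_norm m (S t f) \<le> L2_norm m f"
      using contr_nm[OF S.T_contr[OF t], of f] f SL[OF t] by (simp add: nm_L2)
  next
    fix t :: real and f g assume t: "0 \<le> t"
    show "AE x in m. S t (\<lambda>y. f y + g y) x = S t f x + S t g x"
      using fun_plus_eq[of f g] by (simp add: contr_add[OF S.T_contr[OF t]])
  next
    fix t c :: real and f assume t: "0 \<le> t"
    show "AE x in m. S t (\<lambda>y. c * f y) x = c * S t f x"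
      using fun_scale_eq[of c f] by (simp add: contr_scale[OF S.T_contr[OF t]])
  next
    fix f assume "f \<in> L2 m"
    then show "AE x in m. S 0 f x = f x" using L2_rep_AE by simp
  next
    fix s t :: real and f assume "0 \<le> s" "0 \<le> t"
    then show "AE x in m. S (s + t) f x = S s (S t f) x" by (simp add: S.T_plus)
  next
    fix f assume f: "f \<in> L2 m"
    have "\<forall>\<^sub>F t in at_right 0. nm (S t f - f) = L2_norm m (\<lambda>x. S t f x - f x)"
      using eventually_at_right_less[of 0]
      by eventually_elim (simp add: nm_L2 SL f fun_minus_eq[of "S _ f" f])
    then show "((\<lambda>t. L2_norm m (\<lambda>x. S t f x - f x)) \<longlongrightarrow> 0) (at_right 0)"
      using S.T_cont[of f] by (rule Lim_transform_eventually[rotated])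
  qed
  moreover have "form_op m Q u f \<longleftrightarrow> ((\<lambda>h. L2_norm m (\<lambda>x. (u x - S h u x) / h - f x)) \<longlongrightarrow> 0) (at_right 0)"
    if u: "u \<in> L2 m" and f: "f \<in> L2 m" for u f
  proof -
    have "form_op m Q u f \<longleftrightarrow>
        ((\<lambda>h. nm ((1 / h) *\<^sub>R (L2_rep m u - S h (L2_rep m u)) - L2_rep m f)) \<longlongrightarrow> 0) (at_right 0)"
      unfolding form_op_iff_gen[OF u f] by (rule S.T_gen_iff) auto
    also have "\<dots> \<longleftrightarrow> ((\<lambda>h. L2_norm m (\<lambda>x. (u x - S h u x) / h - f x)) \<longlongrightarrow> 0) (at_right 0)"
    proof (rule tendsto_cong)
      show "\<forall>\<^sub>F h in at_right 0. nm ((1 / h) *\<^sub>R (L2_rep m u - S h (L2_rep m u)) - L2_rep m f) =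
          L2_norm m (\<lambda>x. (u x - S h u x) / h - f x)"
        using eventually_at_right_less[of 0]
      proof eventually_elim
        case (elim h)
        then have h: "0 \<le> h" by simp
        have "(1 / h) *\<^sub>R (L2_rep m u - S h (L2_rep m u)) - L2_rep m f = L2_rep m ((1 / h) *\<^sub>R (u - S h u) - f)"
          using h by simp
        then show ?case using quotient_norm[OF u f SL[OF h], of u h] by (simp only: nm_P)
      qed
    qed
    finally show ?thesis .
  qed
  ultimately show ?thesis unfolding is_form_semigroup_def by blast
qed

lemma is_form_semigroup_form_semigroup: "is_form_semigroup m Q (form_semigroup m Q)"
  unfolding form_semigroup_def
  using sgroup_exists sgroup_is_form_semigroup by (intro someI_ex[where P = "is_form_semigroup m Q"]) blast

abbreviation U :: "real \<Rightarrow> ('a \<Rightarrow> real) \<Rightarrow> 'a \<Rightarrow> real" where "U \<equiv> form_semigroup m Q"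

lemma U_cs: "contraction_semigroup m U"
  using is_form_semigroup_form_semigroup by (simp add: is_form_semigroup_def)

lemma U_L2: "0 \<le> t \<Longrightarrow> f \<in> L2 m \<Longrightarrow> U t f \<in> L2 m"
  and U_norm: "0 \<le> t \<Longrightarrow> f \<in> L2 m \<Longrightarrow> L2_norm m (U t f) \<le> L2_norm m f"
  and U_plus: "0 \<le> t \<Longrightarrow> f \<in> L2 m \<Longrightarrow> g \<in> L2 m \<Longrightarrow> AE x in m. U t (f + g) x = U t f x + U t g x"
  and U_scale: "0 \<le> t \<Longrightarrow> f \<in> L2 m \<Longrightarrow> AE x in m. U t (c *\<^sub>R f) x = c * U t f x"
  and U_zero: "f \<in> L2 m \<Longrightarrow> AE x in m. U 0 f x = f x"
  and U_time: "0 \<le> s \<Longrightarrow> 0 \<le> t \<Longrightarrow> f \<in> L2 m \<Longrightarrow> AE x in m. U (s + t) f x = U s (U t f) x"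
  and U_cont: "f \<in> L2 m \<Longrightarrow> ((\<lambda>t. L2_norm m (\<lambda>x. U t f x - f x)) \<longlongrightarrow> 0) (at_right 0)"
  using U_cs unfolding contraction_semigroup_def fun_plus_eq[symmetric] fun_scale_eq[symmetric] by blast+

lemma U_gen: "u \<in> L2 m \<Longrightarrow> f \<in> L2 m \<Longrightarrow> form_op m Q u f \<longleftrightarrow>
        ((\<lambda>h. L2_norm m (\<lambda>x. (u x - U h u x) / h - f x)) \<longlongrightarrow> 0) (at_right 0)"
  using is_form_semigroup_form_semigroup by (simp add: is_form_semigroup_def)

lemma U_cong:
  assumes t: "0 \<le> t" and f: "f \<in> L2 m" and g: "g \<in> L2 m" and fg: "AE x in m. f x = g x"
  shows "AE x in m. U t f x = U t g x"
proof -
  let ?d = "f - g"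
  have d: "?d \<in> L2 m" using f g by simp
  have "AE x in m. ?d x = 0" using fg by eventually_elim simp
  then have "L2_norm m ?d = 0" using L2_norm_zero_iff[OF d] by (simp add: L2_norm_def)
  then have "L2_norm m (U t ?d) \<le> 0" using U_norm[OF t d] by simp
  then have "L2_inner m (U t ?d) (U t ?d) = 0" using L2_inner_nonneg[of m "U t ?d"] by (simp add: L2_norm_def)
  then have "AE x in m. U t ?d x = 0" using L2_norm_zero_iff[OF U_L2[OF t d]] by simp
  moreover have "AE x in m. U t (?d + g) x = U t ?d x + U t g x" by (rule U_plus[OF t d g])
  ultimately show ?thesis by eventually_elim simp
qed

text \<open>The semigroup of the form is determined up to null sets only; on representatives its
  laws become equations.\<close>
definition T :: "real \<Rightarrow> ('a \<Rightarrow> real) \<Rightarrow> 'a \<Rightarrow> real" where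
  "T t f = L2_rep m (U t (L2_rep m f))"

lemma T_rep_U: assumes "0 \<le> t" "f \<in> L2 m" shows "T t f = L2_rep m (U t f)"
proof -
  have "AE x in m. U t (L2_rep m f) x = U t f x"
    by (rule U_cong[OF assms(1) L2_rep_in assms(2) L2_rep_AE[OF assms(2)]])
  then show ?thesis
    unfolding T_def using rep_eq_iff[OF U_L2[OF assms(1) L2_rep_in] U_L2[OF assms]] by blast
qed

lemma T_AE_U: "0 \<le> t \<Longrightarrow> f \<in> L2 m \<Longrightarrow> AE x in m. U t f x = T t f x"
  using L2_rep_AE[OF U_L2, of t f] by (simp add: T_rep_U) (auto elim: AE_mp)

lemma sgroup_T: "sgroup T"
proof -
  have UL: "U t (L2_rep m f) \<in> L2 m" if "0 \<le> t" for t f using U_L2[OF that] by simp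
  have c: "contr (T t)" if t: "0 \<le> t" for t
  proof (rule contrI)
    show "T t (x + y) = T t x + T t y" for x y
    proof -
      have "L2_rep m (U t (L2_rep m (x + y))) = L2_rep m (U t (L2_rep m x) + U t (L2_rep m y))"
        using U_plus[OF t, of "L2_rep m x" "L2_rep m y"] UL[OF t] UL[OF t, of "x + y"] by (subst rep_eq_iff) auto
      then show ?thesis unfolding T_def by simp
    qed
    show "T t (r *\<^sub>R x) = r *\<^sub>R T t x" for r x
    proof -
      have "L2_rep m (U t (L2_rep m (r *\<^sub>R x))) = L2_rep m (r *\<^sub>R U t (L2_rep m x))"
        using U_scale[OF t, of "L2_rep m x" r] UL[OF t] UL[OF t, of "r *\<^sub>R x"] by (subst rep_eq_iff) auto
      then show ?thesis unfolding T_def by simp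
    qed
    show "nm (T t x) \<le> nm x" for x
      using U_norm[OF t L2_rep_in, of x] nm_L2[OF UL[OF t, of x]] nm_L2[OF L2_rep_in[of m x]] unfolding T_def nm_P
      by (simp only:)
  qed
  have tm: "T (s + t) x = T s (T t x)" if "0 \<le> s" "0 \<le> t" for s t x
  proof -
    have "T s (T t x) = L2_rep m (U s (T t x))" using that by (intro T_rep_U) (auto simp: T_def)
    also have "\<dots> = L2_rep m (U s (U t (L2_rep m x)))"
      using U_cong[OF that(1) _ UL[OF that(2)] L2_rep_AE[OF UL[OF that(2)]], of x] U_L2[OF that(1)] UL[OF that(2)]
      unfolding T_def by (subst rep_eq_iff) auto
    also have "\<dots> = L2_rep m (U (s + t) (L2_rep m x))"
      using U_time[OF that, of "L2_rep m x"] U_L2[OF that(1)] UL[OF that(2)] UL[of "s + t" x] that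
      by (subst rep_eq_iff) (auto elim: AE_mp)
    finally show ?thesis by (simp add: T_def)
  qed
  have ct: "((\<lambda>t. nm (T t x - x)) \<longlongrightarrow> 0) (at_right 0)" for x
  proof -
    have "\<forall>\<^sub>F t in at_right 0. L2_norm m (\<lambda>y. U t (L2_rep m x) y - L2_rep m x y) = nm (T t x - x)"
      using eventually_at_right_less[of 0]
    proof eventually_elim
      case (elim t)
      have "nm (T t x - x) = nm (U t (L2_rep m x) - L2_rep m x)" unfolding T_def by simp
      also have "\<dots> = L2_norm m (\<lambda>y. U t (L2_rep m x) y - L2_rep m x y)"
        unfolding fun_minus_eq[of "U t (L2_rep m x)" "L2_rep m x"] using elim by (intro nm_L2) (simp add: UL)
      finally show ?case by simp
    qed
    then show ?thesis using U_cont[of "L2_rep m x"] by (rule Lim_transform_eventually[rotated]) simp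
  qed
  have gn: "gen x f \<longleftrightarrow> ((\<lambda>h. nm ((1 / h) *\<^sub>R (x - T h x) - f)) \<longlongrightarrow> 0) (at_right 0)"
    if x: "L2_rep m x = x" and f: "L2_rep m f = f" for x f
  proof -
    note xL = rep_L2[OF x] and fL = rep_L2[OF f]
    have "gen x f \<longleftrightarrow> ((\<lambda>h. L2_norm m (\<lambda>y. (x y - U h x y) / h - f y)) \<longlongrightarrow> 0) (at_right 0)"
      using form_op_iff_gen[OF xL fL] U_gen[OF xL fL] x f by simp
    also have "\<dots> \<longleftrightarrow> ((\<lambda>h. nm ((1 / h) *\<^sub>R (x - T h x) - f)) \<longlongrightarrow> 0) (at_right 0)"
    proof (rule tendsto_cong)
      show "\<forall>\<^sub>F h in at_right 0. L2_norm m (\<lambda>y. (x y - U h x y) / h - f y) = nm ((1 / h) *\<^sub>R (x - T h x) - f)"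
        using eventually_at_right_less[of 0]
      proof eventually_elim
        case (elim h)
        then have h: "0 \<le> h" by simp
        have "(1 / h) *\<^sub>R (x - T h x) - f = L2_rep m ((1 / h) *\<^sub>R (x - U h x) - f)"
          using T_rep_U[OF h xL] x f by simp
        then show ?case using quotient_norm[OF xL fL U_L2[OF h xL]] by (simp only: nm_P)
      qed
    qed
    finally show ?thesis .
  qed
  have "T 0 x = L2_rep m x" for x
    using U_zero[OF L2_rep_in, of x] rep_eq_iff[OF UL[of 0 x] L2_rep_in[of m x]] unfolding T_def by simp
  then show ?thesis unfolding sgroup_def using c tm ct gn by (auto simp: T_def)
qed

sublocale semigroup_space "L2_ip m" "L2_rep m" rdom "qbil Q" T
  by standard (rule sgroup_T)

subsection \<open>Markov property\<close>

text \<open>The unit contraction of the minimiser \<open>J h f\<close> has no larger energy and is no farther from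
  \<open>f\<close> when \<open>0 \<le> f \<le> 1\<close>; uniqueness of the minimiser does the rest.\<close>
lemma markov_J: assumes h: "0 < h" shows "markov_op (J h)"
  unfolding markov_op_def
proof (intro conjI allI ballI impI)
  show "contr (J h)" by (rule contr_J[OF h])
  show "L2_rep m (J h x) = J h x" for x using h by simp
  show "L2_ip m (J h x) y = L2_ip m x (J h y)" for x y by (rule J_sym[OF h])
  show "AE x in m. 0 \<le> J h f x \<and> J h f x \<le> 1"
    if f: "f \<in> L2 m" and fb: "AE x in m. 0 \<le> f x \<and> f x \<le> 1" for f
  proof -
    let ?v = "J h f" and ?w = "\<lambda>x. min (max (J h f x) 0) 1"
    have vD: "?v \<in> qdom Q" using J_in[OF h] by (rule rdomD)
    have w: "?w \<in> qdom Q" "qval Q ?w \<le> qval Q ?v" using dirichlet vD by (auto simp: dirichlet_form_def)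
    have vL: "?v \<in> L2 m" and wL: "?w \<in> L2 m" using vD w qdom_L2 by auto
    let ?r = "L2_rep m ?w"
    have r: "?r \<in> rdom" by (rule rep_in_rdom[OF w(1)])
    have "qbil Q ?r ?r \<le> qbil Q ?v ?v"
      using w(2) qval_rep[OF w(1)] by (simp only: qbil_self[OF vD] qbil_self[OF rep_qdom[OF w(1)]])
    moreover have "L2_ip m (f - ?r) (f - ?r) \<le> L2_ip m (f - ?v) (f - ?v)"
    proof -
      have "L2_ip m (f - ?r) (f - ?r) = L2_ip m (f - ?w) (f - ?w)" by (simp add: ip_bilin)
      also have "\<dots> = (\<integral>x. (f x - ?w x)\<^sup>2 \<partial>m)" using f wL by (simp add: L2_ip_eq L2_inner_self)
      also have "\<dots> \<le> (\<integral>x. (f x - ?v x)\<^sup>2 \<partial>m)"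
      proof (rule integral_mono_AE)
        show "AE x in m. (f x - ?w x)\<^sup>2 \<le> (f x - ?v x)\<^sup>2"
          using fb by eventually_elim (auto simp: abs_le_square_iff[symmetric] min_def max_def)
      qed (use L2D(2)[OF L2_diff[OF f vL]] L2D(2)[OF L2_diff[OF f wL]] in auto)
      also have "\<dots> = L2_ip m (f - ?v) (f - ?v)" using f vL by (simp add: L2_ip_eq L2_inner_self)
      finally show ?thesis .
    qed
    ultimately have "h * qbil Q ?r ?r + L2_ip m (f - ?r) (f - ?r) \<le> h * qbil Q ?v ?v + L2_ip m (f - ?v) (f - ?v)"
      using h by (intro add_mono mult_left_mono) auto
    then have "h * qbil Q (?r - ?v) (?r - ?v) + L2_ip m (?r - ?v) (?r - ?v) \<le> 0"
      using J_minimizes[OF h r, of f] by linarith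
    moreover have "0 \<le> h * qbil Q (?r - ?v) (?r - ?v)" using h r J_in[OF h] by (intro mult_nonneg_nonneg dom.c_nonneg) auto
    ultimately have "L2_ip m (?r - ?v) (?r - ?v) = 0" using ip_nonneg[of "?r - ?v"] by linarith
    then have "L2_rep m ?w = L2_rep m ?v" using P_eqI[of ?r ?v] by (simp add: nm_def)
    then have "AE x in m. ?w x = ?v x" using rep_eq_iff[OF wL vL] by simp
    then show ?thesis
    proof eventually_elim
      case (elim x)
      have "0 \<le> ?w x" "?w x \<le> 1" by auto
      then show ?case using elim by simp
    qed
  qed
qed

lemma markov_J_funpow: assumes h: "0 < h" shows "markov_op (\<lambda>x. (J h ^^ Suc n) x)"
proof (induction n)
  case 0 then show ?case using markov_J[OF h] by simp
next
  case (Suc n)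
  have "markov_op (\<lambda>x. J h ((J h ^^ Suc n) x))"
    by (rule markov_comp[OF markov_J[OF h] Suc]) (simp add: funpow_swap1)
  then show ?case by simp
qed

text \<open>Euler's formula exhibits \<open>T\<^sub>t\<close> as a limit of products of Markov operators.\<close>
lemma markov_T: assumes t: "0 \<le> t" shows "markov_op (T t)"
proof (cases "t = 0")
  case True
  then have "T t = L2_rep m" by (auto simp: fun_eq_iff)
  then show ?thesis using markov_rep_op by simp
next
  case False
  then have t': "0 < t" using t by simp
  show ?thesis
  proof (rule markov_limit[where E = "\<lambda>n x. (J (t / real (Suc n)) ^^ Suc n) x"])
    show "markov_op (\<lambda>x. (J (t / real (Suc n)) ^^ Suc n) x)" for n
      using t' by (intro markov_J_funpow) simp
    show "(\<lambda>n. nm ((J (t / real (Suc n)) ^^ Suc n) x - T t x)) \<longlonglongrightarrow> 0" for x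
      by (rule T_exponential_formula[OF t'])
  qed (use T_contr[OF t] T_P[OF t] T_sym[OF t] in auto)
qed

end

section \<open>Conservation of mass\<close>

context L2_space
begin

definition mass_loss :: "(('a \<Rightarrow> real) \<Rightarrow> 'a \<Rightarrow> real) \<Rightarrow> ('a \<Rightarrow> real) \<Rightarrow> real" where
  "mass_loss S f = (\<integral>x. f x \<partial>m) - (\<integral>x. S f x \<partial>m)"

lemma mass_loss_nonneg: "markov_op S \<Longrightarrow> pos_L12 f \<Longrightarrow> 0 \<le> mass_loss S f"
  using markov_mass(2)[of S f] by (simp add: mass_loss_def)

lemma pos_L12_scale: assumes "pos_L12 f" "0 \<le> c" shows "pos_L12 (c *\<^sub>R f)"
proof -
  have "integrable m (\<lambda>x. c * f x)" using assms by (auto simp: pos_L12_def)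
  then have "integrable m (c *\<^sub>R f)" unfolding fun_scale_eq[symmetric] .
  moreover have "AE x in m. 0 \<le> (c *\<^sub>R f) x"
    using pos_L12D(3)[OF assms(1)] by eventually_elim (use assms(2) in simp)
  ultimately show ?thesis using assms by (simp add: pos_L12_def)
qed

lemma mass_loss_add:
  assumes S: "markov_op S" and f: "pos_L12 f" and g: "pos_L12 g"
  shows "mass_loss S (f + g) = mass_loss S f + mass_loss S g"
  using pos_L12D(2)[OF f] pos_L12D(2)[OF g] pos_L12D(2)[OF markov_mass(1)[OF S f]] pos_L12D(2)[OF markov_mass(1)[OF S g]]
  by (simp add: mass_loss_def contr_add[OF markov_contr[OF S]])

lemma mass_loss_scale:
  assumes S: "markov_op S" shows "mass_loss S (c *\<^sub>R f) = c * mass_loss S f"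
  by (simp add: mass_loss_def contr_scale[OF markov_contr[OF S]] right_diff_distrib)

lemma mass_loss_rep: "markov_op S \<Longrightarrow> pos_L12 f \<Longrightarrow> mass_loss S (L2_rep m f) = mass_loss S f"
  by (simp add: mass_loss_def pos_L12_rep markov_arg_rep)

text \<open>The losses of \<open>f\<close> and of \<open>c g - f \<ge> 0\<close> are nonnegative and add up to \<open>c\<close> times that of
  \<open>g\<close>.\<close>
lemma mass_loss_hereditary:
  assumes S: "markov_op S" and f: "pos_L12 f" and g: "pos_L12 g" and c: "0 \<le> c"
    and le: "AE x in m. f x \<le> c * g x" and loss: "mass_loss S g = 0"
  shows "mass_loss S f = 0"
proof -
  let ?d = "c *\<^sub>R g - f"
  have "integrable m (\<lambda>x. c * g x - f x)" using pos_L12D[OF f] pos_L12D[OF g] by auto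
  then have di: "integrable m ?d" by (simp add: fun_diff_def)
  have d: "pos_L12 ?d"
    unfolding pos_L12_def using pos_L12D(1)[OF f] pos_L12D(1)[OF g] di le by auto
  have "c *\<^sub>R g = f + ?d" by simp
  then have "mass_loss S (c *\<^sub>R g) = mass_loss S (f + ?d)" by (simp only:)
  then have "c * mass_loss S g = mass_loss S f + mass_loss S ?d"
    by (simp only: mass_loss_add[OF S f d] mass_loss_scale[OF S])
  then show ?thesis using loss mass_loss_nonneg[OF S f] mass_loss_nonneg[OF S d] by simp
qed

lemma markov_funpow_mass: "markov_op S \<Longrightarrow> pos_L12 f \<Longrightarrow> pos_L12 ((S ^^ n) f)"
  by (induction n) (auto intro: markov_mass(1))

end

context dirichlet_space
begin

lemma T_mass: "0 \<le> t \<Longrightarrow> pos_L12 f \<Longrightarrow> pos_L12 (T t f)"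
  "0 \<le> t \<Longrightarrow> pos_L12 f \<Longrightarrow> (\<integral>x. T t f x \<partial>m) \<le> (\<integral>x. f x \<partial>m)"
  using markov_mass[OF markov_T] by auto

lemma T_mass_antimono:
  assumes "0 \<le> s" "s \<le> t" "pos_L12 f" shows "(\<integral>x. T t f x \<partial>m) \<le> (\<integral>x. T s f x \<partial>m)"
proof -
  have "T t f = T (t - s) (T s f)" using T_plus[of "t - s" s f] assms by simp
  then show ?thesis using T_mass[of "t - s" "T s f"] T_mass[of s f] assms by simp
qed

text \<open>Testing \<open>T\<^sub>t 1\<close> against nonnegative integrable \<open>f\<close>: by symmetry \<open>f\<close> lives on the conservative set
  if and only if the semigroup preserves its mass.\<close>
definition conserved :: "('a \<Rightarrow> real) \<Rightarrow> bool" where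
  "conserved f \<longleftrightarrow> pos_L12 f \<and> (\<forall>t\<ge>0. (\<integral>x. T t f x \<partial>m) = (\<integral>x. f x \<partial>m))"

lemma conservedI:
  assumes f: "pos_L12 f" and unb: "\<And>t. 0 \<le> t \<Longrightarrow> \<exists>s\<ge>t. (\<integral>x. T s f x \<partial>m) = (\<integral>x. f x \<partial>m)"
  shows "conserved f"
  unfolding conserved_def
proof (intro conjI allI impI f)
  fix t :: real assume t: "0 \<le> t"
  from unb[OF t] obtain s where "t \<le> s" "(\<integral>x. T s f x \<partial>m) = (\<integral>x. f x \<partial>m)" by blast
  then show "(\<integral>x. T t f x \<partial>m) = (\<integral>x. f x \<partial>m)"
    using T_mass_antimono[OF t _ f, of s] T_mass(2)[OF t f] by linarith
qed

lemma conserved_T: assumes t: "0 \<le> t" and f: "conserved f" shows "conserved (T t f)"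
  unfolding conserved_def
proof (intro conjI allI impI)
  show "pos_L12 (T t f)" using f t by (simp add: conserved_def T_mass)
  fix s :: real assume s: "0 \<le> s"
  have "(\<integral>x. T s (T t f) x \<partial>m) = (\<integral>x. T (s + t) f x \<partial>m)" using T_plus[OF s t] by simp
  also have "\<dots> = (\<integral>x. f x \<partial>m)" using f s t by (simp add: conserved_def)
  also have "\<dots> = (\<integral>x. T t f x \<partial>m)" using f t by (simp add: conserved_def)
  finally show "(\<integral>x. T s (T t f) x \<partial>m) = (\<integral>x. T t f x \<partial>m)" .
qed

lemma ip_T_phi_bounds:
  assumes t: "0 \<le> t" and f: "pos_L12 f"
  shows "0 \<le> L2_ip m (T t f) (phi k)" "L2_ip m (T t f) (phi k) \<le> (\<integral>x. T t f x \<partial>m)"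
proof -
  note g = T_mass(1)[OF t f]
  have "AE x in m. 0 \<le> T t f x * phi k x"
    using pos_L12D(3)[OF g] phi_AE[of k] by eventually_elim simp
  then have "0 \<le> (\<integral>x. T t f x * phi k x \<partial>m)" by (rule integral_nonneg_AE)
  then show "0 \<le> L2_ip m (T t f) (phi k)" using pos_L12D(1)[OF g] by (simp add: L2_ip_eq phi_L2 L2_inner_def)
  show "L2_ip m (T t f) (phi k) \<le> (\<integral>x. T t f x \<partial>m)"
    by (rule ip_le_integral[OF g phi_L2]) (use phi_AE[of k] in auto)
qed

lemma exp_weight_integral:
  fixes h N :: real assumes "0 < h" "0 \<le> N" shows "((\<lambda>s. exp (- s / h) / h) has_integral (1 - exp (- N / h))) {0..N}"
proof -
  have "((\<lambda>s. exp (- s / h) / h) has_integral (- exp (- N / h) - - exp (- 0 / h))) {0..N}"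
  proof (rule fundamental_theorem_of_calculus[OF assms(2)])
    fix s
    have "((\<lambda>s. - exp (- s / h)) has_real_derivative exp (- s / h) / h) (at s within {0..N})"
      by (rule derivative_eq_intros refl | use assms in simp)+
    then show "((\<lambda>s. - exp (- s / h)) has_vector_derivative exp (- s / h) / h) (at s within {0..N})"
      by (simp add: has_real_derivative_iff_has_vector_derivative)
  qed
  then show ?thesis by simp
qed

text \<open>The resolvent averages the semigroup with total weight one, so it preserves the mass of \<open>f\<close>
  exactly when the semigroup does so at all times.\<close>
lemma conserved_iff_J:
  assumes h: "0 < h" and f: "pos_L12 f"
  shows "conserved f \<longleftrightarrow> (\<integral>x. J h f x \<partial>m) = (\<integral>x. f x \<partial>m)"
proof
  let ?M = "\<integral>x. f x \<partial>m"
  note Jf = markov_mass[OF markov_J[OF h] f]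
  {
    assume c: "conserved f"
    have "(1 - exp (- N / h)) * ?M \<le> (\<integral>x. J h f x \<partial>m)" if N: "0 \<le> N" for N
    proof -
      let ?F = "\<lambda>k s. exp (- s / h) / h * L2_ip m (T s f) (phi k)"
      have w: "((\<lambda>s. exp (- s / h) / h * ?M) has_integral ((1 - exp (- N / h)) * ?M)) {0..N}"
        by (rule has_integral_mult_left[OF exp_weight_integral[OF h N]])
      have L: "(?F k has_integral (L2_ip m (J h f) (phi k) - exp (- N / h) * L2_ip m (T N (J h f)) (phi k))) {0..N}" for k
        by (rule resolvent_laplace[OF h N])
      have "(\<lambda>k. integral {0..N} (?F k)) \<longlonglongrightarrow> integral {0..N} (\<lambda>s. exp (- s / h) / h * ?M)"
      proof (rule dominated_convergence)
        show "?F k integrable_on {0..N}" for k using L by blast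
        show "(\<lambda>s. exp (- s / h) / h * ?M) integrable_on {0..N}" using w by blast
        show "norm (?F k s) \<le> exp (- s / h) / h * ?M" if "s \<in> {0..N}" for k s
        proof -
          have s: "0 \<le> s" using that by simp
          have "L2_ip m (T s f) (phi k) \<le> ?M" using ip_T_phi_bounds(2)[OF s f, of k] T_mass(2)[OF s f] by linarith
          then show ?thesis using ip_T_phi_bounds(1)[OF s f, of k] h by (auto simp: abs_mult intro!: mult_left_mono divide_right_mono)
        qed
        show "(\<lambda>k. ?F k s) \<longlonglongrightarrow> exp (- s / h) / h * ?M" if "s \<in> {0..N}" for s
        proof -
          have s: "0 \<le> s" using that by simp
          have "(\<lambda>k. L2_ip m (T s f) (phi k)) \<longlonglongrightarrow> (\<integral>x. T s f x \<partial>m)"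
            using pos_L12D[OF T_mass(1)[OF s f]] by (intro ip_phi_tendsto_integral)
          also have "(\<integral>x. T s f x \<partial>m) = ?M" using c s by (simp add: conserved_def)
          finally show ?thesis by (intro tendsto_intros)
        qed
      qed
      then have lim: "(\<lambda>k. L2_ip m (J h f) (phi k) - exp (- N / h) * L2_ip m (T N (J h f)) (phi k)) \<longlonglongrightarrow> (1 - exp (- N / h)) * ?M"
        using integral_unique[OF L] integral_unique[OF w] by simp
      show ?thesis
      proof (rule LIMSEQ_le[OF lim ip_phi_tendsto_integral])
        show "J h f \<in> L2 m" "integrable m (J h f)" using pos_L12D[OF Jf(1)] by auto
        show "\<exists>K. \<forall>k\<ge>K. L2_ip m (J h f) (phi k) - exp (- N / h) * L2_ip m (T N (J h f)) (phi k) \<le> L2_ip m (J h f) (phi k)"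
          using ip_T_phi_bounds(1)[OF N Jf(1)] by simp
      qed
    qed
    note low = this
    have "?M \<le> (\<integral>x. J h f x \<partial>m)"
    proof (rule LIMSEQ_le_const2)
      have "(\<lambda>n. exp (- 1 / h) ^ n) \<longlonglongrightarrow> 0" using h by (intro LIMSEQ_power_zero) simp
      then have "(\<lambda>n. exp (- real n / h)) \<longlonglongrightarrow> 0" by (simp add: exp_of_nat_mult[symmetric])
      then have "(\<lambda>n. (1 - exp (- real n / h)) * ?M) \<longlonglongrightarrow> (1 - 0) * ?M" by (intro tendsto_intros)
      then show "(\<lambda>n. (1 - exp (- real n / h)) * ?M) \<longlonglongrightarrow> ?M" by simp
      show "\<exists>N. \<forall>n\<ge>N. (1 - exp (- real n / h)) * ?M \<le> (\<integral>x. J h f x \<partial>m)" using low by simp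
    qed
    then show "(\<integral>x. J h f x \<partial>m) = ?M" using Jf(2) by simp
  }
  {
    assume eq: "(\<integral>x. J h f x \<partial>m) = ?M"
    show "conserved f"
    proof (rule conservedI[OF f])
      fix s :: real assume s: "0 \<le> s"
      let ?e = "exp (- s / h)" and ?M' = "\<integral>x. T s f x \<partial>m"
      have "L2_ip m (J h f) (phi k) \<le> (1 - ?e) * ?M + ?e * ?M'" for k
      proof -
        have "L2_ip m (J h f) (phi k) - ?e * L2_ip m (T s (J h f)) (phi k) \<le> (1 - ?e) * ?M"
        proof (rule has_integral_le[OF resolvent_laplace[OF h s] has_integral_mult_left[OF exp_weight_integral[OF h s]]])
          fix r assume r: "r \<in> {0..s}"
          then have r0: "0 \<le> r" by simp
          have "L2_ip m (T r f) (phi k) \<le> ?M" using ip_T_phi_bounds(2)[OF r0 f, of k] T_mass(2)[OF r0 f] by linarith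
          then show "exp (- r / h) / h * L2_ip m (T r f) (phi k) \<le> exp (- r / h) / h * ?M"
            using h by (intro mult_left_mono) auto
        qed
        moreover have "L2_ip m (T s (J h f)) (phi k) \<le> ?M'"
        proof -
          note g = T_mass(1)[OF s f]
          have "L2_ip m (T s (J h f)) (phi k) = L2_ip m (J h (T s f)) (phi k)" using T_J_commute[OF s h] by simp
          also have "\<dots> \<le> (\<integral>x. J h (T s f) x \<partial>m)"
            by (rule ip_le_integral[OF markov_mass(1)[OF markov_J[OF h] g] phi_L2]) (use phi_AE[of k] in auto)
          also have "\<dots> \<le> ?M'" by (rule markov_mass(2)[OF markov_J[OF h] g])
          finally show ?thesis .
        qed
        then have "?e * L2_ip m (T s (J h f)) (phi k) \<le> ?e * ?M'" by (intro mult_left_mono) auto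
        ultimately show ?thesis by linarith
      qed
      moreover have "(\<lambda>k. L2_ip m (J h f) (phi k)) \<longlonglongrightarrow> ?M"
        using ip_phi_tendsto_integral[of "J h f"] pos_L12D[OF Jf(1)] eq by simp
      ultimately have "?M \<le> (1 - ?e) * ?M + ?e * ?M'" by (intro LIMSEQ_le_const2) auto
      then have "?e * ?M \<le> ?e * ?M'" by (simp add: algebra_simps)
      then have "?M \<le> ?M'" by simp
      then have "?M' = ?M" using T_mass(2)[OF s f] by simp
      then show "\<exists>r\<ge>s. (\<integral>x. T r f x \<partial>m) = ?M" by blast
    qed
  }
qed

lemma conserved_J: assumes h: "0 < h" and f: "conserved f" shows "conserved (J h f)" "(\<integral>x. J h f x \<partial>m) = (\<integral>x. f x \<partial>m)"
proof -
  have fp: "pos_L12 f" using f by (simp add: conserved_def)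
  have eq: "(\<integral>x. J h g x \<partial>m) = (\<integral>x. g x \<partial>m)" if "conserved g" for g
    using conserved_iff_J[OF h, of g] that by (simp add: conserved_def)
  show "(\<integral>x. J h f x \<partial>m) = (\<integral>x. f x \<partial>m)" by (rule eq[OF f])
  show "conserved (J h f)"
    unfolding conserved_def
  proof (intro conjI allI impI)
    show "pos_L12 (J h f)" by (rule markov_mass(1)[OF markov_J[OF h] fp])
    fix t :: real assume t: "0 \<le> t"
    have "(\<integral>x. T t (J h f) x \<partial>m) = (\<integral>x. T t f x \<partial>m)"
      using eq[OF conserved_T[OF t f]] T_J_commute[OF t h] by simp
    also have "\<dots> = (\<integral>x. J h f x \<partial>m)" using f t eq[OF f] by (simp add: conserved_def)
    finally show "(\<integral>x. T t (J h f) x \<partial>m) = (\<integral>x. J h f x \<partial>m)" .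
  qed
qed

subsection \<open>The conservative set\<close>

abbreviation tau :: "real \<Rightarrow> 'a \<Rightarrow> real" where "tau s \<equiv> semigroup_Linf m Q s (\<lambda>y. 1)"

lemma tau_eq: "tau s x = lim (\<lambda>k. U s (phi k) x) - U s (\<lambda>y. 0) x"
proof -
  have "lim (\<lambda>k::nat. U s (\<lambda>y. 0) x) = U s (\<lambda>y. 0) x" by (rule limI) simp
  then show ?thesis by (simp add: semigroup_Linf_def)
qed

lemma tau_measurable: assumes "0 \<le> s" shows "tau s \<in> borel_measurable m"
proof -
  have [measurable]: "U s (phi k) \<in> borel_measurable m" "U s (\<lambda>y. 0) \<in> borel_measurable m" for k
    using U_L2[OF assms phi_L2] U_L2[OF assms L2_zero] L2D(1) by auto
  show ?thesis unfolding tau_eq[abs_def] by measurable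
qed

text \<open>\<open>tau s\<close> is \<open>T\<^sub>s 1\<close>, the increasing limit of \<open>T\<^sub>s \<phi>\<^sub>k\<close>. The definition subtracts the
  contribution of the negative part of \<open>1\<close>, which vanishes almost everywhere.\<close>
lemma tau_props:
  assumes s: "0 \<le> s"
  shows "AE x in m. 0 \<le> tau s x \<and> tau s x \<le> 1 \<and> (\<lambda>k. T s (phi k) x) \<longlonglongrightarrow> tau s x"
proof -
  have z: "AE x in m. U s (\<lambda>y. 0) x = 0"
  proof -
    have "AE x in m. U s (0 *\<^sub>R (\<lambda>y. 0)) x = 0 * U s (\<lambda>y. 0) x" by (rule U_scale[OF s L2_zero])
    moreover have "0 *\<^sub>R (\<lambda>y. 0) = (\<lambda>y::'a. 0::real)" by (simp add: fun_eq_iff)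
    ultimately show ?thesis by simp
  qed
  have a: "AE x in m. \<forall>k. U s (phi k) x = T s (phi k) x"
    unfolding AE_all_countable using T_AE_U[OF s phi_L2] by blast
  have b: "AE x in m. \<forall>k. 0 \<le> T s (phi k) x \<and> T s (phi k) x \<le> 1"
    unfolding AE_all_countable using markov_unit[OF markov_T[OF s] phi_L2 phi_AE] by blast
  have c: "AE x in m. \<forall>k. T s (phi k) x \<le> T s (phi (Suc k)) x"
    unfolding AE_all_countable
    using phi_mono_Suc by (intro allI markov_mono[OF markov_T[OF s] phi_L2 phi_L2] AE_I2)
  show ?thesis
    using z a b c
  proof eventually_elim
    case (elim x)
    have inc: "incseq (\<lambda>k. T s (phi k) x)" using elim(4) by (intro incseq_SucI) blast
    obtain l where l: "(\<lambda>k. T s (phi k) x) \<longlonglongrightarrow> l"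
      by (rule incseq_convergent[OF inc, of 1]) (use elim(3) in auto)
    then have "tau s x = l" using elim(1,2) by (simp add: tau_eq limI)
    moreover have "0 \<le> l" by (rule LIMSEQ_le_const[OF l]) (use elim(3) in auto)
    moreover have "l \<le> 1" by (rule LIMSEQ_le_const2[OF l]) (use elim(3) in auto)
    ultimately show ?case using l by simp
  qed
qed

text \<open>Symmetry in the limit: \<open>\<integral> T\<^sub>s f = (f, T\<^sub>s 1)\<close>.\<close>
lemma mass_T_eq:
  assumes s: "0 \<le> s" and f: "pos_L12 f"
  shows "integrable m (\<lambda>x. f x * tau s x)" "(\<integral>x. T s f x \<partial>m) = (\<integral>x. f x * tau s x \<partial>m)"
proof -
  have fm [measurable]: "f \<in> borel_measurable m" using L2D(1)[OF pos_L12D(1)[OF f]] .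
  have tm [measurable]: "tau s \<in> borel_measurable m" by (rule tau_measurable[OF s])
  have Tm [measurable]: "T s (phi k) \<in> borel_measurable m" for k using L2D(1)[OF markov_L2[OF markov_T[OF s]]] .
  show "integrable m (\<lambda>x. f x * tau s x)"
  proof (rule Bochner_Integration.integrable_bound[OF pos_L12D(2)[OF f]])
    show "AE x in m. norm (f x * tau s x) \<le> norm (f x)"
      using tau_props[OF s] by eventually_elim (auto simp: abs_mult intro!: mult_left_le)
  qed measurable
  have "(\<lambda>k. \<integral>x. f x * T s (phi k) x \<partial>m) \<longlonglongrightarrow> (\<integral>x. f x * tau s x \<partial>m)"
  proof (rule integral_dominated_convergence[where w = "\<lambda>x. \<bar>f x\<bar>"])
    show "AE x in m. (\<lambda>k. f x * T s (phi k) x) \<longlonglongrightarrow> f x * tau s x"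
      using tau_props[OF s] by eventually_elim (intro tendsto_intros, simp)
    show "AE x in m. norm (f x * T s (phi k) x) \<le> \<bar>f x\<bar>" for k
      using markov_unit[OF markov_T[OF s] phi_L2 phi_AE, of k]
      by eventually_elim (auto simp: abs_mult intro!: mult_left_le)
  qed (use pos_L12D(2)[OF f] in auto)
  moreover have "(\<integral>x. f x * T s (phi k) x \<partial>m) = L2_ip m (T s f) (phi k)" for k
    using T_sym[OF s, of f "phi k"] pos_L12D(1)[OF f] markov_L2[OF markov_T[OF s]] by (simp add: L2_ip_eq L2_inner_def)
  moreover have "(\<lambda>k. L2_ip m (T s f) (phi k)) \<longlonglongrightarrow> (\<integral>x. T s f x \<partial>m)"
    using pos_L12D[OF T_mass(1)[OF s f]] by (intro ip_phi_tendsto_integral)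
  ultimately show "(\<integral>x. T s f x \<partial>m) = (\<integral>x. f x * tau s x \<partial>m)" using LIMSEQ_unique by simp
qed

lemma mass_T_preserved_iff:
  assumes s: "0 \<le> s" and f: "pos_L12 f"
  shows "(\<integral>x. T s f x \<partial>m) = (\<integral>x. f x \<partial>m) \<longleftrightarrow> (AE x in m. f x = 0 \<or> tau s x = 1)"
proof -
  have i: "integrable m (\<lambda>x. f x - f x * tau s x)" using mass_T_eq(1)[OF s f] pos_L12D(2)[OF f] by simp
  have p: "AE x in m. 0 \<le> f x - f x * tau s x"
    using tau_props[OF s] pos_L12D(3)[OF f] by eventually_elim (simp add: mult_left_le)
  have "(\<integral>x. T s f x \<partial>m) = (\<integral>x. f x \<partial>m) \<longleftrightarrow> (\<integral>x. f x - f x * tau s x \<partial>m) = 0"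
    using mass_T_eq[OF s f] pos_L12D(2)[OF f] by auto
  also have "\<dots> \<longleftrightarrow> (AE x in m. f x - f x * tau s x = 0)"
    by (rule integral_nonneg_eq_0_iff_AE[OF i p])
  also have "\<dots> \<longleftrightarrow> (AE x in m. f x = 0 \<or> tau s x = 1)"
    by (rule AE_cong) auto
  finally show ?thesis .
qed

lemma X_cons_sets: "X_cons m Q \<in> sets m"
proof -
  have "{x \<in> space m. tau (real k) x = 1} \<in> sets m" for k
  proof -
    have [measurable]: "tau (real k) \<in> borel_measurable m" by (rule tau_measurable) simp
    show ?thesis by measurable
  qed
  then show ?thesis unfolding X_cons_def by (intro sets.countable_INT') auto
qed

lemma conserved_iff_X_cons:
  assumes f: "pos_L12 f" shows "conserved f \<longleftrightarrow> (AE x in m. x \<notin> X_cons m Q \<longrightarrow> f x = 0)"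
proof -
  have "conserved f \<longleftrightarrow> (\<forall>k\<in>{1::nat..}. (\<integral>x. T (real k) f x \<partial>m) = (\<integral>x. f x \<partial>m))"
  proof
    assume k: "\<forall>k\<in>{1::nat..}. (\<integral>x. T (real k) f x \<partial>m) = (\<integral>x. f x \<partial>m)"
    show "conserved f"
    proof (rule conservedI[OF f])
      fix t :: real
      obtain n :: nat where n: "t \<le> real n" using real_arch_simple by blast
      then have "t \<le> real (Suc n)" by simp
      then show "\<exists>s\<ge>t. (\<integral>x. T s f x \<partial>m) = (\<integral>x. f x \<partial>m)"
        using k by (intro exI[of _ "real (Suc n)"]) (simp del: of_nat_Suc)
    qed
  qed (auto simp: conserved_def)
  also have "\<dots> \<longleftrightarrow> (\<forall>k\<in>{1::nat..}. AE x in m. f x = 0 \<or> tau (real k) x = 1)"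
    using mass_T_preserved_iff[OF _ f] by simp
  also have "\<dots> \<longleftrightarrow> (AE x in m. \<forall>k\<in>{1::nat..}. f x = 0 \<or> tau (real k) x = 1)"
    by (rule AE_ball_countable[symmetric]) simp
  also have "\<dots> \<longleftrightarrow> (AE x in m. x \<notin> X_cons m Q \<longrightarrow> f x = 0)"
    by (rule AE_cong) (auto simp: X_cons_def)
  finally show ?thesis .
qed

lemma pos_L12_indicator_phi:
  assumes "Y \<in> sets m" shows "pos_L12 (\<lambda>x. indicator Y x * phi 0 x)"
proof -
  have "integrable m (\<lambda>x. indicator Y x * phi 0 x)"
    using integrable_mult_indicator[OF assms phi_integrable[of 0]] by simp
  moreover have "AE x in m. 0 \<le> indicator Y x * phi 0 x" using phi_AE[of 0] by eventually_elim simp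
  ultimately show ?thesis using L2_indicator[OF phi_L2 assms, of 0] by (simp add: pos_L12_def)
qed

lemma conserved_phi: "conserved (\<lambda>x. indicator (X_cons m Q) x * phi 0 x)"
  using conserved_iff_X_cons[OF pos_L12_indicator_phi[OF X_cons_sets]] by simp

subsection \<open>Invariance of the conservative set\<close>

text \<open>For \<open>f \<ge> 0\<close> test \<open>T\<^sub>t f\<close> against \<open>g = 1\<^sub>Y \<phi>\<^sub>0\<close>, where \<open>Y\<close> is the conservative set: \<open>T\<^sub>t g\<close>
  again lives on \<open>Y\<close>, so \<open>(T\<^sub>t f, g) = (f, T\<^sub>t g) = 0\<close>, and \<open>g > 0\<close> on \<open>Y\<close>. In general use
  \<open>|T\<^sub>t f| \<le> T\<^sub>t |f|\<close>.\<close>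
lemma T_preserves_diss:
  assumes t: "0 \<le> t" and f: "f \<in> L2 m" and z: "AE x in m. x \<in> X_cons m Q \<longrightarrow> f x = 0"
  shows "AE x in m. x \<in> X_cons m Q \<longrightarrow> T t f x = 0"
proof -
  let ?Y = "X_cons m Q" and ?a = "\<lambda>x. \<bar>f x\<bar>" and ?g = "\<lambda>x. indicator (X_cons m Q) x * phi 0 x"
  have a: "?a \<in> L2 m" by (rule L2_dominated[OF f]) (use L2D(1)[OF f] in auto)
  have g: "pos_L12 ?g" by (rule pos_L12_indicator_phi[OF X_cons_sets])
  have Tg: "AE x in m. x \<notin> ?Y \<longrightarrow> T t ?g x = 0"
    using conserved_T[OF t conserved_phi] conserved_iff_X_cons[OF T_mass(1)[OF t g]] by simp
  have "L2_ip m (T t ?a) ?g = L2_ip m ?a (T t ?g)" by (rule T_sym[OF t])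
  also have "\<dots> = (\<integral>x. ?a x * T t ?g x \<partial>m)" using a markov_L2[OF markov_T[OF t]] by (simp add: L2_ip_eq L2_inner_def)
  also have "\<dots> = 0"
  proof (rule integral_eq_zero_AE)
    show "AE x in m. ?a x * T t ?g x = 0" using z Tg by eventually_elim auto
  qed
  finally have "L2_ip m (T t ?a) ?g = 0" .
  then have "(\<integral>x. T t ?a x * ?g x \<partial>m) = 0"
    using pos_L12D(1)[OF g] markov_L2[OF markov_T[OF t]] by (simp add: L2_ip_eq L2_inner_def)
  moreover have Ta: "AE x in m. 0 \<le> T t ?a x" by (rule markov_pos[OF markov_T[OF t] a]) auto
  then have "AE x in m. 0 \<le> T t ?a x * ?g x" using pos_L12D(3)[OF g] by eventually_elim simp
  ultimately have z': "AE x in m. T t ?a x * ?g x = 0"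
    using integral_nonneg_eq_0_iff_AE[OF L2_product_integrable[OF markov_L2[OF markov_T[OF t]] pos_L12D(1)[OF g]]] by simp
  have "AE x in m. 0 \<le> T t (?a + f) x" "AE x in m. 0 \<le> T t (?a - f) x"
    using a f by (auto intro!: markov_pos[OF markov_T[OF t]])
  then have "AE x in m. \<bar>T t f x\<bar> \<le> T t ?a x"
    unfolding contr_add[OF T_contr[OF t]] contr_diff[OF T_contr[OF t]] by eventually_elim auto
  then show ?thesis
    using z' AE_space
  proof eventually_elim
    case (elim x)
    then show ?case using phi_bounds(1)[of x 0] by auto
  qed
qed

text \<open>By symmetry from the previous lemma, testing against functions that vanish on the
  conservative set.\<close>
lemma T_preserves_cons:
  assumes t: "0 \<le> t" and f: "f \<in> L2 m" and z: "AE x in m. x \<notin> X_cons m Q \<longrightarrow> f x = 0"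
  shows "AE x in m. x \<notin> X_cons m Q \<longrightarrow> T t f x = 0"
proof -
  let ?Z = "space m - X_cons m Q"
  let ?h = "\<lambda>x. indicator ?Z x * T t f x"
  have TL: "T t g \<in> L2 m" for g by (rule markov_L2[OF markov_T[OF t]])
  have h: "?h \<in> L2 m" by (rule L2_indicator[OF TL]) (use X_cons_sets in auto)
  have Th: "AE x in m. x \<in> X_cons m Q \<longrightarrow> T t ?h x = 0"
    by (rule T_preserves_diss[OF t h]) auto
  have "L2_ip m (T t f) ?h = L2_ip m f (T t ?h)" by (rule T_sym[OF t])
  also have "\<dots> = (\<integral>x. f x * T t ?h x \<partial>m)" using f TL by (simp add: L2_ip_eq L2_inner_def)
  also have "\<dots> = 0"
  proof (rule integral_eq_zero_AE)
    show "AE x in m. f x * T t ?h x = 0" using z Th by eventually_elim auto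
  qed
  finally have "L2_ip m (T t f) ?h = 0" .
  moreover have "L2_ip m (T t f) ?h = L2_inner m ?h ?h"
    unfolding L2_ip_eq[OF TL h] L2_inner_def
    by (rule Bochner_Integration.integral_cong) (auto simp: indicator_def)
  ultimately have "AE x in m. ?h x = 0" using L2_norm_zero_iff[OF h] by simp
  then show ?thesis using AE_space by eventually_elim (auto simp: indicator_def split: if_splits)
qed

text \<open>\<open>1\<^sub>Y u - T\<^sub>t 1\<^sub>Y u\<close> is orthogonal to \<open>u - 1\<^sub>Y u\<close>, so \<open>(u - T\<^sub>t u, u)\<close> is the sum of the
  corresponding expressions for the two parts. Hence the approximating forms of \<open>1\<^sub>Y u\<close> are
  bounded by those of \<open>u\<close>.\<close>
theorem invariant_set_domain:
  assumes u: "u \<in> qdom Q" and Y: "Y = X_cons m Q \<or> Y = X_diss m Q"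
  shows "(\<lambda>x. indicator Y x * u x) \<in> qdom Q"
proof -
  let ?v = "\<lambda>x. indicator Y x * u x"
  have uL: "u \<in> L2 m" by (rule qdom_L2[OF u])
  have Ys: "Y \<in> sets m" using Y X_cons_sets by (auto simp: X_diss_def)
  have v: "?v \<in> L2 m" by (rule L2_indicator[OF uL Ys])
  let ?w = "u - ?v"
  have w: "?w \<in> L2 m" using uL v by simp
  have TL: "0 \<le> t \<Longrightarrow> T t g \<in> L2 m" for t g using markov_L2[OF markov_T] .
  have orth: "L2_ip m (?v - T t ?v) ?w = 0" if t: "0 \<le> t" for t
  proof -
    have "AE x in m. x \<notin> Y \<longrightarrow> T t ?v x = 0"
      using Y
    proof
      assume "Y = X_cons m Q"
      then show ?thesis using T_preserves_cons[OF t v] by auto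
    next
      assume YY: "Y = X_diss m Q"
      have "AE x in m. x \<in> X_cons m Q \<longrightarrow> T t ?v x = 0" by (rule T_preserves_diss[OF t v]) (auto simp: YY X_diss_def)
      then show ?thesis using AE_space by eventually_elim (auto simp: YY X_diss_def)
    qed
    then have "AE x in m. (?v - T t ?v) x * ?w x = 0"
      by eventually_elim (auto simp: indicator_def)
    then have "(\<integral>x. (?v - T t ?v) x * ?w x \<partial>m) = 0" by (rule integral_eq_zero_AE)
    then have "L2_inner m (?v - T t ?v) ?w = 0" unfolding L2_inner_def by simp
    then show ?thesis using v w TL[OF t] by (simp only: L2_ip_eq[OF L2_minus[OF v TL[OF t]] w])
  qed
  have "tform t (L2_rep m ?v) \<le> qbil Q (L2_rep m u) (L2_rep m u)" if t: "0 < t" for t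
  proof -
    have t0: "0 \<le> t" using t by simp
    have df: "defect_form (T t) (L2_rep m g) = defect_form (T t) g" for g
      using t0 by (simp add: defect_form_def)
    have uvw: "u = ?v + ?w" by simp
    have "defect_form (T t) u = defect_form (T t) (?v + ?w)" using uvw by (simp only:)
    also have "\<dots> = defect_form (T t) ?v + 2 * L2_ip m (?v - T t ?v) ?w + defect_form (T t) ?w"
      by (rule defect_form_add[OF T_contr[OF t0] T_sym[OF t0]])
    finally have "defect_form (T t) ?v \<le> defect_form (T t) u"
      using orth[OF t0] defect_form_nonneg[OF T_contr[OF t0], of ?w] by linarith
    then have "tform t (L2_rep m ?v) \<le> tform t (L2_rep m u)"
      unfolding tform_def df using t by (simp add: divide_right_mono)
    also have "\<dots> \<le> qbil Q (L2_rep m u) (L2_rep m u)" by (rule tform_le_form[OF t rep_in_rdom[OF u]])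
    finally show ?thesis .
  qed
  from tform_bounded_imp_dom[OF L2_rep_idem this] show ?thesis using rep_in_rdom_iff[OF v] by simp
qed

end

section \<open>Bounded Dirichlet forms\<close>

text \<open>Both approximations have this shape: \<open>c = 1 / t\<close>, \<open>S = T\<^sub>t\<close> and \<open>c = \<beta>\<close>, \<open>S = \<beta> K\<^sub>\<beta>\<close>.\<close>
definition bform :: "'a measure \<Rightarrow> real \<Rightarrow> (('a \<Rightarrow> real) \<Rightarrow> 'a \<Rightarrow> real) \<Rightarrow> 'a qform" where
  "bform m c S = \<lparr>qdom = L2 m, qval = (\<lambda>u. c * L2_inner m (\<lambda>x. u x - S u x) u)\<rparr>"

lemma qdom_bform [simp]: "qdom (bform m c S) = L2 m" by (simp add: bform_def)

text \<open>\<open>S0\<close> is \<open>S\<close> on representatives; \<open>S\<close> itself respects linearity and null sets only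
  almost everywhere.\<close>
locale bform_space = L2_space m for m :: "'a measure" +
  fixes c :: real and S S0 :: "('a \<Rightarrow> real) \<Rightarrow> 'a \<Rightarrow> real"
  assumes markov: "markov_op S0" and c_pos: "0 < c"
    and S_L2: "u \<in> L2 m \<Longrightarrow> S u \<in> L2 m"
    and S_AE: "u \<in> L2 m \<Longrightarrow> AE x in m. S u x = S0 u x"
begin

lemma qval_bform: assumes u: "u \<in> L2 m" shows "qval (bform m c S) u = c * defect_form S0 u"
proof -
  have "L2_rep m (S u) = L2_rep m (S0 u)"
    using rep_eq_iff[OF S_L2[OF u] markov_L2[OF markov]] S_AE[OF u] by blast
  then have "L2_ip m (S u) u = L2_ip m (S0 u) u" by (metis ip_P)
  moreover have "L2_inner m (\<lambda>x. u x - S u x) u = L2_ip m (u - S u) u"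
    using L2_ip_eq[OF L2_minus[OF u S_L2[OF u]] u] by (simp only: fun_minus_eq[of u "S u"])
  ultimately show ?thesis by (simp add: bform_def defect_form_def ip_diff)
qed

lemma defect_form_scale: "defect_form S0 (r *\<^sub>R u) = r\<^sup>2 * defect_form S0 u"
  by (simp add: defect_form_def contr_scale[OF markov_contr[OF markov]] ip_scale ip_scale_right power2_eq_square algebra_simps)

lemma qbil_bform:
  assumes "u \<in> L2 m" "v \<in> L2 m" shows "qbil (bform m c S) u v = c * (L2_ip m u v - L2_ip m (S0 u) v)"
proof -
  have "qbil (bform m c S) u v = (qval (bform m c S) (u + v) - qval (bform m c S) (u - v)) / 4"
    by (simp only: qbil_def fun_plus_eq[symmetric] fun_minus_eq[symmetric])
  also have "\<dots> = (c * defect_form S0 (u + v) - c * defect_form S0 (u + (-1) *\<^sub>R v)) / 4"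
    using assms by (simp add: qval_bform)
  also have "\<dots> = c * L2_ip m (u - S0 u) v"
    unfolding defect_form_add[OF markov_contr[OF markov] markov_sym[OF markov]] defect_form_scale
    by (simp only: ip_scale_right) (simp add: algebra_simps)
  finally show ?thesis by (simp only: ip_diff)
qed

text \<open>The form is bounded, so closedness is completeness of \<open>L\<^sup>2\<close>; the unit contraction
  property comes from the Markov property of \<open>S\<close>.\<close>
lemma dirichlet_bform: "dirichlet_form m (bform m c S)"
proof -
  let ?Q = "bform m c S"
  have "quadratic_form m ?Q"
    unfolding quadratic_form_def qdom_bform
  proof (intro conjI allI ballI impI)
    show "L2 m \<subseteq> L2 m" "(\<lambda>x. 0) \<in> L2 m" by (auto simp: L2_zero)
    show "(\<lambda>x. u x + v x) \<in> L2 m" if "u \<in> L2 m" "v \<in> L2 m" for u v using that by (rule L2_add)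
    show "(\<lambda>x. r * u x) \<in> L2 m" if "u \<in> L2 m" for r u using that by (rule L2_scale)
    show "v \<in> L2 m" if "v \<in> L2 m" for v using that .
    show "qval ?Q v = qval ?Q u" if u: "u \<in> L2 m" and v: "v \<in> L2 m" and ae: "AE x in m. u x = v x" for u v
    proof -
      have r: "L2_rep m u = L2_rep m v" using rep_eq_iff[OF u v] ae by blast
      have "defect_form S0 (L2_rep m w) = defect_form S0 w" for w
        by (simp add: defect_form_def markov_arg_rep[OF markov])
      then have "defect_form S0 u = defect_form S0 v" using r by metis
      then show ?thesis using u v by (simp add: qval_bform)
    qed
    show "qval ?Q (\<lambda>x. r * u x) = r\<^sup>2 * qval ?Q u" if u: "u \<in> L2 m" for r u
    proof -
      have "qval ?Q (r *\<^sub>R u) = r\<^sup>2 * qval ?Q u" using u by (simp add: qval_bform defect_form_scale)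
      then show ?thesis using fun_scale_eq[of r u] by simp
    qed
    show "qbil ?Q (\<lambda>x. u x + v x) w = qbil ?Q u w + qbil ?Q v w" if "u \<in> L2 m" "v \<in> L2 m" "w \<in> L2 m" for u v w
    proof -
      have "qbil ?Q (u + v) w = qbil ?Q u w + qbil ?Q v w"
        using that by (simp add: qbil_bform contr_add[OF markov_contr[OF markov]] ip_add algebra_simps)
      then show ?thesis using fun_plus_eq[of u v] by simp
    qed
    show "qbil ?Q (\<lambda>x. r * u x) w = r * qbil ?Q u w" if "u \<in> L2 m" "w \<in> L2 m" for r u w
    proof -
      have "qbil ?Q (r *\<^sub>R u) w = r * qbil ?Q u w"
        using that by (simp add: qbil_bform contr_scale[OF markov_contr[OF markov]] ip_scale algebra_simps)
      then show ?thesis using fun_scale_eq[of r u] by simp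
    qed
  qed
  moreover have nonneg: "0 \<le> qval ?Q u" if "u \<in> L2 m" for u
    using that c_pos defect_form_nonneg[OF markov_contr[OF markov], of u] by (simp add: qval_bform)
  moreover have "densely_defined m ?Q"
    unfolding densely_defined_def qdom_bform
  proof (intro ballI allI impI)
    fix f and \<epsilon> :: real assume "f \<in> L2 m" "0 < \<epsilon>"
    then show "\<exists>u\<in>L2 m. L2_norm m (\<lambda>x. f x - u x) < \<epsilon>"
      by (intro bexI[of _ f]) (simp_all add: L2_norm_def L2_inner_def)
  qed
  moreover have "closed_form m ?Q"
    unfolding closed_form_def qdom_bform
  proof (intro allI impI)
    fix u :: "nat \<Rightarrow> 'a \<Rightarrow> real"
    assume "\<forall>n. u n \<in> L2 m"
      and cau: "\<forall>\<epsilon>>0. \<exists>N. \<forall>i\<ge>N. \<forall>j\<ge>N. form_norm_sq m ?Q (\<lambda>x. u i x - u j x) < \<epsilon>"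
    then have u: "u n \<in> L2 m" for n by blast
    have le: "L2_inner m w w \<le> form_norm_sq m ?Q w" if "w \<in> L2 m" for w
      using nonneg[OF that] by (simp add: form_norm_sq_def L2_norm_square)
    have ge: "form_norm_sq m ?Q w \<le> (2 * c + 1) * L2_inner m w w" if w: "w \<in> L2 m" for w
    proof -
      have "- L2_ip m (S0 w) w \<le> L2_ip m w w"
      proof -
        have "- L2_ip m (S0 w) w \<le> nm (S0 w) * nm w" using ip_abs_le[of "S0 w" w] by linarith
        also have "\<dots> \<le> nm w * nm w" using contr_nm[OF markov_contr[OF markov], of w] by (intro mult_right_mono) auto
        finally show ?thesis by (simp add: ip_self power2_eq_square)
      qed
      then have "defect_form S0 w \<le> 2 * L2_inner m w w"
        using w by (simp add: defect_form_def L2_ip_eq)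
      then have "c * defect_form S0 w \<le> c * (2 * L2_inner m w w)" using c_pos by (intro mult_left_mono) auto
      then show ?thesis using w by (simp add: form_norm_sq_def qval_bform L2_norm_square algebra_simps)
    qed
    have "\<exists>w\<in>L2 m. (\<lambda>n. L2_inner m (\<lambda>x. u n x - w x) (\<lambda>x. u n x - w x)) \<longlonglongrightarrow> 0"
    proof (rule L2_complete[OF u])
      fix \<epsilon> :: real assume "0 < \<epsilon>"
      with cau obtain N where "\<forall>i\<ge>N. \<forall>j\<ge>N. form_norm_sq m ?Q (\<lambda>x. u i x - u j x) < \<epsilon>" by blast
      then show "\<exists>N. \<forall>i\<ge>N. \<forall>j\<ge>N. L2_inner m (\<lambda>x. u i x - u j x) (\<lambda>x. u i x - u j x) < \<epsilon>"
        using le[OF L2_diff[OF u u]] by (meson le_less_trans)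
    qed
    then obtain w where w: "w \<in> L2 m" and lim: "(\<lambda>n. L2_inner m (\<lambda>x. u n x - w x) (\<lambda>x. u n x - w x)) \<longlonglongrightarrow> 0"
      by blast
    have "(\<lambda>n. form_norm_sq m ?Q (\<lambda>x. u n x - w x)) \<longlonglongrightarrow> 0"
    proof (rule tendsto_sandwich)
      show "\<forall>\<^sub>F n in sequentially. 0 \<le> form_norm_sq m ?Q (\<lambda>x. u n x - w x)"
        using order_trans[OF L2_inner_nonneg le[OF L2_diff[OF u w]]] by (auto intro!: always_eventually)
      show "\<forall>\<^sub>F n in sequentially. form_norm_sq m ?Q (\<lambda>x. u n x - w x) \<le> (2 * c + 1) * L2_inner m (\<lambda>x. u n x - w x) (\<lambda>x. u n x - w x)"
        using ge[OF L2_diff[OF u w]] by (auto intro!: always_eventually)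
      show "(\<lambda>n. (2 * c + 1) * L2_inner m (\<lambda>x. u n x - w x) (\<lambda>x. u n x - w x)) \<longlonglongrightarrow> 0"
        using tendsto_mult_right_zero[OF lim] .
    qed simp
    then show "\<exists>w\<in>L2 m. (\<lambda>n. form_norm_sq m ?Q (\<lambda>x. u n x - w x)) \<longlonglongrightarrow> 0" using w by blast
  qed
  moreover have "(\<lambda>x. min (max (u x) 0) 1) \<in> L2 m \<and> qval ?Q (\<lambda>x. min (max (u x) 0) 1) \<le> qval ?Q u" if u: "u \<in> L2 m" for u
    using defect_form_unit_contraction[OF markov u] u c_pos by (simp add: qval_bform)
  ultimately show ?thesis unfolding dirichlet_form_def by simp
qed

sublocale B: dirichlet_space m "bform m c S"
  by standard (rule dirichlet_bform)

text \<open>The domain is the whole of \<open>L\<^sup>2\<close>, so the weak resolvent equation identifies vectors.\<close>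
lemma resolvent_bform:
  assumes h: "0 < h"
  shows "(1 + h * c) *\<^sub>R B.J h f = L2_rep m f + (h * c) *\<^sub>R S0 (B.J h f)"
proof (rule rep_eqI_ip)
  let ?g = "B.J h f"
  have g: "?g \<in> L2 m" using rep_L2[OF B.P_J[OF h]] .
  fix w
  have "L2_rep m w \<in> B.rdom" using B.rep_in_rdom_iff[of "L2_rep m w"] by (simp add: L2_rep_idem)
  from B.J_eq[OF h this, of f]
  have "h * (c * (L2_ip m ?g (L2_rep m w) - L2_ip m (S0 ?g) (L2_rep m w))) + L2_ip m ?g (L2_rep m w) = L2_ip m f (L2_rep m w)"
    by (simp only: qbil_bform[OF g L2_rep_in])
  then show "L2_ip m ((1 + h * c) *\<^sub>R ?g) w = L2_ip m (L2_rep m f + (h * c) *\<^sub>R S0 ?g) w"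
    by (simp add: ip_scale ip_add algebra_simps)
qed (use h markov_rep[OF markov] in simp_all)

text \<open>The resolvent \<open>g\<close> of the bounded form satisfies \<open>(1 + c) g = f + c S g\<close>, so it
  dominates \<open>f\<close> up to a constant, and one direction follows from heredity. In the other, the
  loss of \<open>g\<close> is that of \<open>S\<^sup>N g\<close> times \<open>(c / (1 + c))\<^sup>N\<close>, as the terms with \<open>f\<close> lose nothing.\<close>
lemma conserved_bform_iff:
  assumes f: "pos_L12 f"
  shows "B.conserved f \<longleftrightarrow> (\<forall>n. mass_loss S0 ((S0 ^^ n) f) = 0)"
proof -
  define g where "g = B.J 1 f"
  have g: "pos_L12 g" unfolding g_def by (rule markov_mass(1)[OF B.markov_J f]) simp
  have eq: "(1 + c) *\<^sub>R g = L2_rep m f + c *\<^sub>R S0 g" using resolvent_bform[of 1 f] by (simp add: g_def)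
  have Sg: "pos_L12 (S0 g)" by (rule markov_mass(1)[OF markov g])
  have "(\<integral>x. f x \<partial>m) = (\<integral>x. g x \<partial>m) + c * mass_loss S0 g"
  proof -
    have "(\<integral>x. ((1 + c) *\<^sub>R g) x \<partial>m) = (\<integral>x. (L2_rep m f + c *\<^sub>R S0 g) x \<partial>m)" by (simp only: eq)
    then have "(1 + c) * (\<integral>x. g x \<partial>m) = (\<integral>x. L2_rep m f x \<partial>m) + c * (\<integral>x. S0 g x \<partial>m)"
      using pos_L12D(2)[OF pos_L12_rep(1)[OF f]] pos_L12D(2)[OF Sg] by simp
    then show ?thesis by (simp add: pos_L12_rep(2)[OF f] mass_loss_def algebra_simps)
  qed
  then have iff: "B.conserved f \<longleftrightarrow> mass_loss S0 g = 0"
    using B.conserved_iff_J[OF zero_less_one f] c_pos by (auto simp: g_def)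
  have ae: "AE x in m. (1 + c) * g x = f x + c * S0 g x"
  proof -
    have "((1 + c) *\<^sub>R g) x = (L2_rep m f + c *\<^sub>R S0 g) x" for x by (simp only: eq)
    then have "(1 + c) * g x = L2_rep m f x + c * S0 g x" for x by simp
    then show ?thesis using L2_rep_AE[OF pos_L12D(1)[OF f]] by (auto elim: AE_mp)
  qed
  note pn = markov_funpow_mass[OF markov]
  have eqn: "(1 + c) *\<^sub>R (S0 ^^ n) g = L2_rep m ((S0 ^^ n) f) + c *\<^sub>R (S0 ^^ Suc n) g" for n
  proof (induction n)
    case 0 then show ?case using eq by simp
  next
    case (Suc n)
    have "S0 ((1 + c) *\<^sub>R (S0 ^^ n) g) = S0 (L2_rep m ((S0 ^^ n) f) + c *\<^sub>R (S0 ^^ Suc n) g)" by (simp only: Suc)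
    then show ?case
      by (simp add: contr_add[OF markov_contr[OF markov]] contr_scale[OF markov_contr[OF markov]]
          markov_arg_rep[OF markov] markov_rep[OF markov])
  qed
  show ?thesis unfolding iff
  proof
    assume loss: "mass_loss S0 g = 0"
    have bound: "AE x in m. (S0 ^^ n) f x \<le> (1 + c) * (S0 ^^ n) g x \<and> (S0 ^^ Suc n) g x \<le> (1 + c) / c * (S0 ^^ n) g x" for n
    proof -
      have "((1 + c) *\<^sub>R (S0 ^^ n) g) x = (L2_rep m ((S0 ^^ n) f) + c *\<^sub>R (S0 ^^ Suc n) g) x" for x by (simp only: eqn)
      then have e: "(1 + c) * (S0 ^^ n) g x = L2_rep m ((S0 ^^ n) f) x + c * (S0 ^^ Suc n) g x" for x by simp
      show ?thesis
        using L2_rep_AE[OF pos_L12D(1)[OF pn[OF f, of n]]] pos_L12D(3)[OF pn[OF f, of n]] pos_L12D(3)[OF pn[OF g, of "Suc n"]]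
      proof eventually_elim
        case (elim x)
        have "0 \<le> c * (S0 ^^ Suc n) g x" using c_pos elim(3) by (intro mult_nonneg_nonneg) auto
        then have a: "(S0 ^^ n) f x \<le> (1 + c) * (S0 ^^ n) g x" using e[of x] elim(1) by linarith
        have "c * (S0 ^^ Suc n) g x \<le> (1 + c) * (S0 ^^ n) g x" using e[of x] elim(1,2) by linarith
        then have "(S0 ^^ Suc n) g x \<le> (1 + c) / c * (S0 ^^ n) g x" using c_pos by (simp add: field_simps)
        with a show ?case by blast
      qed
    qed
    have gl: "mass_loss S0 ((S0 ^^ n) g) = 0" for n
    proof (induction n)
      case (Suc n)
      show ?case
        by (rule mass_loss_hereditary[OF markov pn[OF g] pn[OF g, of n], where c = "(1 + c) / c"])
          (use bound[of n] Suc c_pos in auto)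
    qed (simp add: loss)
    show "\<forall>n. mass_loss S0 ((S0 ^^ n) f) = 0"
    proof
      fix n
      show "mass_loss S0 ((S0 ^^ n) f) = 0"
        by (rule mass_loss_hereditary[OF markov pn[OF f] pn[OF g, of n], where c = "1 + c"])
          (use bound[of n] gl[of n] c_pos in auto)
    qed
  next
    assume floss: "\<forall>n. mass_loss S0 ((S0 ^^ n) f) = 0"
    let ?r = "c / (1 + c)"
    have step: "mass_loss S0 ((S0 ^^ n) g) = ?r * mass_loss S0 ((S0 ^^ Suc n) g)" for n
    proof -
      have "(1 + c) * mass_loss S0 ((S0 ^^ n) g) = mass_loss S0 ((1 + c) *\<^sub>R (S0 ^^ n) g)"
        by (simp only: mass_loss_scale[OF markov])
      also have "\<dots> = mass_loss S0 (L2_rep m ((S0 ^^ n) f) + c *\<^sub>R (S0 ^^ Suc n) g)" by (simp only: eqn)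
      also have "\<dots> = mass_loss S0 (L2_rep m ((S0 ^^ n) f)) + mass_loss S0 (c *\<^sub>R (S0 ^^ Suc n) g)"
        using c_pos by (intro mass_loss_add[OF markov] pos_L12_rep(1) pos_L12_scale pn f g) auto
      also have "\<dots> = c * mass_loss S0 ((S0 ^^ Suc n) g)"
        using floss by (simp only: mass_loss_rep[OF markov pn[OF f]] mass_loss_scale[OF markov])
      finally show ?thesis using c_pos by (simp add: field_simps)
    qed
    have "mass_loss S0 g = ?r ^ n * mass_loss S0 ((S0 ^^ n) g)" for n
    proof (induction n)
      case (Suc n)
      then show ?case unfolding step[of n] by simp
    qed simp
    moreover have "?r ^ n * mass_loss S0 ((S0 ^^ n) g) \<le> ?r ^ n * (\<integral>x. g x \<partial>m)" for n
    proof (rule mult_left_mono)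
      have "(\<integral>x. (S0 ^^ n) g x \<partial>m) \<le> (\<integral>x. g x \<partial>m)"
      proof (induction n)
        case (Suc n)
        then show ?case using markov_mass(2)[OF markov pn[OF g, of n]] by simp
      qed simp
      moreover have "0 \<le> (\<integral>x. S0 ((S0 ^^ n) g) x \<partial>m)"
        using pos_L12D(3)[OF pn[OF g, of "Suc n"]] by (intro integral_nonneg_AE) simp
      ultimately show "mass_loss S0 ((S0 ^^ n) g) \<le> (\<integral>x. g x \<partial>m)" by (simp add: mass_loss_def)
    qed (use c_pos in simp)
    ultimately have le: "mass_loss S0 g \<le> ?r ^ n * (\<integral>x. g x \<partial>m)" for n by metis
    have "(\<lambda>n. ?r ^ n * (\<integral>x. g x \<partial>m)) \<longlonglongrightarrow> 0 * (\<integral>x. g x \<partial>m)"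
      using c_pos by (intro tendsto_intros LIMSEQ_power_zero) auto
    then have "mass_loss S0 g \<le> 0" using le by (intro LIMSEQ_le_const) auto
    then show "mass_loss S0 g = 0" using mass_loss_nonneg[OF markov g] by simp
  qed
qed

end

text \<open>A set is recovered from the functions that live on it, by way of \<open>1\<^sub>Y \<phi>\<^sub>0\<close> with
  \<open>\<phi>\<^sub>0 > 0\<close>.\<close>
lemma X_cons_cong:
  assumes "dirichlet_space m Q1" "dirichlet_space m Q2"
    and eq: "\<And>f. L2_space.pos_L12 m f \<Longrightarrow> dirichlet_space.conserved m Q1 f \<longleftrightarrow> dirichlet_space.conserved m Q2 f"
  shows "AE x in m. x \<in> X_cons m Q1 \<longleftrightarrow> x \<in> X_cons m Q2"
proof -
  interpret A: dirichlet_space m Q1 by fact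
  interpret B: dirichlet_space m Q2 by fact
  have pA: "A.pos_L12 (\<lambda>x. indicator (X_cons m Q1) x * cutoff_seq m 0 x)" by (rule A.pos_L12_indicator_phi[OF A.X_cons_sets])
  have pB: "A.pos_L12 (\<lambda>x. indicator (X_cons m Q2) x * cutoff_seq m 0 x)" by (rule A.pos_L12_indicator_phi[OF B.X_cons_sets])
  have "AE x in m. x \<notin> X_cons m Q2 \<longrightarrow> indicator (X_cons m Q1) x * cutoff_seq m 0 x = 0"
    using A.conserved_phi eq[OF pA] B.conserved_iff_X_cons[OF pA] by blast
  moreover have "AE x in m. x \<notin> X_cons m Q1 \<longrightarrow> indicator (X_cons m Q2) x * cutoff_seq m 0 x = 0"
    using B.conserved_phi eq[OF pB] A.conserved_iff_X_cons[OF pB] by blast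
  ultimately show ?thesis
    using AE_space
  proof eventually_elim
    case (elim x)
    then show ?case using A.phi_bounds(1)[of x 0] by (auto simp: indicator_def split: if_splits)
  qed
qed

section \<open>Conservative sets of the approximating forms\<close>

context dirichlet_space
begin

lemma bform_space_time: assumes t: "0 < t" shows "bform_space m (1 / t) (U t) (T t)"
proof -
  have t0: "0 \<le> t" using t by simp
  show ?thesis
    by unfold_locales (use t markov_T[OF t0] U_L2[OF t0] T_AE_U[OF t0] in auto)
qed

lemma bform_space_dy:
  assumes b: "0 < \<beta>" shows "bform_space m \<beta> (\<lambda>u x. \<beta> * form_resolvent m Q \<beta> u x) (J (1 / \<beta>))"
proof unfold_locales
  show "markov_op (J (1 / \<beta>))" using b by (intro markov_J) simp
  show "0 < \<beta>" by (rule b)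
  fix u assume u: "u \<in> L2 m"
  show "(\<lambda>x. \<beta> * form_resolvent m Q \<beta> u x) \<in> L2 m" by (rule L2_scale[OF form_resolvent_eq(1)[OF b u]])
  show "AE x in m. \<beta> * form_resolvent m Q \<beta> u x = J (1 / \<beta>) u x"
    using L2_rep_AE[OF form_resolvent_eq(1)[OF b u]] unfolding form_resolvent_eq(2)[OF b u]
    by eventually_elim (use b in \<open>auto simp: field_simps\<close>)
qed

lemma time_approx_bform: "time_approx m Q t = bform m (1 / t) (U t)"
  by (simp add: time_approx_def bform_def)

lemma dy_approx_bform: "deny_yosida_approx m Q \<beta> = bform m \<beta> (\<lambda>u x. \<beta> * form_resolvent m Q \<beta> u x)"
  by (simp add: deny_yosida_approx_def bform_def)

lemma qval_time_approx:
  assumes t: "0 < t" and u: "u \<in> L2 m" shows "qval (time_approx m Q t) u = tform t u"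
proof -
  interpret B: bform_space m "1 / t" "U t" "T t" by (rule bform_space_time[OF t])
  show ?thesis unfolding time_approx_bform B.qval_bform[OF u] by (simp add: tform_def)
qed

lemma qval_dy_approx:
  assumes b: "0 < \<beta>" and u: "u \<in> L2 m" shows "qval (deny_yosida_approx m Q \<beta>) u = env (1 / \<beta>) u"
proof -
  interpret B: bform_space m \<beta> "\<lambda>u x. \<beta> * form_resolvent m Q \<beta> u x" "J (1 / \<beta>)" by (rule bform_space_dy[OF b])
  show ?thesis unfolding dy_approx_bform B.qval_bform[OF u] by (simp add: env_def defect_form_def)
qed

text \<open>The powers of \<open>T\<^sub>t\<close> are \<open>T\<^sub>n\<^sub>t\<close>, and the mass of \<open>T\<^sub>s f\<close> decreases in \<open>s\<close>, so the
  multiples of \<open>t\<close> decide.\<close>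
lemma X_cons_time_approx:
  assumes t: "0 < t" shows "AE x in m. x \<in> X_cons m (time_approx m Q t) \<longleftrightarrow> x \<in> X_cons m Q"
proof -
  interpret B: bform_space m "1 / t" "U t" "T t" by (rule bform_space_time[OF t])
  have t0: "0 \<le> t" using t by simp
  have "B.B.conserved f \<longleftrightarrow> conserved f" if f: "pos_L12 f" for f
  proof -
    have iter: "(T t ^^ Suc n) f = T (real (Suc n) * t) f" for n by (rule T_funpow[OF t0, symmetric])
    have "(\<forall>n. mass_loss (T t) ((T t ^^ n) f) = 0) \<longleftrightarrow> conserved f"
    proof
      assume l: "\<forall>n. mass_loss (T t) ((T t ^^ n) f) = 0"
      have const: "(\<integral>x. (T t ^^ n) f x \<partial>m) = (\<integral>x. f x \<partial>m)" for n
      proof (induction n)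
        case (Suc n)
        have "mass_loss (T t) ((T t ^^ n) f) = 0" using l by blast
        then show ?case using Suc by (simp add: mass_loss_def)
      qed simp
      show "conserved f"
      proof (rule conservedI[OF f])
        fix s :: real
        obtain n :: nat where n: "s / t \<le> real n" using real_arch_simple by blast
        then have "s \<le> real n * t" using t by (simp add: field_simps)
        also have "\<dots> \<le> real (Suc n) * t" using t by (intro mult_right_mono) auto
        finally show "\<exists>r\<ge>s. (\<integral>x. T r f x \<partial>m) = (\<integral>x. f x \<partial>m)"
          using const[of "Suc n"] unfolding iter by blast
      qed
    next
      assume c: "conserved f"
      have "conserved ((T t ^^ n) f)" for n
        by (induction n) (auto simp: c intro: conserved_T[OF t0])
      then show "\<forall>n. mass_loss (T t) ((T t ^^ n) f) = 0"
        using t0 by (simp add: mass_loss_def conserved_def)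
    qed
    then show ?thesis using B.conserved_bform_iff[OF f] by simp
  qed
  then show ?thesis
    unfolding time_approx_bform by (rule X_cons_cong[OF B.B.dirichlet_space_axioms dirichlet_space_axioms])
qed

text \<open>The first power of \<open>J\<^sub>h\<close> already decides; the other powers preserve the mass because
  \<open>J\<^sub>h\<close> maps conserved functions to conserved functions.\<close>
lemma X_cons_dy_approx:
  assumes b: "0 < \<beta>" shows "AE x in m. x \<in> X_cons m (deny_yosida_approx m Q \<beta>) \<longleftrightarrow> x \<in> X_cons m Q"
proof -
  interpret B: bform_space m \<beta> "\<lambda>u x. \<beta> * form_resolvent m Q \<beta> u x" "J (1 / \<beta>)" by (rule bform_space_dy[OF b])
  have h: "0 < 1 / \<beta>" using b by simp
  have "B.B.conserved f \<longleftrightarrow> conserved f" if f: "pos_L12 f" for f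
  proof -
    have "(\<forall>n. mass_loss (J (1 / \<beta>)) ((J (1 / \<beta>) ^^ n) f) = 0) \<longleftrightarrow> conserved f"
    proof
      assume "\<forall>n. mass_loss (J (1 / \<beta>)) ((J (1 / \<beta>) ^^ n) f) = 0"
      then have "mass_loss (J (1 / \<beta>)) ((J (1 / \<beta>) ^^ 0) f) = 0" by blast
      then show "conserved f" using conserved_iff_J[OF h f] by (simp add: mass_loss_def)
    next
      assume c: "conserved f"
      have "conserved ((J (1 / \<beta>) ^^ n) f)" for n
        by (induction n) (auto simp: c intro: conserved_J(1)[OF h])
      then show "\<forall>n. mass_loss (J (1 / \<beta>)) ((J (1 / \<beta>) ^^ n) f) = 0"
        using conserved_J(2)[OF h] by (simp add: mass_loss_def)
    qed
    then show ?thesis using B.conserved_bform_iff[OF f] by simp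
  qed
  then show ?thesis
    unfolding dy_approx_bform by (rule X_cons_cong[OF B.B.dirichlet_space_axioms dirichlet_space_axioms])
qed

section \<open>Mosco convergence\<close>

lemma weak_lim_ip:
  assumes "\<forall>n. u n \<in> L2 m" "w \<in> L2 m" "L2_weak_lim m u w" shows "(\<lambda>n. L2_ip m (u n) v) \<longlonglongrightarrow> L2_ip m w v"
proof -
  have "(\<lambda>n. L2_inner m (u n) (L2_rep m v)) \<longlonglongrightarrow> L2_inner m w (L2_rep m v)"
    using assms(3) by (simp add: L2_weak_lim_def)
  moreover have "L2_ip m z v = L2_inner m z (L2_rep m v)" if "z \<in> L2 m" for z
    using L2_ip_eq[OF that L2_rep_in, of v] by simp
  ultimately show ?thesis using assms by simp
qed

text \<open>For fixed \<open>s\<close> the functional \<open>G s\<close> passes to the weak limit, so every \<open>G s w\<close> is at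
  most the lower limit of the values \<open>F n\<close>; the supremum over \<open>s\<close> is the value of \<open>Q\<close> at
  \<open>w\<close>.\<close>
lemma mosco_lower_bound:
  fixes G :: "real \<Rightarrow> ('a \<Rightarrow> real) \<Rightarrow> real" and F :: "nat \<Rightarrow> real"
  assumes lsc: "\<And>s c. 0 < s \<Longrightarrow> c < G s w \<Longrightarrow> \<forall>\<^sub>F n in sequentially. c < G s (u n)"
    and below: "\<And>s. 0 < s \<Longrightarrow> \<forall>\<^sub>F n in sequentially. G s (u n) \<le> F n"
    and sup: "\<And>M. (\<And>s. 0 < s \<Longrightarrow> G s w \<le> M) \<Longrightarrow> w \<in> qdom Q \<and> qval Q w \<le> M"
  shows "qext Q w \<le> liminf (\<lambda>n. ereal (F n))"
proof -
  let ?l = "liminf (\<lambda>n. ereal (F n))"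
  have le: "ereal (G s w) \<le> ?l" if s: "0 < (s::real)" for s
  proof (rule ccontr)
    assume "\<not> ereal (G s w) \<le> ?l"
    then have "?l < ereal (G s w)" by simp
    then obtain c where c: "?l < ereal c" "ereal c < ereal (G s w)" using ereal_dense2 by blast
    have "\<forall>\<^sub>F n in sequentially. c < G s (u n)" using lsc[OF s] c(2) by simp
    then have "\<forall>\<^sub>F n in sequentially. ereal c \<le> ereal (F n)" using below[OF s] by eventually_elim simp
    then have "ereal c \<le> ?l" by (rule Liminf_bounded)
    then show False using c(1) by simp
  qed
  show ?thesis
  proof (cases ?l)
    case (real M)
    then have "\<And>s. 0 < s \<Longrightarrow> G s w \<le> M" using le by simp
    from sup[OF this] show ?thesis using real by (simp add: qext_def)
  next
    case MInf
    then show ?thesis using le[of 1] by simp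
  qed simp
qed

lemma time_approx_lower_bound:
  assumes t: "\<And>n. 0 < t n" "t \<longlonglongrightarrow> 0" and u: "\<forall>n. u n \<in> L2 m" and w: "w \<in> L2 m" and weak: "L2_weak_lim m u w"
  shows "qext Q w \<le> liminf (\<lambda>n. ereal (qval (time_approx m Q (t n)) (u n)))"
proof (rule mosco_lower_bound[where G = tform])
  fix s c :: real assume s: "0 < s"
  then have s0: "0 \<le> s" by simp
  {
    assume "c < tform s w"
    then have "c * s < defect_form (T s) w" using s by (simp add: tform_def field_simps)
    then have "\<forall>\<^sub>F n in sequentially. c * s < defect_form (T s) (u n)"
      by (rule defect_form_weakly_lsc[OF T_contr[OF s0] T_sym[OF s0] weak_lim_ip[OF u w weak]])
    then show "\<forall>\<^sub>F n in sequentially. c < tform s (u n)"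
      by eventually_elim (use s in \<open>simp add: tform_def field_simps\<close>)
  }
  have "\<forall>\<^sub>F n in sequentially. t n < s" using t(2) s by (rule order_tendstoD(2))
  then show "\<forall>\<^sub>F n in sequentially. tform s (u n) \<le> qval (time_approx m Q (t n)) (u n)"
  proof eventually_elim
    case (elim n)
    then show ?case using qval_time_approx[OF t(1), of "u n" n] u tform_mono[OF t(1), of n s "u n"] by simp
  qed
next
  fix M assume M: "\<And>s. 0 < s \<Longrightarrow> tform s w \<le> M"
  have "tform s (L2_rep m w) \<le> M" if "0 < s" for s
    using M[OF that] that by (simp add: tform_def defect_form_def)
  from tform_bounded_imp_dom[OF L2_rep_idem this]
  have "L2_rep m w \<in> rdom" "qbil Q (L2_rep m w) (L2_rep m w) \<le> M" by auto
  then show "w \<in> qdom Q \<and> qval Q w \<le> M"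
    using rep_in_rdom_iff[OF w] qval_rep[of w] qbil_self[OF rep_qdom, of w] by simp
qed

lemma dy_approx_lower_bound:
  assumes b: "\<And>n. 0 < \<beta> n" "filterlim \<beta> at_top sequentially"
    and u: "\<forall>n. u n \<in> L2 m" and w: "w \<in> L2 m" and weak: "L2_weak_lim m u w"
  shows "qext Q w \<le> liminf (\<lambda>n. ereal (qval (deny_yosida_approx m Q (\<beta> n)) (u n)))"
proof (rule mosco_lower_bound[where G = env])
  fix s c :: real assume s: "0 < s"
  have env: "env s v = defect_form (J s) v / s" for v by (simp add: env_def defect_form_def)
  {
    assume "c < env s w"
    then have "c * s < defect_form (J s) w" using s by (simp add: env field_simps)
    then have "\<forall>\<^sub>F n in sequentially. c * s < defect_form (J s) (u n)"
      by (rule defect_form_weakly_lsc[OF contr_J[OF s] J_sym[OF s] weak_lim_ip[OF u w weak]])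
    then show "\<forall>\<^sub>F n in sequentially. c < env s (u n)"
      by eventually_elim (use s in \<open>simp add: env field_simps\<close>)
  }
  have "\<forall>\<^sub>F n in sequentially. 1 / s \<le> \<beta> n" using b(2) by (simp add: filterlim_at_top)
  then show "\<forall>\<^sub>F n in sequentially. env s (u n) \<le> qval (deny_yosida_approx m Q (\<beta> n)) (u n)"
  proof eventually_elim
    case (elim n)
    have "1 / \<beta> n \<le> s" using elim s b(1)[of n] by (simp add: field_simps)
    then show ?case using qval_dy_approx[OF b(1), of "u n" n] u env_mono[of "1 / \<beta> n" s "u n"] b(1)[of n] by simp
  qed
next
  fix M assume M: "\<And>s. 0 < s \<Longrightarrow> env s w \<le> M"
  have "env s (L2_rep m w) \<le> M" if "0 < s" for s
    using M[OF that] that by (simp add: env_def)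
  from env_bounded_imp_dom[OF L2_rep_idem this]
  have "L2_rep m w \<in> rdom" "qbil Q (L2_rep m w) (L2_rep m w) \<le> M" by auto
  then show "w \<in> qdom Q \<and> qval Q w \<le> M"
    using rep_in_rdom_iff[OF w] qval_rep[of w] qbil_self[OF rep_qdom, of w] by simp
qed

text \<open>Restricting to \<open>Y\<close> only enlarges values to \<open>\<infinity>\<close>, so the lower bound survives once the
  weak limit is known to vanish off \<open>Y\<close>, which it does unless the lower limit is infinite.
  Constant sequences are recovery sequences, since invariance of \<open>Y\<close> puts them in the domain
  of \<open>Q\<close>.\<close>
lemma mosco_part:
  fixes a :: "nat \<Rightarrow> 'a qform"
  assumes dom: "\<And>n. qdom (a n) = L2 m"
    and Y: "Y \<in> sets m" and Y': "\<And>n. AE x in m. x \<in> Y' n \<longleftrightarrow> x \<in> Y"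
    and inv: "\<And>u. u \<in> qdom Q \<Longrightarrow> (\<lambda>x. indicator Y x * u x) \<in> qdom Q"
    and upper: "\<And>n u. u \<in> qdom Q \<Longrightarrow> qval (a n) u \<le> qval Q u"
    and lower: "\<And>u w. \<forall>n. u n \<in> L2 m \<Longrightarrow> w \<in> L2 m \<Longrightarrow> L2_weak_lim m u w \<Longrightarrow>
        qext Q w \<le> liminf (\<lambda>n. ereal (qval (a n) (u n)))"
  shows "mosco_converges m (\<lambda>n. form_part m (Y' n) (a n)) (form_part m Y Q)"
  unfolding mosco_converges_def
proof (intro conjI allI impI ballI)
  fix u w assume u: "\<forall>n. u n \<in> L2 m" and w: "w \<in> L2 m" and weak: "L2_weak_lim m u w"
  let ?G = "\<lambda>n. qext (form_part m (Y' n) (a n)) (u n)"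
  have "liminf (\<lambda>n. ereal (qval (a n) (u n))) \<le> liminf ?G"
    by (intro Liminf_mono always_eventually allI) (simp add: qext_def form_part_def)
  with lower[OF u w weak] have low: "qext Q w \<le> liminf ?G" by simp
  show "qext (form_part m Y Q) w \<le> liminf ?G"
  proof (cases "liminf ?G = \<infinity>")
    case False
    then have wD: "w \<in> qdom Q" using low by (auto simp: qext_def split: if_splits)
    let ?Z = "space m - Y"
    let ?v = "\<lambda>x. indicator ?Z x * w x"
    have v: "?v \<in> L2 m" using Y w by (intro L2_indicator) auto
    have lim: "(\<lambda>n. L2_inner m (u n) ?v) \<longlonglongrightarrow> L2_inner m w ?v" using weak v by (simp add: L2_weak_lim_def)
    have freq: "\<exists>\<^sub>F n in sequentially. L2_inner m (u n) ?v = 0"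
    proof (rule ccontr)
      assume "\<not> ?thesis"
      then have "\<forall>\<^sub>F n in sequentially. L2_inner m (u n) ?v \<noteq> 0" by (simp add: not_frequently)
      then have "\<forall>\<^sub>F n in sequentially. \<infinity> \<le> ?G n"
      proof eventually_elim
        case (elim n)
        have "u n \<notin> qdom (form_part m (Y' n) (a n))"
        proof
          assume "u n \<in> qdom (form_part m (Y' n) (a n))"
          then obtain z where "AE x in m. u n x = indicator (Y' n) x * z x" by (auto simp: form_part_def)
          then have "AE x in m. u n x * ?v x = 0"
            using Y'[of n] by eventually_elim (auto simp: indicator_def)
          then have "L2_inner m (u n) ?v = 0" unfolding L2_inner_def by (rule integral_eq_zero_AE)
          then show False using elim by simp
        qed
        then show ?case by (simp add: qext_def)
      qed
      then have "\<infinity> \<le> liminf ?G" by (rule Liminf_bounded)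
      then show False using False by simp
    qed
    have "L2_inner m w ?v = 0"
    proof (rule ccontr)
      assume "L2_inner m w ?v \<noteq> 0"
      then have "\<forall>\<^sub>F n in sequentially. L2_inner m (u n) ?v \<noteq> 0" by (rule tendsto_imp_eventually_ne[OF lim])
      then show False using freq by (simp add: frequently_def)
    qed
    moreover have "L2_inner m w ?v = L2_inner m ?v ?v"
      unfolding L2_inner_def by (rule Bochner_Integration.integral_cong) (auto simp: indicator_def)
    ultimately have "AE x in m. ?v x = 0" using L2_norm_zero_iff[OF v] by simp
    then have "AE x in m. w x = indicator Y x * w x"
      using AE_space by eventually_elim (auto simp: indicator_def split: if_splits)
    then have "w \<in> qdom (form_part m Y Q)" unfolding form_part_def using w bexI[OF _ wD] by simp
    then show ?thesis using low wD by (simp add: qext_def) (simp add: form_part_def)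
  qed simp
next
  fix w assume w: "w \<in> L2 m"
  have "limsup (\<lambda>n. qext (form_part m (Y' n) (a n)) w) \<le> qext (form_part m Y Q) w"
  proof (cases "w \<in> qdom (form_part m Y Q)")
    case True
    then obtain u where u: "u \<in> qdom Q" and ae: "AE x in m. w x = indicator Y x * u x" by (auto simp: form_part_def)
    have "AE x in m. indicator Y x * u x = w x" using ae by eventually_elim simp
    from qdom_cong[OF inv[OF u] w this] have wD: "w \<in> qdom Q" .
    have "qext (form_part m (Y' n) (a n)) w \<le> ereal (qval Q w)" for n
    proof -
      have "AE x in m. w x = indicator (Y' n) x * w x"
        using ae Y'[of n] by eventually_elim (auto simp: indicator_def)
      then have "w \<in> qdom (form_part m (Y' n) (a n))"
        unfolding form_part_def dom using w bexI[OF _ w] by simp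
      then show ?thesis using upper[OF wD, of n] by (simp add: qext_def) (simp add: form_part_def)
    qed
    then have "limsup (\<lambda>n. qext (form_part m (Y' n) (a n)) w) \<le> ereal (qval Q w)"
      by (intro Limsup_bounded always_eventually allI)
    also have "\<dots> = qext (form_part m Y Q) w" using True by (simp add: qext_def) (simp add: form_part_def)
    finally show ?thesis .
  qed (simp add: qext_def)
  moreover have "L2_lim m (\<lambda>n. w) w" by (simp add: L2_lim_def L2_norm_def L2_inner_def)
  ultimately show "\<exists>u. (\<forall>n. u n \<in> L2 m) \<and> L2_lim m u w \<and>
      limsup (\<lambda>n. qext (form_part m (Y' n) (a n)) (u n)) \<le> qext (form_part m Y Q) w"
    using w by (intro exI[of _ "\<lambda>n. w"]) simp
qed

lemma AE_X_diss:
  assumes "AE x in m. x \<in> X_cons m Q' \<longleftrightarrow> x \<in> X_cons m Q"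
  shows "AE x in m. x \<in> X_diss m Q' \<longleftrightarrow> x \<in> X_diss m Q"
  using assms by eventually_elim (auto simp: X_diss_def)

lemma X_diss_sets: "X_diss m Q \<in> sets m"
  using X_cons_sets by (auto simp: X_diss_def)

lemma mosco_time_parts:
  assumes t: "\<And>n. 0 < t n" "t \<longlonglongrightarrow> 0"
  shows "mosco_converges m (\<lambda>n. conservative_part m (time_approx m Q (t n))) (conservative_part m Q)"
    and "mosco_converges m (\<lambda>n. dissipative_part m (time_approx m Q (t n))) (dissipative_part m Q)"
proof -
  have up: "qval (time_approx m Q (t n)) u \<le> qval Q u" if u: "u \<in> qdom Q" for n u
  proof -
    have "tform (t n) u = tform (t n) (L2_rep m u)" using t(1)[of n] by (simp add: tform_def defect_form_def)
    also have "\<dots> \<le> qbil Q (L2_rep m u) (L2_rep m u)" by (rule tform_le_form[OF t(1) rep_in_rdom[OF u]])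
    also have "\<dots> = qval Q u" using qbil_self[OF rep_qdom[OF u]] qval_rep[OF u] by simp
    finally show ?thesis using qval_time_approx[OF t(1) qdom_L2[OF u]] by simp
  qed
  have dom: "qdom (time_approx m Q (t n)) = L2 m" for n by (simp add: time_approx_def)
  note low = time_approx_lower_bound[OF t]
  show "mosco_converges m (\<lambda>n. conservative_part m (time_approx m Q (t n))) (conservative_part m Q)"
    unfolding conservative_part_def
    by (rule mosco_part[OF dom X_cons_sets X_cons_time_approx[OF t(1)] invariant_set_domain up low]) auto
  show "mosco_converges m (\<lambda>n. dissipative_part m (time_approx m Q (t n))) (dissipative_part m Q)"
    unfolding dissipative_part_def
    by (rule mosco_part[OF dom X_diss_sets AE_X_diss[OF X_cons_time_approx[OF t(1)]] invariant_set_domain up low]) auto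
qed

lemma mosco_dy_parts:
  assumes b: "\<And>n. 0 < \<beta> n" "filterlim \<beta> at_top sequentially"
  shows "mosco_converges m (\<lambda>n. conservative_part m (deny_yosida_approx m Q (\<beta> n))) (conservative_part m Q)"
    and "mosco_converges m (\<lambda>n. dissipative_part m (deny_yosida_approx m Q (\<beta> n))) (dissipative_part m Q)"
proof -
  have up: "qval (deny_yosida_approx m Q (\<beta> n)) u \<le> qval Q u" if u: "u \<in> qdom Q" for n u
  proof -
    have h: "0 < 1 / \<beta> n" using b(1)[of n] by simp
    have "env (1 / \<beta> n) u = env (1 / \<beta> n) (L2_rep m u)" using h by (simp add: env_def)
    also have "\<dots> \<le> qbil Q (L2_rep m u) (L2_rep m u)" by (rule env_le_form[OF h rep_in_rdom[OF u]])
    also have "\<dots> = qval Q u" using qbil_self[OF rep_qdom[OF u]] qval_rep[OF u] by simp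
    finally show ?thesis using qval_dy_approx[OF b(1) qdom_L2[OF u]] by simp
  qed
  have dom: "qdom (deny_yosida_approx m Q (\<beta> n)) = L2 m" for n by (simp add: deny_yosida_approx_def)
  note low = dy_approx_lower_bound[OF b]
  show "mosco_converges m (\<lambda>n. conservative_part m (deny_yosida_approx m Q (\<beta> n))) (conservative_part m Q)"
    unfolding conservative_part_def
    by (rule mosco_part[OF dom X_cons_sets X_cons_dy_approx[OF b(1)] invariant_set_domain up low]) auto
  show "mosco_converges m (\<lambda>n. dissipative_part m (deny_yosida_approx m Q (\<beta> n))) (dissipative_part m Q)"
    unfolding dissipative_part_def
    by (rule mosco_part[OF dom X_diss_sets AE_X_diss[OF X_cons_dy_approx[OF b(1)]] invariant_set_domain up low]) auto
qed

end

theorem corollary4p16: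
  fixes m :: "'a::t2_space measure" and E :: "'a qform"
  assumes "radon_measure m" and "sigma_finite_measure m" and "full_support m"
    and "dirichlet_form m E"
  shows "(mosco_at_zero m (\<lambda>t. conservative_part m (time_approx m E t)) (conservative_part m E) \<and>
          mosco_at_zero m (\<lambda>t. dissipative_part m (time_approx m E t)) (dissipative_part m E)) \<and>
         (mosco_at_infinity m (\<lambda>\<beta>. conservative_part m (deny_yosida_approx m E \<beta>)) (conservative_part m E) \<and>
          mosco_at_infinity m (\<lambda>\<beta>. dissipative_part m (deny_yosida_approx m E \<beta>)) (dissipative_part m E))"
proof -
  interpret sigma_finite_measure m by fact
  interpret dirichlet_space m E by unfold_locales fact
  show ?thesis
    unfolding mosco_at_zero_def mosco_at_infinity_def
    using mosco_time_parts mosco_dy_parts by blast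
qed

end
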